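(* Let $H$ be a finite-dimensional, non-semisimple Hopf algebra over an algebraically closed field $\mathbf{k}$ whose Green ring $R=r(H)$ is commutative. If the square $S^2$ of the antipode of $H$ is an inner automorphism of $H$ and $I_{\operatorname{max}}=I_{\operatorname{proj}}$, then $R$ (with its basis of isomorphism classes of indecomposable modules) is a representation ring in the sense of Benson.
   Context: All modules are finite-dimensional left $H$-modules. The Green ring $R=r(H)$ is the abelian group generated by isomorphism classes $[V]$ of modules with relations $[U\oplus V]=[U]+[V]$ and product $[U][V]=[U\otimes V]$; it has $\mathbb{Z}$-basis the isomorphism classes of indecomposable modules, and its identity $\mathbf{1}$ is the class of the trivial module $\mathbf{k}$. The duality operator $*$ on $R$ is the additive map with $[V]^*=[V^*]$, where $V^*=\operatorname{Hom}_{\mathbf{k}}(V,\mathbf{k})$ with $(hf)(v)=f(S(h)v)$. A representation ideal of $R$ is an ideal that is the $\mathbb{Z}$-span of a proper subset of the basis of indecomposables and is closed under $*$. $I_{\operatorname{proj}}$ is the representation ideal spanned by the classes of projective modules; $I_{\operatorname{max}}$ is the maximal (largest) representation ideal. Representation ring in the sense of Benson: a commutative ring $R$ with a $\mathbb{Z}$-basis $\{x_i\}_{i\in\mathfrak{I}}$ having non-negative integer structure constants and with identity $x_0=\mathbf{1}$, such that, writing $[x:x_i]$ for the coefficient of $x_i$ in $x$: (i) there is an involution $i\mapsto i^*$ on $\mathfrak{I}$ that induces an anti-involution on $R$ (via $x_i\mapsto x_{i^*}$); (ii) if $[x_ix_j:\mathbf{1}]>0$, then $j=i^*$; (iii) if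 $[x_ix_{i^*}:\mathbf{1}]=0$, then $[x_ix_{i^*}x_i:x_i]\geq 2$; (iv) there exists a ring homomorphism $\dim:R\to\mathbb{Z}$ with $\dim(x_i)=\dim(x_{i^*})>0$ for all $i\in\mathfrak{I}$; (v) there exists a nonzero element $\rho\in R$ with all coefficients non-negative such that $x\rho=(\dim x)\rho$ for all $x\in R$. *)

theory Defs
  imports
    "Jordan_Normal_Form.Matrix"
    "HOL-Algebra.QuotRing"
    "HOL-Algebra.IntRing"
    "HOL-Algebra.Generated_Groups"
    "HOL-Algebra.Free_Abelian_Groups"
    "HOL-Computational_Algebra.Polynomial"
begin

section \<open>Hopf algebras\<close>

text \<open>
  A tensor product of vector spaces over \<open>'k\<close> is the quotient of the free vector space
  \<open>'a \<times> 'b \<Rightarrow>\<^sub>0 'k\<close> by the subspace spanned by the bilinearity relators.  As the scalar multiplication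
  of a Hopf algebra is a term and not part of its type, this quotient is not formed as a type:
  elements of tensor powers of \<open>H\<close> are given by representatives in the free vector space and
  compared modulo the subspaces \<open>tensor2_null\<close> (for \<open>H \<otimes> H\<close>) and \<open>tensor3_null\<close>
  (for \<open>H \<otimes> H \<otimes> H\<close>).
\<close>

abbreviation pure :: "'a \<Rightarrow> 'a \<Rightarrow>\<^sub>0 'k::zero_neq_one" where
  "pure a \<equiv> Poly_Mapping.single a 1"

definition fsmult :: "'k::semiring_0 \<Rightarrow> ('a \<Rightarrow>\<^sub>0 'k) \<Rightarrow> ('a \<Rightarrow>\<^sub>0 'k)" where
  "fsmult c t = Poly_Mapping.map ((*) c) t"

definition fextend :: "('a \<Rightarrow> 'b \<Rightarrow>\<^sub>0 'k) \<Rightarrow> ('a \<Rightarrow>\<^sub>0 'k::semiring_0) \<Rightarrow> ('b \<Rightarrow>\<^sub>0 'k)" where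
  "fextend f t = (\<Sum>a \<in> Poly_Mapping.keys t. fsmult (Poly_Mapping.lookup t a) (f a))"

inductive_set tensor2_null :: "('k::field \<Rightarrow> 'h::ab_group_add \<Rightarrow> 'h) \<Rightarrow> ('h \<times> 'h \<Rightarrow>\<^sub>0 'k) set"
  for s :: "'k \<Rightarrow> 'h \<Rightarrow> 'h" where
  zero: "0 \<in> tensor2_null s"
| add: "t \<in> tensor2_null s \<Longrightarrow> u \<in> tensor2_null s \<Longrightarrow> t + u \<in> tensor2_null s"
| smult: "t \<in> tensor2_null s \<Longrightarrow> fsmult c t \<in> tensor2_null s"
| add1: "pure (a + a', b) - pure (a, b) - pure (a', b) \<in> tensor2_null s"
| add2: "pure (a, b + b') - pure (a, b) - pure (a, b') \<in> tensor2_null s"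
| smult1: "pure (s c a, b) - fsmult c (pure (a, b)) \<in> tensor2_null s"
| smult2: "pure (a, s c b) - fsmult c (pure (a, b)) \<in> tensor2_null s"

inductive_set tensor3_null ::
    "('k::field \<Rightarrow> 'h::ab_group_add \<Rightarrow> 'h) \<Rightarrow> ('h \<times> 'h \<times> 'h \<Rightarrow>\<^sub>0 'k) set"
  for s :: "'k \<Rightarrow> 'h \<Rightarrow> 'h" where
  zero: "0 \<in> tensor3_null s"
| add: "t \<in> tensor3_null s \<Longrightarrow> u \<in> tensor3_null s \<Longrightarrow> t + u \<in> tensor3_null s"
| smult: "t \<in> tensor3_null s \<Longrightarrow> fsmult c t \<in> tensor3_null s"
| add1: "pure (a + a', b, d) - pure (a, b, d) - pure (a', b, d) \<in> tensor3_null s"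
| add2: "pure (a, b + b', d) - pure (a, b, d) - pure (a, b', d) \<in> tensor3_null s"
| add3: "pure (a, b, d + d') - pure (a, b, d) - pure (a, b, d') \<in> tensor3_null s"
| smult1: "pure (s c a, b, d) - fsmult c (pure (a, b, d)) \<in> tensor3_null s"
| smult2: "pure (a, s c b, d) - fsmult c (pure (a, b, d)) \<in> tensor3_null s"
| smult3: "pure (a, b, s c d) - fsmult c (pure (a, b, d)) \<in> tensor3_null s"

definition tensor2_eq where "tensor2_eq s t u \<longleftrightarrow> t - u \<in> tensor2_null s"

definition tensor3_eq where "tensor3_eq s t u \<longleftrightarrow> t - u \<in> tensor3_null s"

text \<open>
  The ring structure of \<open>H\<close> is that of the type \<open>'h\<close>; \<open>comult H h\<close> is a representative
  \<open>\<Sum> c (h\<^sub>1, h\<^sub>2)\<close> of \<open>\<Delta>(h) = \<Sum> c h\<^sub>1 \<otimes> h\<^sub>2\<close>.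
\<close>

record (overloaded) ('k, 'h) hopf_data =
  hscale :: "'k \<Rightarrow> 'h \<Rightarrow> 'h"
  comult :: "'h \<Rightarrow> ('h \<times> 'h \<Rightarrow>\<^sub>0 'k)"
  counit :: "'h \<Rightarrow> 'k"
  antipode :: "'h \<Rightarrow> 'h"

text \<open>\<open>sweedler H f h\<close> is \<open>\<Sum> c f(h\<^sub>1, h\<^sub>2)\<close>.\<close>

definition sweedler ::
    "('k::field, 'h::ring_1, 'z) hopf_data_scheme \<Rightarrow> ('h \<Rightarrow> 'h \<Rightarrow> 'h) \<Rightarrow> 'h \<Rightarrow> 'h" where
  "sweedler H f h =
     (\<Sum>(a, b) \<in> Poly_Mapping.keys (comult H h).
        hscale H (Poly_Mapping.lookup (comult H h) (a, b)) (f a b))"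

locale hopf_algebra = vector_space "hscale H"
  for H :: "('k::field, 'h::ring_1, 'z) hopf_data_scheme" +
  assumes scale_mult_left: "hscale H c (g * h) = hscale H c g * h"
    and scale_mult_right: "hscale H c (g * h) = g * hscale H c h"
    and comult_add: "tensor2_eq (hscale H) (comult H (g + h)) (comult H g + comult H h)"
    and comult_scale: "tensor2_eq (hscale H) (comult H (hscale H c h)) (fsmult c (comult H h))"
    and comult_one: "tensor2_eq (hscale H) (comult H 1) (pure (1, 1))"
    and comult_mult: "tensor2_eq (hscale H) (comult H (g * h))
          (fextend (\<lambda>(a, b). fextend (\<lambda>(a', b'). pure (a * a', b * b')) (comult H h)) (comult H g))"
    and coassoc: "tensor3_eq (hscale H)
          (fextend (\<lambda>(a, b). fextend (\<lambda>(p, q). pure (p, q, b)) (comult H a)) (comult H h))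
          (fextend (\<lambda>(a, b). fextend (\<lambda>(p, q). pure (a, p, q)) (comult H b)) (comult H h))"
    and counit_add: "counit H (g + h) = counit H g + counit H h"
    and counit_scale: "counit H (hscale H c h) = c * counit H h"
    and counit_one: "counit H 1 = 1"
    and counit_mult: "counit H (g * h) = counit H g * counit H h"
    and counit_left: "sweedler H (\<lambda>a b. hscale H (counit H a) b) h = h"
    and counit_right: "sweedler H (\<lambda>a b. hscale H (counit H b) a) h = h"
    and antipode_add: "antipode H (g + h) = antipode H g + antipode H h"
    and antipode_scale: "antipode H (hscale H c h) = hscale H c (antipode H h)"
    and antipode_left: "sweedler H (\<lambda>a b. antipode H a * b) h = hscale H (counit H h) 1"
    and antipode_right: "sweedler H (\<lambda>a b. a * antipode H b) h = hscale H (counit H h) 1"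

definition finite_dimensional_over ::
    "('k::field, 'h::ring_1, 'z) hopf_data_scheme \<Rightarrow> bool" where
  "finite_dimensional_over H \<longleftrightarrow> (\<exists>B. finite_dimensional_vector_space (hscale H) B)"

definition left_ideal :: "'h::ring_1 set \<Rightarrow> bool" where
  "left_ideal L \<longleftrightarrow> 0 \<in> L \<and> (\<forall>x\<in>L. \<forall>y\<in>L. x + y \<in> L) \<and> (\<forall>h. \<forall>x\<in>L. h * x \<in> L)"

text \<open>A ring is semisimple if its regular left module is: every left ideal has a complement.\<close>

definition semisimple_ring :: "'h::ring_1 itself \<Rightarrow> bool" where
  "semisimple_ring _ \<longleftrightarrow>
     (\<forall>L :: 'h set. left_ideal L \<longrightarrow>
        (\<exists>L'. left_ideal L' \<and> L \<inter> L' = {0} \<and> (\<forall>h. \<exists>x\<in>L. \<exists>y\<in>L'. h = x + y)))"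

definition inner_automorphism :: "('h::ring_1 \<Rightarrow> 'h) \<Rightarrow> bool" where
  "inner_automorphism f \<longleftrightarrow> (\<exists>u v. u * v = 1 \<and> v * u = 1 \<and> (\<forall>h. f h = u * h * v))"

section \<open>Finite-dimensional modules\<close>

text \<open>
  A module \<open>(n, \<rho>)\<close> is the coordinate space \<open>carrier_vec n\<close> on which \<open>h\<close> acts
  by \<open>v \<mapsto> \<rho> h *\<^sub>v v\<close>.  Up to isomorphism these are all finite-dimensional modules
  (lemma \<open>fd_module_iso_hmodule\<close> below), so they carry all isomorphism classes.
\<close>

type_synonym ('k, 'h) hmod = "nat \<times> ('h \<Rightarrow> 'k mat)"

definition hmodule ::
    "('k::field, 'h::ring_1, 'z) hopf_data_scheme \<Rightarrow> ('k, 'h) hmod \<Rightarrow> bool" where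
  "hmodule H V \<longleftrightarrow> (case V of (n, \<rho>) \<Rightarrow>
     (\<forall>h. \<rho> h \<in> carrier_mat n n) \<and>
     (\<forall>g h. \<rho> (g + h) = \<rho> g + \<rho> h) \<and>
     (\<forall>c h. \<rho> (hscale H c h) = c \<cdot>\<^sub>m \<rho> h) \<and>
     \<rho> 1 = 1\<^sub>m n \<and>
     (\<forall>g h. \<rho> (g * h) = \<rho> g * \<rho> h))"

lemma fd_module_iso_hmodule:
  fixes H :: "('k::field, 'h::ring_1, 'z) hopf_data_scheme"
    and sV :: "'k \<Rightarrow> 'v::ab_group_add \<Rightarrow> 'v" and act :: "'h \<Rightarrow> 'v \<Rightarrow> 'v"
  assumes fd: "finite_dimensional_vector_space sV B"
    and act_add: "\<And>h v w. act h (v + w) = act h v + act h w"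
    and act_scale: "\<And>h c v. act h (sV c v) = sV c (act h v)"
    and add_act: "\<And>g h v. act (g + h) v = act g v + act h v"
    and scale_act: "\<And>c h v. act (hscale H c h) v = sV c (act h v)"
    and one_act: "\<And>v. act 1 v = v"
    and mult_act: "\<And>g h v. act (g * h) v = act g (act h v)"
  obtains n \<rho> \<phi> where "hmodule H (n, \<rho>)" and "bij_betw \<phi> UNIV (carrier_vec n)"
    and "\<And>v w. \<phi> (v + w) = \<phi> v + \<phi> w" and "\<And>c v. \<phi> (sV c v) = c \<cdot>\<^sub>v \<phi> v"
    and "\<And>h v. \<phi> (act h v) = \<rho> h *\<^sub>v \<phi> v"
proof -
  interpret V: finite_dimensional_vector_space sV B by (fact fd)
  obtain bs where bs: "set bs = B" "distinct bs"
    using finite_distinct_list[OF V.finite_Basis] by blast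
  define n where "n = length bs"
  define coord where "coord v b = V.representation B v b" for v b
  define \<phi> where "\<phi> v = vec n (\<lambda>i. coord v (bs ! i))" for v
  define \<rho> where "\<rho> h = mat n n (\<lambda>(i, j). coord (act h (bs ! j)) (bs ! i))" for h
  have reindex: "(\<Sum>b\<in>B. f b) = (\<Sum>j = 0..<n. f (bs ! j))" for f :: "'v \<Rightarrow> 'c::comm_monoid_add"
    using bs sum_list_distinct_conv_sum_set[of bs f] sum_list_sum_nth[of "map f bs"]
    by (simp add: n_def)
  have coord_add: "coord (v + w) b = coord v b + coord w b" for v w b
    unfolding coord_def using V.independent_Basis V.span_Basis
    by (simp add: V.representation_add)
  have coord_scale: "coord (sV c v) b = c * coord v b" for c v b
    unfolding coord_def using V.independent_Basis V.span_Basis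
    by (simp add: V.representation_scale)
  have coord_sum: "coord (\<Sum>i\<in>J. f i) b = (\<Sum>i\<in>J. coord (f i) b)" for J :: "nat set" and f b
    unfolding coord_def using V.independent_Basis V.span_Basis
    by (simp add: V.representation_sum)
  have expand: "v = (\<Sum>j = 0..<n. sV (coord v (bs ! j)) (bs ! j))" for v
  proof -
    have "(\<Sum>b\<in>B. sV (coord v b) b) = v"
      unfolding coord_def using V.independent_Basis V.span_Basis
      by (intro V.sum_representation_eq) (auto simp: V.finite_Basis)
    then show ?thesis by (simp add: reindex)
  qed
  have coord_basis: "coord (bs ! j) (bs ! i) = (if i = j then 1 else 0)"
    if "i < n" "j < n" for i j
    using that bs V.representation_basis[OF V.independent_Basis, of "bs ! j"]
    by (auto simp: coord_def n_def nth_eq_iff_index_eq)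
  have act_sum: "act h (\<Sum>i\<in>J. f i) = (\<Sum>i\<in>J. act h (f i))" if "finite J" for J :: "nat set" and f h
  proof -
    have "act h 0 = 0" using act_scale[of h 0 0] by simp
    with that show ?thesis by (induction J) (auto simp: act_add)
  qed
  have equivariant: "\<phi> (act h v) = \<rho> h *\<^sub>v \<phi> v" for h v
  proof (rule eq_vecI)
    fix i assume "i < dim_vec (\<rho> h *\<^sub>v \<phi> v)"
    then have i: "i < n" by (simp add: \<rho>_def)
    have "coord (act h v) (bs ! i) =
        coord (\<Sum>j = 0..<n. sV (coord v (bs ! j)) (act h (bs ! j))) (bs ! i)"
      by (subst expand[of v]) (simp add: act_sum act_scale)
    with i show "\<phi> (act h v) $ i = (\<rho> h *\<^sub>v \<phi> v) $ i"
      by (simp add: \<phi>_def \<rho>_def coord_sum coord_scale scalar_prod_def mult.commute)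
  qed (simp add: \<phi>_def \<rho>_def)
  have bij: "bij_betw \<phi> UNIV (carrier_vec n)"
  proof (rule bij_betwI[where g = "\<lambda>x. \<Sum>j = 0..<n. sV (x $ j) (bs ! j)"])
    show "(\<Sum>j = 0..<n. sV (\<phi> v $ j) (bs ! j)) = v" for v
      by (subst (2) expand[of v]) (simp add: \<phi>_def)
    show "\<phi> (\<Sum>j = 0..<n. sV (x $ j) (bs ! j)) = x" if "x \<in> carrier_vec n" for x
      using that
      by (intro eq_vecI) (auto simp: \<phi>_def coord_sum coord_scale coord_basis if_distrib
          [where f = "(*) _"] cong: if_cong)
  qed (auto simp: \<phi>_def)
  have "hmodule H (n, \<rho>)"
    unfolding hmodule_def prod.case
  proof (intro conjI allI)
    show "\<rho> h \<in> carrier_mat n n" for h by (simp add: \<rho>_def)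
    show "\<rho> (g + h) = \<rho> g + \<rho> h" for g h
      by (rule eq_matI) (auto simp: \<rho>_def add_act coord_add)
    show "\<rho> (hscale H c h) = c \<cdot>\<^sub>m \<rho> h" for c h
      by (rule eq_matI) (auto simp: \<rho>_def scale_act coord_scale)
    show "\<rho> 1 = 1\<^sub>m n"
      by (rule eq_matI) (auto simp: \<rho>_def one_act coord_basis)
    show "\<rho> (g * h) = \<rho> g * \<rho> h" for g h
    proof (rule eq_matI)
      fix i j assume "i < dim_row (\<rho> g * \<rho> h)" "j < dim_col (\<rho> g * \<rho> h)"
      then have ij: "i < n" "j < n" by (simp_all add: \<rho>_def)
      have "\<phi> (act g (act h (bs ! j))) $ i = (\<rho> g *\<^sub>v \<phi> (act h (bs ! j))) $ i"
        by (simp add: equivariant)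
      with ij show "\<rho> (g * h) $$ (i, j) = (\<rho> g * \<rho> h) $$ (i, j)"
        by (simp add: \<phi>_def \<rho>_def mult_act scalar_prod_def)
    qed (auto simp: \<rho>_def)
  qed
  moreover have "\<phi> (v + w) = \<phi> v + \<phi> w" "\<phi> (sV c v) = c \<cdot>\<^sub>v \<phi> v" for v w c
    by (auto simp: \<phi>_def coord_add coord_scale)
  ultimately show thesis using bij equivariant that by blast
qed

definition hmod_hom :: "('k::field, 'h) hmod \<Rightarrow> ('k, 'h) hmod \<Rightarrow> 'k mat set" where
  "hmod_hom V W =
     {A \<in> carrier_mat (fst W) (fst V). \<forall>h. A * snd V h = snd W h * A}"

definition hmod_iso :: "('k::field, 'h) hmod \<Rightarrow> ('k, 'h) hmod \<Rightarrow> bool" where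
  "hmod_iso V W \<longleftrightarrow>
     (\<exists>A \<in> hmod_hom V W. \<exists>B \<in> hmod_hom W V. B * A = 1\<^sub>m (fst V) \<and> A * B = 1\<^sub>m (fst W))"

definition hmod_trivial ::
    "('k::field, 'h::ring_1, 'z) hopf_data_scheme \<Rightarrow> ('k, 'h) hmod" where
  "hmod_trivial H = (1, \<lambda>h. counit H h \<cdot>\<^sub>m 1\<^sub>m 1)"

definition hmod_sum :: "('k::field, 'h) hmod \<Rightarrow> ('k, 'h) hmod \<Rightarrow> ('k, 'h) hmod" where
  "hmod_sum V W = (fst V + fst W,
     \<lambda>h. four_block_mat (snd V h) (0\<^sub>m (fst V) (fst W)) (0\<^sub>m (fst W) (fst V)) (snd W h))"

text \<open>
  The basis vector \<open>e\<^sub>i \<otimes> e\<^sub>j\<close> of the tensor product of coordinate spaces is the basis vector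
  with index \<open>i * m + j\<close>, where \<open>m\<close> is the dimension of the second factor.
\<close>

definition kronecker :: "'k::field mat \<Rightarrow> 'k mat \<Rightarrow> 'k mat" where
  "kronecker A B = mat (dim_row A * dim_row B) (dim_col A * dim_col B)
     (\<lambda>(i, j). A $$ (i div dim_row B, j div dim_col B) * B $$ (i mod dim_row B, j mod dim_col B))"

definition hmod_tensor ::
    "('k::field, 'h::ring_1, 'z) hopf_data_scheme \<Rightarrow> ('k, 'h) hmod \<Rightarrow> ('k, 'h) hmod \<Rightarrow> ('k, 'h) hmod"
  where
  "hmod_tensor H V W = (fst V * fst W,
     \<lambda>h. mat (fst V * fst W) (fst V * fst W) (\<lambda>(i, j).
       \<Sum>(a, b) \<in> Poly_Mapping.keys (comult H h).
         Poly_Mapping.lookup (comult H h) (a, b) * kronecker (snd V a) (snd W b) $$ (i, j)))"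

text \<open>The matrix, in the dual basis, of the action \<open>(h f)(v) = f(S(h) v)\<close>.\<close>

definition hmod_dual ::
    "('k::field, 'h::ring_1, 'z) hopf_data_scheme \<Rightarrow> ('k, 'h) hmod \<Rightarrow> ('k, 'h) hmod" where
  "hmod_dual H V = (fst V, \<lambda>h. transpose_mat (snd V (antipode H h)))"

definition indecomposable ::
    "('k::field, 'h::ring_1, 'z) hopf_data_scheme \<Rightarrow> ('k, 'h) hmod \<Rightarrow> bool" where
  "indecomposable H V \<longleftrightarrow> hmodule H V \<and> fst V \<noteq> 0 \<and>
     \<not> (\<exists>U W. hmodule H U \<and> hmodule H W \<and> fst U \<noteq> 0 \<and> fst W \<noteq> 0 \<and> hmod_iso V (hmod_sum U W))"

definition projective ::
    "('k::field, 'h::ring_1, 'z) hopf_data_scheme \<Rightarrow> ('k, 'h) hmod \<Rightarrow> bool" where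
  "projective H V \<longleftrightarrow> hmodule H V \<and>
     (\<forall>U W. \<forall>p \<in> hmod_hom U W. \<forall>f \<in> hmod_hom V W.
        hmodule H U \<and> hmodule H W \<and> (\<lambda>v. p *\<^sub>v v) ` carrier_vec (fst U) = carrier_vec (fst W) \<longrightarrow>
        (\<exists>g \<in> hmod_hom V U. p * g = f))"

section \<open>The Green ring\<close>

type_synonym ('k, 'h) hclass = "('k, 'h) hmod set"

definition iso_class ::
    "('k::field, 'h::ring_1, 'z) hopf_data_scheme \<Rightarrow> ('k, 'h) hmod \<Rightarrow> ('k, 'h) hclass" where
  "iso_class H V = {W. hmodule H W \<and> hmod_iso V W}"

definition iso_classes ::
    "('k::field, 'h::ring_1, 'z) hopf_data_scheme \<Rightarrow> ('k, 'h) hclass set" where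
  "iso_classes H = {iso_class H V | V. hmodule H V}"

definition indec_classes ::
    "('k::field, 'h::ring_1, 'z) hopf_data_scheme \<Rightarrow> ('k, 'h) hclass set" where
  "indec_classes H = {iso_class H V | V. indecomposable H V}"

definition class_tensor ::
    "('k::field, 'h::ring_1, 'z) hopf_data_scheme \<Rightarrow> ('k, 'h) hclass \<Rightarrow> ('k, 'h) hclass \<Rightarrow> ('k, 'h) hclass"
  where
  "class_tensor H X Y = (\<Union>V\<in>X. \<Union>W\<in>Y. iso_class H (hmod_tensor H V W))"

definition class_dual ::
    "('k::field, 'h::ring_1, 'z) hopf_data_scheme \<Rightarrow> ('k, 'h) hclass \<Rightarrow> ('k, 'h) hclass" where
  "class_dual H X = (\<Union>V\<in>X. iso_class H (hmod_dual H V))"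

text \<open>
  The free abelian group on the isomorphism classes, with the biadditive extension of the
  tensor product; the Green ring is its quotient by the subgroup generated by the elements
  \<open>[U \<oplus> V] - [U] - [V]\<close>, which is an ideal.
\<close>

definition free_green_ring ::
    "('k::field, 'h::ring_1, 'z) hopf_data_scheme \<Rightarrow> (('k, 'h) hclass \<Rightarrow>\<^sub>0 int) ring" where
  "free_green_ring H =
     \<lparr> carrier = {x. Poly_Mapping.keys x \<subseteq> iso_classes H},
       mult = (\<lambda>x y. frag_extend (\<lambda>X. frag_extend (\<lambda>Y. frag_of (class_tensor H X Y)) y) x),
       one = frag_of (iso_class H (hmod_trivial H)),
       ring.zero = 0,
       add = (+) \<rparr>"

definition sum_relations ::
    "('k::field, 'h::ring_1, 'z) hopf_data_scheme \<Rightarrow> (('k, 'h) hclass \<Rightarrow>\<^sub>0 int) set" where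
  "sum_relations H = generate (add_monoid (free_green_ring H))
     {frag_of (iso_class H (hmod_sum U V)) - frag_of (iso_class H U) - frag_of (iso_class H V) | U V.
        hmodule H U \<and> hmodule H V}"

definition green_ring ::
    "('k::field, 'h::ring_1, 'z) hopf_data_scheme \<Rightarrow> (('k, 'h) hclass \<Rightarrow>\<^sub>0 int) set ring" where
  "green_ring H = free_green_ring H Quot sum_relations H"

definition green_class ::
    "('k::field, 'h::ring_1, 'z) hopf_data_scheme \<Rightarrow> ('k, 'h) hclass \<Rightarrow> (('k, 'h) hclass \<Rightarrow>\<^sub>0 int) set"
  where
  "green_class H X = sum_relations H +>\<^bsub>free_green_ring H\<^esub> frag_of X"

text \<open>The map induced on cosets by the additive extension of \<open>[V] \<mapsto> [V*]\<close>.\<close>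

definition green_dual ::
    "('k::field, 'h::ring_1, 'z) hopf_data_scheme \<Rightarrow>
     (('k, 'h) hclass \<Rightarrow>\<^sub>0 int) set \<Rightarrow> (('k, 'h) hclass \<Rightarrow>\<^sub>0 int) set" where
  "green_dual H \<xi> =
     (\<Union>x\<in>\<xi>. sum_relations H +>\<^bsub>free_green_ring H\<^esub> frag_extend (\<lambda>X. frag_of (class_dual H X)) x)"

definition zspan :: "('a, 'b) ring_scheme \<Rightarrow> 'a set \<Rightarrow> 'a set" where
  "zspan R P = generate (add_monoid R) P"

definition representation_ideal ::
    "('k::field, 'h::ring_1, 'z) hopf_data_scheme \<Rightarrow> (('k, 'h) hclass \<Rightarrow>\<^sub>0 int) set set \<Rightarrow> bool" where
  "representation_ideal H I \<longleftrightarrow>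
     ideal I (green_ring H) \<and>
     (\<exists>P. P \<subset> green_class H ` indec_classes H \<and> I = zspan (green_ring H) P) \<and>
     (\<forall>\<xi>\<in>I. green_dual H \<xi> \<in> I)"

definition I_max ::
    "('k::field, 'h::ring_1, 'z) hopf_data_scheme \<Rightarrow> (('k, 'h) hclass \<Rightarrow>\<^sub>0 int) set set" where
  "I_max H = (GREATEST I. representation_ideal H I)"

definition I_proj ::
    "('k::field, 'h::ring_1, 'z) hopf_data_scheme \<Rightarrow> (('k, 'h) hclass \<Rightarrow>\<^sub>0 int) set set" where
  "I_proj H = zspan (green_ring H) {green_class H (iso_class H V) | V. projective H V}"

section \<open>Representation rings in the sense of Benson\<close>

definition zcomb :: "('a, 'b) ring_scheme \<Rightarrow> ('i \<Rightarrow> 'a) \<Rightarrow> ('i \<Rightarrow>\<^sub>0 int) \<Rightarrow> 'a" where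
  "zcomb R x c = (\<Oplus>\<^bsub>R\<^esub>i \<in> Poly_Mapping.keys c. [Poly_Mapping.lookup c i] \<cdot>\<^bsub>R\<^esub> x i)"

definition zbasis :: "('a, 'b) ring_scheme \<Rightarrow> 'i set \<Rightarrow> ('i \<Rightarrow> 'a) \<Rightarrow> bool" where
  "zbasis R I x \<longleftrightarrow> x ` I \<subseteq> carrier R \<and>
     (\<forall>a \<in> carrier R. \<exists>!c. Poly_Mapping.keys c \<subseteq> I \<and> a = zcomb R x c)"

text \<open>The coefficient \<open>[a : x\<^sub>i]\<close>.\<close>

definition zcoeff :: "('a, 'b) ring_scheme \<Rightarrow> 'i set \<Rightarrow> ('i \<Rightarrow> 'a) \<Rightarrow> 'a \<Rightarrow> 'i \<Rightarrow> int" where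
  "zcoeff R I x a i =
     Poly_Mapping.lookup (THE c. Poly_Mapping.keys c \<subseteq> I \<and> a = zcomb R x c) i"

definition anti_involution :: "('a, 'b) ring_scheme \<Rightarrow> ('a \<Rightarrow> 'a) \<Rightarrow> bool" where
  "anti_involution R \<phi> \<longleftrightarrow> \<phi> \<in> carrier R \<rightarrow> carrier R \<and>
     (\<forall>a \<in> carrier R. \<forall>b \<in> carrier R. \<phi> (a \<oplus>\<^bsub>R\<^esub> b) = \<phi> a \<oplus>\<^bsub>R\<^esub> \<phi> b) \<and>
     (\<forall>a \<in> carrier R. \<forall>b \<in> carrier R. \<phi> (a \<otimes>\<^bsub>R\<^esub> b) = \<phi> b \<otimes>\<^bsub>R\<^esub> \<phi> a) \<and>
     \<phi> \<one>\<^bsub>R\<^esub> = \<one>\<^bsub>R\<^esub> \<and>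
     (\<forall>a \<in> carrier R. \<phi> (\<phi> a) = a)"

definition benson_representation_ring ::
    "('a, 'b) ring_scheme \<Rightarrow> 'i set \<Rightarrow> ('i \<Rightarrow> 'a) \<Rightarrow> bool" where
  "benson_representation_ring R I x \<longleftrightarrow>
     cring R \<and> zbasis R I x \<and>
     (\<forall>i\<in>I. \<forall>j\<in>I. \<forall>l\<in>I. 0 \<le> zcoeff R I x (x i \<otimes>\<^bsub>R\<^esub> x j) l) \<and>
     (\<exists>i\<^sub>0 \<in> I. x i\<^sub>0 = \<one>\<^bsub>R\<^esub> \<and>
       (\<exists>star dm.
         \<comment> \<open>(i)\<close>
         (\<forall>i\<in>I. star i \<in> I \<and> star (star i) = i) \<and>
         (\<exists>\<phi>. anti_involution R \<phi> \<and> (\<forall>i\<in>I. \<phi> (x i) = x (star i))) \<and>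
         \<comment> \<open>(ii)\<close>
         (\<forall>i\<in>I. \<forall>j\<in>I. 0 < zcoeff R I x (x i \<otimes>\<^bsub>R\<^esub> x j) i\<^sub>0 \<longrightarrow> j = star i) \<and>
         \<comment> \<open>(iii)\<close>
         (\<forall>i\<in>I. zcoeff R I x (x i \<otimes>\<^bsub>R\<^esub> x (star i)) i\<^sub>0 = 0 \<longrightarrow>
            2 \<le> zcoeff R I x (x i \<otimes>\<^bsub>R\<^esub> x (star i) \<otimes>\<^bsub>R\<^esub> x i) i) \<and>
         \<comment> \<open>(iv)\<close>
         dm \<in> ring_hom R \<Z> \<and>
         (\<forall>i\<in>I. dm (x i) = dm (x (star i)) \<and> 0 < dm (x i)) \<and>
         \<comment> \<open>(v)\<close>
         (\<exists>r \<in> carrier R. r \<noteq> \<zero>\<^bsub>R\<^esub> \<and> (\<forall>i\<in>I. 0 \<le> zcoeff R I x r i) \<and>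
            (\<forall>a \<in> carrier R. a \<otimes>\<^bsub>R\<^esub> r = [dm a] \<cdot>\<^bsub>R\<^esub> r))))"

end

theory Submission
  imports Defs "Jordan_Normal_Form.Determinant"
begin

text \<open>
  The Krull--Schmidt theorem identifies coefficients in the Green ring with multiplicities of
  indecomposable summands.  An invertible element \<open>u\<close> with \<open>S\<^sup>2(h) = u h u\<^sup>-\<^sup>1\<close> acts on \<open>V\<close> as an
  isomorphism \<open>V \<cong> V\<^sup>*\<^sup>*\<close>, whence the involution \<open>i \<mapsto> i\<^sup>*\<close>.  If \<open>k\<close> splits off \<open>V \<otimes> W\<close> with \<open>V\<close> and \<open>W\<close>
  indecomposable, then some composite \<open>W\<^sup>* \<rightarrow> V \<rightarrow> W\<^sup>*\<close> has a nonzero trace after twisting by \<open>u\<close>, so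
  it is not nilpotent, and therefore it is an isomorphism by Fitting's lemma.  If \<open>k\<close> does not split
  off \<open>V \<otimes> V\<^sup>*\<close>, then the two embeddings of \<open>V\<close> into \<open>V \<otimes> V\<^sup>* \<otimes> V\<close> given by the coevaluations of \<open>V\<close>
  and \<open>V\<^sup>*\<close> are jointly split, so that \<open>V\<close> occurs there twice.  Finally \<open>H \<otimes> V\<close> is the direct sum of
  \<open>dim V\<close> copies of \<open>H\<close>, so the class of the regular module serves as \<open>\<rho>\<close>.
\<close>

section \<open>Fitting decomposition and nilpotent matrices\<close>

text \<open>Why a twist by \<open>u\<close> is needed: an invariant of V \<otimes> W is a map from
  the dual of W to the double dual of V, an invariant pairing on V \<otimes> W is a map from V to
  the dual of W, and these do not compose until the double dual is brought back to V. The price is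
  that the scalar k -> k becomes the trace of \<open>u\<close> times an endomorphism. Since
  \<open>u\<close> commutes with every endomorphism of a module, this product is still nilpotent,
  hence of trace 0, whenever the endomorphism is nilpotent.

  All modules are coordinate spaces. Tensor products and direct sums are then strictly associative
  and the trivial module is a strict unit for the tensor product, so that genuine isomorphisms are
  left to distributivity, to the order of summands and to duals.

  Elements of tensor powers of H are mere representatives, and the coproduct is linear,
  multiplicative and coassociative modulo relators. Consequences of the axioms are therefore derived
  after a multilinear matrix-valued map has been applied, usually one made from representations:
  such maps do not see the choice of representative.\<close>

lemma mat_mult_assoc:
  fixes A B C :: "'a::semiring_0 mat"
  assumes "dim_col A = dim_row B" "dim_col B = dim_row C"
  shows "A * B * C = A * (B * C)"
  using assms by (intro assoc_mult_mat[of A "dim_row A" "dim_row B" B "dim_row C" C "dim_col C"]) auto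

lemma pow_mat_plus:
  fixes A :: "'a::semiring_1 mat"
  assumes "A \<in> carrier_mat n n"
  shows "A ^\<^sub>m (k + l) = A ^\<^sub>m k * A ^\<^sub>m l"
proof (induction l)
  case 0
  then show ?case using assms by simp
next
  case (Suc l)
  have "A ^\<^sub>m k * A ^\<^sub>m l * A = A ^\<^sub>m k * (A ^\<^sub>m l * A)"
    using assms by (intro mat_mult_assoc) auto
  with Suc show ?case by simp
qed

lemma pow_mat_commutes:
  fixes A B :: "'a::semiring_1 mat"
  assumes "A \<in> carrier_mat n n" "B \<in> carrier_mat n n" "A * B = B * A"
  shows "A ^\<^sub>m k * B = B * A ^\<^sub>m k"
proof (induction k)
  case 0
  then show ?case using assms by simp
next
  case (Suc k)
  have "A ^\<^sub>m k * A * B = A ^\<^sub>m k * (B * A)"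
    using assms by (simp add: mat_mult_assoc)
  also have "\<dots> = B * A ^\<^sub>m k * A"
    using assms Suc by (subst mat_mult_assoc[symmetric]) auto
  also have "\<dots> = B * (A ^\<^sub>m k * A)"
    using assms by (intro mat_mult_assoc) auto
  finally show ?case by simp
qed

lemma pow_mat_mult_commuting:
  fixes A B :: "'a::semiring_1 mat"
  assumes A: "A \<in> carrier_mat n n" and B: "B \<in> carrier_mat n n" and AB: "A * B = B * A"
  shows "(A * B) ^\<^sub>m k = A ^\<^sub>m k * B ^\<^sub>m k"
proof (induction k)
  case 0
  then show ?case using assms by simp
next
  case (Suc k)
  note [simp] = carrier_matD[OF A] carrier_matD[OF B]
  have c: "B ^\<^sub>m k * A = A * B ^\<^sub>m k"
    using pow_mat_commutes[OF B A] AB by simp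
  have "(A * B) ^\<^sub>m Suc k = A ^\<^sub>m k * ((B ^\<^sub>m k * A) * B)"
    using Suc by (simp add: mat_mult_assoc)
  then show ?case by (simp add: c mat_mult_assoc)
qed

text \<open>An empty family of matrices does not determine a size, hence the explicit
  dimensions.\<close>

definition mat_lincomb :: "nat \<Rightarrow> nat \<Rightarrow> 'i set \<Rightarrow> ('i \<Rightarrow> 'a) \<Rightarrow> ('i \<Rightarrow> 'a mat) \<Rightarrow> 'a::comm_semiring_1 mat" where
  "mat_lincomb r c L a F = mat r c (\<lambda>ij. \<Sum>l\<in>L. a l * F l $$ ij)"

lemma mat_lincomb_carrier [simp]: "mat_lincomb r c L a F \<in> carrier_mat r c"
  and dim_row_mat_lincomb [simp]: "dim_row (mat_lincomb r c L a F) = r"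
  and dim_col_mat_lincomb [simp]: "dim_col (mat_lincomb r c L a F) = c"
  by (auto simp: mat_lincomb_def)

lemma mat_lincomb_cong:
  assumes "\<And>l. l \<in> L \<Longrightarrow> a l = b l" "\<And>l. l \<in> L \<Longrightarrow> F l = G l"
  shows "mat_lincomb r c L a F = mat_lincomb r c L b G"
  using assms by (auto simp: mat_lincomb_def intro!: eq_matI sum.cong)

lemma mat_lincomb_mult_right:
  assumes F: "\<And>l. l \<in> L \<Longrightarrow> F l \<in> carrier_mat r c" and B: "B \<in> carrier_mat c d"
  shows "mat_lincomb r c L a F * B = mat_lincomb r d L a (\<lambda>l. F l * B)"
proof (rule eq_matI)
  fix i j assume ij: "i < dim_row (mat_lincomb r d L a (\<lambda>l. F l * B))" "j < dim_col (mat_lincomb r d L a (\<lambda>l. F l * B))"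
  have "(mat_lincomb r c L a F * B) $$ (i, j) = (\<Sum>k = 0..<c. (\<Sum>l\<in>L. a l * F l $$ (i, k)) * B $$ (k, j))"
    using ij B by (simp add: scalar_prod_def mat_lincomb_def)
  also have "\<dots> = (\<Sum>l\<in>L. a l * (\<Sum>k = 0..<c. F l $$ (i, k) * B $$ (k, j)))"
    by (simp add: sum_distrib_left sum_distrib_right mult.assoc sum.swap[of _ L])
  also have "\<dots> = (\<Sum>l\<in>L. a l * (F l * B) $$ (i, j))"
  proof (rule sum.cong[OF refl])
    fix l assume "l \<in> L"
    with F[of l] ij B show "a l * (\<Sum>k = 0..<c. F l $$ (i, k) * B $$ (k, j)) = a l * (F l * B) $$ (i, j)"
      by (simp add: scalar_prod_def)
  qed
  finally show "(mat_lincomb r c L a F * B) $$ (i, j) = mat_lincomb r d L a (\<lambda>l. F l * B) $$ (i, j)"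
    using ij by (simp add: mat_lincomb_def)
qed (use B in auto)

lemma mat_lincomb_mult_left:
  assumes F: "\<And>l. l \<in> L \<Longrightarrow> F l \<in> carrier_mat c d" and B: "B \<in> carrier_mat r c"
  shows "B * mat_lincomb c d L a F = mat_lincomb r d L a (\<lambda>l. B * F l)"
proof (rule eq_matI)
  fix i j assume ij: "i < dim_row (mat_lincomb r d L a (\<lambda>l. B * F l))" "j < dim_col (mat_lincomb r d L a (\<lambda>l. B * F l))"
  have "(B * mat_lincomb c d L a F) $$ (i, j) = (\<Sum>k = 0..<c. B $$ (i, k) * (\<Sum>l\<in>L. a l * F l $$ (k, j)))"
    using ij B by (simp add: scalar_prod_def mat_lincomb_def)
  also have "\<dots> = (\<Sum>l\<in>L. a l * (\<Sum>k = 0..<c. B $$ (i, k) * F l $$ (k, j)))"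
    by (simp add: sum_distrib_left mult.left_commute sum.swap[of _ L])
  also have "\<dots> = (\<Sum>l\<in>L. a l * (B * F l) $$ (i, j))"
  proof (rule sum.cong[OF refl])
    fix l assume "l \<in> L"
    with F[of l] ij B show "a l * (\<Sum>k = 0..<c. B $$ (i, k) * F l $$ (k, j)) = a l * (B * F l) $$ (i, j)"
      by (simp add: scalar_prod_def)
  qed
  finally show "(B * mat_lincomb c d L a F) $$ (i, j) = mat_lincomb r d L a (\<lambda>l. B * F l) $$ (i, j)"
    using ij by (simp add: mat_lincomb_def)
qed (use B in auto)

text \<open>Padding \<open>A\<close> with zero rows gives a square matrix whose last row vanishes,
  so its transpose kills the last unit vector and its determinant is 0.\<close>

lemma wide_matrix_kernel:
  fixes A :: "'a::field mat"
  assumes A: "A \<in> carrier_mat m n" and "m < n"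
  obtains v where "v \<in> carrier_vec n" "v \<noteq> 0\<^sub>v n" "A *\<^sub>v v = 0\<^sub>v m"
proof -
  define B where "B = mat n n (\<lambda>(i, j). if i < m then A $$ (i, j) else 0)"
  have B: "B \<in> carrier_mat n n" by (simp add: B_def)
  have "B\<^sup>T *\<^sub>v unit_vec n (n - 1) = 0\<^sub>v n"
    using assms by (intro eq_vecI) (auto simp: B_def scalar_prod_def unit_vec_def intro!: sum.neutral)
  moreover have "unit_vec n (n - 1) \<noteq> (0\<^sub>v n :: 'a vec)"
    using assms by (intro unit_vec_nonzero) auto
  ultimately have "det B\<^sup>T = 0"
    using det_0_iff_vec_prod_zero_field[of "B\<^sup>T" n] B unit_vec_carrier[of n "n - 1"]
    unfolding transpose_carrier_mat by blast
  then have "det B = 0" using det_transpose[OF B] by simp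
  then obtain v where v: "v \<in> carrier_vec n" "v \<noteq> 0\<^sub>v n" "B *\<^sub>v v = 0\<^sub>v n"
    using det_0_iff_vec_prod_zero_field[OF B] by blast
  have "A *\<^sub>v v = 0\<^sub>v m"
  proof (rule eq_vecI)
    fix i assume i: "i < dim_vec (0\<^sub>v m :: 'a vec)"
    then have "(B *\<^sub>v v) $ i = (A *\<^sub>v v) $ i"
      using A v(1) assms(2) by (auto simp: B_def scalar_prod_def)
    with v(3) i assms(2) show "(A *\<^sub>v v) $ i = (0\<^sub>v m :: 'a vec) $ i" by simp
  qed (use A in auto)
  with v that show thesis by blast
qed

text \<open>
  The minimal polynomial of \<open>A\<close> has the form \<open>X\<^sup>k (c + X q)\<close> with \<open>c \<noteq> 0\<close>; the matrix \<open>S\<close> is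
  \<open>- q(A) / c\<close>.
\<close>

lemma stabilizing_power:
  fixes A :: "'a::field mat"
  assumes A: "A \<in> carrier_mat n n"
  obtains k S where "S \<in> carrier_mat n n" "A ^\<^sub>m k = A ^\<^sub>m Suc k * S"
    and "\<And>B. B \<in> carrier_mat n n \<Longrightarrow> A * B = B * A \<Longrightarrow> S * B = B * S"
proof -
  \<comment> \<open>The columns of \<open>M\<close> are the powers of \<open>A\<close> with
    exponents from 0 to \<open>N\<close>. These are \<open>Suc N\<close> vectors in a space of
    dimension \<open>N\<close>, so some nontrivial relation \<open>v\<close> holds among
    them.\<close>
  define N where "N = n * n"
  define M where "M = mat N (Suc N) (\<lambda>(p, l). (A ^\<^sub>m l) $$ (p div n, p mod n))"
  obtain v where v: "v \<in> carrier_vec (Suc N)" "v \<noteq> 0\<^sub>v (Suc N)" "M *\<^sub>v v = 0\<^sub>v N"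
    using wide_matrix_kernel[of M N "Suc N"] by (auto simp: M_def)
  have dep: "(\<Sum>l = 0..<Suc N. v $ l * (A ^\<^sub>m l) $$ (i, j)) = 0" if ij: "i < n" "j < n" for i j
  proof -
    have "i * n + j < Suc i * n" using ij by simp
    also have "\<dots> \<le> N" unfolding N_def using ij by (intro mult_le_mono1) auto
    finally have p: "i * n + j < N" .
    have "(M *\<^sub>v v) $ (i * n + j) = (\<Sum>l = 0..<Suc N. (A ^\<^sub>m l) $$ (i, j) * v $ l)"
      using p v(1) ij by (simp add: M_def scalar_prod_def)
    with v(3) p show ?thesis by (simp add: mult.commute)
  qed
  have "\<exists>l. l < Suc N \<and> v $ l \<noteq> 0"
  proof (rule ccontr)
    assume "\<not> (\<exists>l. l < Suc N \<and> v $ l \<noteq> 0)"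
    then have "v = 0\<^sub>v (Suc N)" using v(1) by (intro eq_vecI) auto
    with v(2) show False by simp
  qed
  \<comment> \<open>\<open>v\<close> lists the coefficients of a nonzero polynomial that annihilates
    \<open>A\<close>, and \<open>k\<close> is the order of its zero at 0. Solving for the
    \<open>k\<close>-th power expresses it through strictly higher ones.\<close>
  define k where "k = (LEAST l. l < Suc N \<and> v $ l \<noteq> 0)"
  have k: "k < Suc N" "v $ k \<noteq> 0"
    using LeastI_ex[OF \<open>\<exists>l. l < Suc N \<and> v $ l \<noteq> 0\<close>] by (simp_all add: k_def)
  have below: "v $ l = 0" if "l < k" for l
    using not_less_Least[of l "\<lambda>l. l < Suc N \<and> v $ l \<noteq> 0"] that k(1) by (auto simp: k_def)
  define a where "a l = - (v $ l / v $ k)" for l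
  define S where "S = mat_lincomb n n {Suc k..<Suc N} a (\<lambda>l. A ^\<^sub>m (l - Suc k))"
  have "A ^\<^sub>m Suc k * S = mat_lincomb n n {Suc k..<Suc N} a (\<lambda>l. A ^\<^sub>m Suc k * A ^\<^sub>m (l - Suc k))"
    unfolding S_def using A by (intro mat_lincomb_mult_left) auto
  also have "\<dots> = mat_lincomb n n {Suc k..<Suc N} a (\<lambda>l. A ^\<^sub>m l)"
    using A by (intro mat_lincomb_cong refl) (simp add: pow_mat_plus[symmetric] del: pow_mat.simps)
  also have "\<dots> = A ^\<^sub>m k"
  proof (rule eq_matI)
    fix i j assume "i < dim_row (A ^\<^sub>m k)" "j < dim_col (A ^\<^sub>m k)"
    then have ij: "i < n" "j < n" using carrier_matD[OF pow_carrier_mat[OF A]] by auto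
    have "0 = (\<Sum>l\<in>{0..<k} \<union> {k..<Suc N}. v $ l * (A ^\<^sub>m l) $$ (i, j))"
      using dep[OF ij] k(1) by (simp add: ivl_disj_un)
    also have "\<dots> = (\<Sum>l\<in>{k..<Suc N}. v $ l * (A ^\<^sub>m l) $$ (i, j))"
      by (intro sum.mono_neutral_right) (auto simp: below)
    also have "{k..<Suc N} = insert k {Suc k..<Suc N}" using k(1) by auto
    finally have "v $ k * (A ^\<^sub>m k) $$ (i, j) = - (\<Sum>l\<in>{Suc k..<Suc N}. v $ l * (A ^\<^sub>m l) $$ (i, j))"
      by (simp add: eq_neg_iff_add_eq_0)
    then have "(A ^\<^sub>m k) $$ (i, j) = - (\<Sum>l\<in>{Suc k..<Suc N}. v $ l * (A ^\<^sub>m l) $$ (i, j)) / v $ k"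
      using k(2) by (simp add: field_simps)
    then show "mat_lincomb n n {Suc k..<Suc N} a (\<lambda>l. A ^\<^sub>m l) $$ (i, j) = (A ^\<^sub>m k) $$ (i, j)"
      using ij by (simp add: mat_lincomb_def a_def sum_negf sum_divide_distrib del: sum.op_ivl_Suc)
  qed (use carrier_matD[OF pow_carrier_mat[OF A]] in auto)
  finally have "A ^\<^sub>m k = A ^\<^sub>m Suc k * S" by simp
  \<comment> \<open>\<open>S\<close> is a polynomial in \<open>A\<close>.\<close>
  moreover have "S * B = B * S" if B: "B \<in> carrier_mat n n" and AB: "A * B = B * A" for B
    unfolding S_def using A B pow_mat_commutes[OF A B AB]
    by (simp add: mat_lincomb_mult_left[of _ _ n n _ n] mat_lincomb_mult_right[of _ _ n n _ n])
  ultimately show thesis using that[of S k] by (simp add: S_def)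
qed

text \<open>Fitting's decomposition: \<open>E\<close> is the projection onto the stable image of \<open>A\<close>.\<close>

lemma fitting_idempotent:
  fixes A :: "'a::field mat"
  assumes A: "A \<in> carrier_mat n n"
  obtains E T k where "E \<in> carrier_mat n n" "T \<in> carrier_mat n n" "E * E = E"
    and "A * T = E" "T * A = E" "A ^\<^sub>m k * E = A ^\<^sub>m k"
    and "\<And>B. B \<in> carrier_mat n n \<Longrightarrow> A * B = B * A \<Longrightarrow> E * B = B * E"
    and "\<And>B. B \<in> carrier_mat n n \<Longrightarrow> A * B = B * A \<Longrightarrow> T * B = B * T"
proof -
  obtain k S where S: "S \<in> carrier_mat n n" and eq: "A ^\<^sub>m k = A ^\<^sub>m Suc k * S"
    and comm: "\<And>B. B \<in> carrier_mat n n \<Longrightarrow> A * B = B * A \<Longrightarrow> S * B = B * S"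
    by (rule stabilizing_power[OF A]) blast
  note [simp] = carrier_matD[OF A] carrier_matD[OF S]
  \<comment> \<open>One power beyond stabilization: \<open>E\<close> then contains a factor
    \<open>A\<close> to spare, so that \<open>T\<close>, with one \<open>A\<close> fewer, inverts
    \<open>A\<close> on the image of \<open>E\<close> even if \<open>k\<close> is 0.\<close>
  define m where "m = Suc k"
  define P where "P = A ^\<^sub>m m"
  have P: "P \<in> carrier_mat n n" using A by (simp add: P_def)
  have SA: "S * A = A * S" using comm[OF A] by simp
  have SjP: "S ^\<^sub>m j * P = P * S ^\<^sub>m j" for j
    unfolding P_def using pow_mat_commutes[OF S] pow_mat_commutes[OF A S] A S SA by simp
  have PA: "P * A = A * P" unfolding P_def using pow_mat_commutes[OF A A] by simp
  have step: "P = P * A * S"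
  proof -
    have "A ^\<^sub>m k * A = A ^\<^sub>m k * A * S * A" using eq by simp
    also have "\<dots> = A ^\<^sub>m k * A * (A * S)" by (simp add: mat_mult_assoc SA)
    also have "\<dots> = A ^\<^sub>m k * A * A * S" by (simp add: mat_mult_assoc)
    finally show ?thesis unfolding P_def m_def pow_mat.simps .
  qed
  have AS: "P = P * (A * S) ^\<^sub>m j" for j
  proof (induction j)
    case 0
    then show ?case using P A by simp
  next
    case (Suc j)
    have "P * (A * S) ^\<^sub>m Suc j = P * (A * S) ^\<^sub>m j * (A * S)"
      using P by (simp add: mat_mult_assoc)
    also have "\<dots> = P * (A * S)" using Suc by simp
    also have "\<dots> = P" using step P by (simp add: mat_mult_assoc)
    finally show ?case by simp
  qed
  \<comment> \<open>\<open>E\<close> is also the \<open>m\<close>-th power of \<open>A * S\<close>,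
    which fixes \<open>P\<close> under multiplication from the right, and it is also
    \<open>S ^\<^sub>m m * P\<close>. Together these two descriptions give idempotency.\<close>
  define E where "E = P * S ^\<^sub>m m"
  define T where "T = A ^\<^sub>m k * S ^\<^sub>m m"
  have E: "E \<in> carrier_mat n n" and T: "T \<in> carrier_mat n n"
    unfolding E_def T_def
    using mult_carrier_mat[OF P pow_carrier_mat[OF S]]
      mult_carrier_mat[OF pow_carrier_mat[OF A] pow_carrier_mat[OF S]] by blast+
  note [simp] = carrier_matD[OF P]
  have EP: "P * E = P"
  proof -
    have "P * E = P * (P * S ^\<^sub>m m)" by (simp add: E_def)
    also have "P * S ^\<^sub>m m = (A * S) ^\<^sub>m m"
      unfolding P_def using pow_mat_mult_commuting[OF A S] SA by simp
    finally show ?thesis using AS by simp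
  qed
  have idem: "E * E = E"
  proof -
    have "E * E = S ^\<^sub>m m * P * E" by (simp add: E_def SjP)
    also have "\<dots> = S ^\<^sub>m m * (P * E)" using E by (intro mat_mult_assoc) auto
    finally show ?thesis by (simp add: EP) (simp add: E_def SjP)
  qed
  have T1: "T * A = E"
  proof -
    have "T * A = A ^\<^sub>m k * (S ^\<^sub>m m * A)" by (simp add: T_def mat_mult_assoc)
    also have "S ^\<^sub>m m * A = A * S ^\<^sub>m m" by (rule pow_mat_commutes[OF S A SA])
    finally show ?thesis by (simp add: E_def P_def m_def mat_mult_assoc)
  qed
  have commT: "T * B = B * T" if B: "B \<in> carrier_mat n n" and AB: "A * B = B * A" for B
  proof -
    note [simp] = carrier_matD[OF B]
    have 1: "S ^\<^sub>m m * B = B * S ^\<^sub>m m"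
      by (rule pow_mat_commutes[OF S B comm[OF B AB]])
    have 2: "A ^\<^sub>m k * B = B * A ^\<^sub>m k"
      by (rule pow_mat_commutes[OF A B AB])
    have "T * B = A ^\<^sub>m k * (B * S ^\<^sub>m m)" by (simp add: T_def mat_mult_assoc 1)
    also have "\<dots> = A ^\<^sub>m k * B * S ^\<^sub>m m" by (simp add: mat_mult_assoc)
    finally show ?thesis by (simp add: 2 T_def mat_mult_assoc)
  qed
  have T2: "A * T = E" using commT[OF A] T1 by simp
  have commE: "E * B = B * E" if B: "B \<in> carrier_mat n n" and AB: "A * B = B * A" for B
  proof -
    note [simp] = carrier_matD[OF B] carrier_matD[OF T]
    have "E * B = T * (A * B)" by (simp add: T1[symmetric] mat_mult_assoc)
    also have "\<dots> = T * B * A" by (simp add: AB mat_mult_assoc)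
    finally show ?thesis by (simp add: commT[OF B AB] mat_mult_assoc T1)
  qed
  show thesis
    by (rule that[OF E T idem T2 T1 EP[unfolded P_def] commE commT])
qed

text \<open>If the entry \<open>k\<close> of a kernel vector is nonzero, then column
  \<open>k\<close> is a combination of the other columns. \<open>A'\<close> omits that column, and
  \<open>Q\<close> restores it with the coefficients \<open>- x $ p / x $ k\<close>. Lowering the
  inner dimension by one in this way serves both the factorization of idempotents and the induction
  for nilpotent traces.\<close>

lemma drop_dependent_column:
  fixes A :: "'a::field mat"
  assumes A: "A \<in> carrier_mat n (Suc r)" and x: "x \<in> carrier_vec (Suc r)" "x \<noteq> 0\<^sub>v (Suc r)"
    and Ax: "A *\<^sub>v x = 0\<^sub>v n"
  obtains A' Q where "A' \<in> carrier_mat n r" "Q \<in> carrier_mat r (Suc r)" "A = A' * Q"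
proof -
  obtain k where k: "k < Suc r" "x $ k \<noteq> 0"
    using x by (metis carrier_vecD eq_vecI index_zero_vec)
  define A' where "A' = mat n r (\<lambda>(i, j). A $$ (i, insert_index k j))"
  define Q where "Q = mat r (Suc r) (\<lambda>(i, j). (if insert_index k i = j then 1 else 0)
      - x $ insert_index k i / x $ k * (if j = k then 1 else 0))"
  have img: "insert_index k ` {0..<r} = {0..<Suc r} - {k}"
    using k(1) by (rule insert_index_image)
  have inj: "inj_on (insert_index k) {0..<r}" by (metis insert_index_inj_on)
  have "A = A' * Q"
  proof (rule eq_matI)
    fix i j assume "i < dim_row (A' * Q)" "j < dim_col (A' * Q)"
    then have ij: "i < n" "j < Suc r" by (auto simp: A'_def Q_def)
    let ?g = "\<lambda>p. A $$ (i, p) * ((if p = j then 1 else 0) - x $ p / x $ k * (if j = k then 1 else 0))"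
    have "(A' * Q) $$ (i, j) = (\<Sum>p = 0..<r. ?g (insert_index k p))"
      using ij by (simp add: A'_def Q_def scalar_prod_def)
    also have "\<dots> = sum ?g ({0..<Suc r} - {k})"
      unfolding img[symmetric] by (simp only: sum.reindex[OF inj] o_def)
    also have "\<dots> = sum ?g {0..<Suc r} - ?g k"
      using k(1) by (subst sum_diff1) auto
    also have "\<dots> = A $$ (i, j)"
    proof (cases "j = k")
      case True
      have "0 = (\<Sum>p = 0..<Suc r. A $$ (i, p) * x $ p)"
        using arg_cong[OF Ax, of "\<lambda>v. v $ i"] A x ij(1) by (simp add: scalar_prod_def)
      then have "(\<Sum>p = 0..<Suc r. A $$ (i, p) * (x $ p / x $ k)) = 0"
        by (simp flip: sum_divide_distrib add: times_divide_eq_right)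
      moreover have g: "?g p = (if p = k then A $$ (i, p) else 0) - A $$ (i, p) * (x $ p / x $ k)" for p
        using True by (simp add: algebra_simps)
      ultimately show ?thesis
        using True k by (simp add: g sum_subtractf del: sum.op_ivl_Suc)
    next
      case False
      then have "?g p = (if p = j then A $$ (i, j) else 0)" for p by simp
      with ij False show ?thesis by (simp del: sum.op_ivl_Suc)
    qed
    finally show "A $$ (i, j) = (A' * Q) $$ (i, j)" by simp
  qed (use A in \<open>auto simp: A'_def Q_def\<close>)
  moreover have "A' \<in> carrier_mat n r" "Q \<in> carrier_mat r (Suc r)" by (simp_all add: A'_def Q_def)
  ultimately show thesis using that by blast
qed

lemma mult_eq_zero_imp_zero:
  fixes A C :: "'a::field mat"
  assumes "A \<in> carrier_mat n r" "C \<in> carrier_mat r m" "A * C = 0\<^sub>m n m"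
    and inj: "\<And>x. x \<in> carrier_vec r \<Longrightarrow> A *\<^sub>v x = 0\<^sub>v n \<Longrightarrow> x = 0\<^sub>v r"
  shows "C = 0\<^sub>m r m"
proof (rule mat_col_eqI)
  fix j assume j: "j < dim_col (0\<^sub>m r m :: 'a mat)"
  then have "A *\<^sub>v col C j = col (A * C) j" using assms(1,2) by (intro col_mult2[symmetric]) auto
  also have "\<dots> = 0\<^sub>v n" unfolding assms(3) using j by simp
  finally have "A *\<^sub>v col C j = 0\<^sub>v n" .
  then have "col C j = 0\<^sub>v r" using inj[of "col C j"] assms(2) j by auto
  then show "col C j = col (0\<^sub>m r m) j" using j by simp
qed (use assms in auto)

text \<open>Take a factorization \<open>E = A B\<close> through the smallest possible dimension.\<close>

lemma idempotent_factorization: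
  fixes E :: "'a::field mat"
  assumes E: "E \<in> carrier_mat n n" and idem: "E * E = E"
  obtains r A B where "A \<in> carrier_mat n r" "B \<in> carrier_mat r n" "A * B = E" "B * A = 1\<^sub>m r"
proof -
  define fac where "fac r \<longleftrightarrow> (\<exists>A \<in> carrier_mat n r. \<exists>B \<in> carrier_mat r n. E = A * B)" for r
  have facI: "fac s" if "X \<in> carrier_mat n s" "Y \<in> carrier_mat s n" "E = X * Y" for s X Y
    using that unfolding fac_def by blast
  have "fac n" using E by (intro facI[of E n "1\<^sub>m n"]) auto
  define r where "r = (LEAST r. fac r)"
  have "fac r" unfolding r_def by (rule LeastI) (rule \<open>fac n\<close>)
  have min: "\<not> fac s" if "s < r" for s using that not_less_Least unfolding r_def by blast
  obtain A B where A: "A \<in> carrier_mat n r" and B: "B \<in> carrier_mat r n" and AB: "E = A * B"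
    using \<open>fac r\<close> unfolding fac_def by auto
  note [simp] = carrier_matD[OF A] carrier_matD[OF B]
  \<comment> \<open>A nonzero kernel vector would make a column of \<open>A\<close> dispensable,
    against the minimality of \<open>r\<close>. The same argument for the transpose of
    \<open>B\<close> follows.\<close>
  have injA: "x = 0\<^sub>v r" if x: "x \<in> carrier_vec r" "A *\<^sub>v x = 0\<^sub>v n" for x
  proof (rule ccontr)
    assume nz: "x \<noteq> 0\<^sub>v r"
    then obtain s where s: "r = Suc s" using x(1) by (cases r) auto
    obtain A' Q where A': "A' \<in> carrier_mat n s" and Q: "Q \<in> carrier_mat s r" and eq: "A = A' * Q"
      using drop_dependent_column[of A n s x] A x nz s by auto
    have "E = A' * (Q * B)" using AB eq A' Q by (simp add: mat_mult_assoc)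
    with A' Q B have "fac s" by (intro facI[of A' s "Q * B"]) simp_all
    with min s show False by simp
  qed
  have injB: "x = 0\<^sub>v r" if x: "x \<in> carrier_vec r" "B\<^sup>T *\<^sub>v x = 0\<^sub>v n" for x
  proof (rule ccontr)
    assume nz: "x \<noteq> 0\<^sub>v r"
    then obtain s where s: "r = Suc s" using x(1) by (cases r) auto
    obtain B' Q where B': "B' \<in> carrier_mat n s" and Q: "Q \<in> carrier_mat s r" and eq: "B\<^sup>T = B' * Q"
      using drop_dependent_column[of "B\<^sup>T" n s x] B x nz s by auto
    have "B = Q\<^sup>T * B'\<^sup>T" using arg_cong[OF eq, of transpose_mat] transpose_mult[OF B' Q] by simp
    then have "E = (A * Q\<^sup>T) * B'\<^sup>T" using AB B' Q by (simp add: mat_mult_assoc)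
    with B' Q A have "fac s" by (intro facI[of "A * Q\<^sup>T" s "B'\<^sup>T"]) simp_all
    with min s show False by simp
  qed
  \<comment> \<open>Idempotency of \<open>E\<close> says \<open>A * D * B\<close> is zero. Now
    \<open>A\<close> cancels on the left, and \<open>B\<close> on the right after
    transposing.\<close>
  define D where "D = B * A - 1\<^sub>m r"
  have D: "D \<in> carrier_mat r r" by (simp add: D_def minus_carrier_mat)
  have DB: "D * B = B * (A * B) - B"
    unfolding D_def using A B by (simp add: minus_mult_distrib_mat[of _ r r] mat_mult_assoc)
  have "A * (D * B) = A * B * (A * B) - A * B"
    unfolding DB using A B by (simp add: mult_minus_distrib_mat[of _ n r _ n] mat_mult_assoc)
  also have "\<dots> = 0\<^sub>m n n" using idem AB E by simp
  finally have "D * B = 0\<^sub>m r n" using mult_eq_zero_imp_zero[OF A _ _ injA] D B by simp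
  then have "B\<^sup>T * D\<^sup>T = 0\<^sub>m n r"
    using transpose_mult[OF D B] by (metis zero_transpose_mat)
  then have "D\<^sup>T = 0\<^sub>m r r" using D B
    by (intro mult_eq_zero_imp_zero[of "B\<^sup>T" n r "D\<^sup>T" r] injB) simp_all
  then have "D = 0\<^sub>m r r" by (metis transpose_transpose zero_transpose_mat)
  have "B * A = 1\<^sub>m r"
  proof (rule eq_matI)
    fix i j assume ij: "i < dim_row (1\<^sub>m r :: 'a mat)" "j < dim_col (1\<^sub>m r :: 'a mat)"
    then have "D $$ (i, j) = 0" using \<open>D = 0\<^sub>m r r\<close> by simp
    then show "(B * A) $$ (i, j) = 1\<^sub>m r $$ (i, j)" using ij by (simp add: D_def)
  qed auto
  then show thesis by (rule that[OF A B AB[symmetric]])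
qed

section \<open>Traces of nilpotent matrices\<close>

definition mat_trace :: "'a::comm_monoid_add mat \<Rightarrow> 'a" where
  "mat_trace A = (\<Sum>i = 0..<dim_row A. A $$ (i, i))"

lemma mat_trace_mult_commute:
  fixes A B :: "'a::comm_semiring_0 mat"
  assumes "A \<in> carrier_mat n m" "B \<in> carrier_mat m n"
  shows "mat_trace (A * B) = mat_trace (B * A)"
proof -
  have "mat_trace (A * B) = (\<Sum>i = 0..<n. \<Sum>j = 0..<m. A $$ (i, j) * B $$ (j, i))"
    using assms by (simp add: mat_trace_def scalar_prod_def)
  also have "\<dots> = mat_trace (B * A)"
    using assms by (subst sum.swap) (simp add: mat_trace_def scalar_prod_def mult.commute)
  finally show ?thesis .
qed

text \<open>A nilpotent matrix is singular, so it factors as \<open>A' * Q\<close> through a space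
  of dimension one less. The trace of \<open>A' * Q\<close> is that of \<open>Q * A'\<close>, which
  is smaller and again nilpotent because its power \<open>Suc j\<close> is
  \<open>Q * A ^\<^sub>m j * A'\<close>.\<close>

lemma mat_trace_nilpotent:
  fixes A :: "'a::field mat"
  assumes "A \<in> carrier_mat n n" "A ^\<^sub>m k = 0\<^sub>m n n"
  shows "mat_trace A = 0"
  using assms
proof (induction n arbitrary: A k)
  case 0
  then show ?case by (simp add: mat_trace_def)
next
  case (Suc n)
  note A = Suc.prems(1)
  have "det A = 0"
  proof (rule ccontr)
    assume "det A \<noteq> 0"
    obtain B where B: "B \<in> carrier_mat (Suc n) (Suc n)" "A * B = 1\<^sub>m (Suc n)" "B * A = 1\<^sub>m (Suc n)"
      using det_non_zero_imp_unit[OF A \<open>det A \<noteq> 0\<close>, of "()"]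
      by (auto simp: Units_def ring_mat_def)
    have "A ^\<^sub>m k * B ^\<^sub>m k = 1\<^sub>m (Suc n) ^\<^sub>m k"
      using pow_mat_mult_commuting[OF A B(1)] B by simp
    also have "\<dots> = 1\<^sub>m (Suc n)" by (induction k) auto
    finally have "0\<^sub>m (Suc n) (Suc n) = (1\<^sub>m (Suc n) :: 'a mat)"
      using Suc.prems(2) carrier_matD[OF pow_carrier_mat[OF B(1)]] by simp
    then have "(0\<^sub>m (Suc n) (Suc n)) $$ (0, 0) = (1\<^sub>m (Suc n) :: 'a mat) $$ (0, 0)" by simp
    then show False by simp
  qed
  then obtain x where "x \<in> carrier_vec (Suc n)" "x \<noteq> 0\<^sub>v (Suc n)" "A *\<^sub>v x = 0\<^sub>v (Suc n)"
    using det_0_iff_vec_prod_zero_field[OF A] by blast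
  then obtain A' Q where A': "A' \<in> carrier_mat (Suc n) n" and Q: "Q \<in> carrier_mat n (Suc n)"
    and eq: "A = A' * Q"
    using drop_dependent_column[OF A] by metis
  note [simp] = carrier_matD[OF A'] carrier_matD[OF Q]
  have pow: "(Q * A') ^\<^sub>m Suc j = Q * A ^\<^sub>m j * A'" for j
  proof (induction j)
    case 0
    then show ?case using A' Q A by simp
  next
    case (Suc j)
    have "(Q * A') ^\<^sub>m Suc (Suc j) = Q * A ^\<^sub>m j * A' * (Q * A')" using Suc by simp
    also have "\<dots> = Q * (A ^\<^sub>m j * (A' * Q)) * A'"
      using A by (simp add: mat_mult_assoc)
    finally show ?case using eq by simp
  qed
  have "(Q * A') ^\<^sub>m Suc k = 0\<^sub>m n n" unfolding pow using Suc.prems(2) A' Q by simp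
  then have "mat_trace (Q * A') = 0" using Suc.IH[of "Q * A'" "Suc k"] A' Q by (simp del: pow_mat.simps)
  then show ?case using mat_trace_mult_commute[OF A' Q] eq by simp
qed

section \<open>Kronecker products\<close>

text \<open>A pair (i, j) is encoded as the index \<open>i * m + j\<close>; this converts sums over
  such indices into double sums.\<close>

lemma sum_div_mod:
  fixes f :: "nat \<Rightarrow> nat \<Rightarrow> 'a::comm_monoid_add"
  shows "(\<Sum>k = 0..<n * m. f (k div m) (k mod m)) = (\<Sum>i = 0..<n. \<Sum>j = 0..<m. f i j)"
proof (induction n)
  case (Suc n)
  have "(\<Sum>k = 0..<Suc n * m. f (k div m) (k mod m)) =
      (\<Sum>k = 0..<n * m. f (k div m) (k mod m)) + (\<Sum>k = n * m..<Suc n * m. f (k div m) (k mod m))"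
    by (rule sum.atLeastLessThan_concat[symmetric]) auto
  also have "(\<Sum>k = n * m..<Suc n * m. f (k div m) (k mod m)) = (\<Sum>j = 0..<m. f n j)"
    using sum.shift_bounds_nat_ivl[of "\<lambda>k. f (k div m) (k mod m)" 0 "n * m" m]
    by (simp add: add.commute)
  finally show ?case using Suc by simp
qed simp

lemma div_mod_bounds:
  fixes i :: nat
  assumes "i < a * b"
  shows "i div b < a" "i mod b < b"
  using assms by (auto simp: less_mult_imp_div_less intro!: mod_less_divisor gr0I)

lemma kronecker_dims [simp]:
  "dim_row (kronecker A B) = dim_row A * dim_row B"
  "dim_col (kronecker A B) = dim_col A * dim_col B"
  by (simp_all add: kronecker_def)

lemma kronecker_carrier [simp, intro]:
  "A \<in> carrier_mat a b \<Longrightarrow> B \<in> carrier_mat c d \<Longrightarrow> kronecker A B \<in> carrier_mat (a * c) (b * d)"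
  by (intro carrier_matI) auto

lemma kronecker_index:
  "i < dim_row A * dim_row B \<Longrightarrow> j < dim_col A * dim_col B \<Longrightarrow> kronecker A B $$ (i, j) =
     A $$ (i div dim_row B, j div dim_col B) * B $$ (i mod dim_row B, j mod dim_col B)"
  by (simp only: kronecker_def index_mat split_conv)

text \<open>The mixed-product rule, that is, functoriality of the tensor product.\<close>

lemma kronecker_mult:
  assumes "dim_col A = dim_row C" "dim_col B = dim_row D"
  shows "kronecker A B * kronecker C D = kronecker (A * C) (B * D)"
proof (rule eq_matI)
  fix i j
  assume "i < dim_row (kronecker (A * C) (B * D))" "j < dim_col (kronecker (A * C) (B * D))"
  then have ij: "i < dim_row A * dim_row B" "j < dim_col C * dim_col D" by auto
  let ?i = "i div dim_row B" and ?i' = "i mod dim_row B"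
  let ?j = "j div dim_col D" and ?j' = "j mod dim_col D"
  note b = div_mod_bounds[OF ij(1)] div_mod_bounds[OF ij(2)]
  let ?m = "dim_row D"
  have "(kronecker A B * kronecker C D) $$ (i, j) = (\<Sum>k = 0..<dim_row C * ?m.
      A $$ (?i, k div ?m) * B $$ (?i', k mod ?m) * (C $$ (k div ?m, ?j) * D $$ (k mod ?m, ?j')))"
    using ij assms by (simp add: scalar_prod_def kronecker_index)
  also have "\<dots> = (\<Sum>p = 0..<dim_row C. \<Sum>q = 0..<?m. A $$ (?i, p) * B $$ (?i', q) * (C $$ (p, ?j) * D $$ (q, ?j')))"
    by (rule sum_div_mod)
  also have "\<dots> = (\<Sum>p = 0..<dim_row C. A $$ (?i, p) * C $$ (p, ?j)) * (\<Sum>q = 0..<?m. B $$ (?i', q) * D $$ (q, ?j'))"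
    by (simp add: sum_product mult_ac)
  also have "\<dots> = kronecker (A * C) (B * D) $$ (i, j)"
    using ij b assms by (simp add: kronecker_index scalar_prod_def)
  finally show "(kronecker A B * kronecker C D) $$ (i, j) = kronecker (A * C) (B * D) $$ (i, j)" .
qed auto

text \<open>Row-major indexing of triples does not depend on the bracketing, so this is an equality
  and no associativity isomorphisms have to be carried along later.\<close>

lemma kronecker_assoc: "kronecker (kronecker A B) C = kronecker A (kronecker B C)"
proof (rule eq_matI)
  fix i j assume "i < dim_row (kronecker A (kronecker B C))" "j < dim_col (kronecker A (kronecker B C))"
  then have ij: "i < dim_row A * dim_row B * dim_row C" "j < dim_col A * dim_col B * dim_col C"
    by (simp_all add: mult.assoc)
  note b = div_mod_bounds[OF ij(1)] div_mod_bounds[OF ij(2)]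
  note b' = div_mod_bounds[OF b(1)] div_mod_bounds[OF b(3)]
  have m: "i mod (dim_row B * dim_row C) = dim_row C * (i div dim_row C mod dim_row B) + i mod dim_row C"
    "j mod (dim_col B * dim_col C) = dim_col C * (j div dim_col C mod dim_col B) + j mod dim_col C"
    by (metis mod_mult2_eq mult.commute)+
  have d: "i div (dim_row B * dim_row C) = i div dim_row C div dim_row B"
    "j div (dim_col B * dim_col C) = j div dim_col C div dim_col B"
    by (metis div_mult2_eq mult.commute)+
  have k: "i mod (dim_row B * dim_row C) < dim_row B * dim_row C" "j mod (dim_col B * dim_col C) < dim_col B * dim_col C"
    using ij by (auto intro!: mod_less_divisor gr0I)
  show "kronecker (kronecker A B) C $$ (i, j) = kronecker A (kronecker B C) $$ (i, j)"
    using ij b b' k by (simp add: kronecker_index mult.assoc) (simp add: m d)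
qed (auto simp: mult.assoc)

lemma kronecker_add_left:
  assumes "A \<in> carrier_mat a b" "A' \<in> carrier_mat a b" "B \<in> carrier_mat c d"
  shows "kronecker (A + A') B = kronecker A B + kronecker A' B"
  using assms by (intro eq_matI) (auto simp: kronecker_index div_mod_bounds distrib_right)

lemma kronecker_add_right:
  assumes "A \<in> carrier_mat a b" "A' \<in> carrier_mat a b" "B \<in> carrier_mat c d"
  shows "kronecker B (A + A') = kronecker B A + kronecker B A'"
  using assms by (intro eq_matI) (auto simp: kronecker_index div_mod_bounds distrib_left)

lemma kronecker_smult_left:
  "kronecker (x \<cdot>\<^sub>m A) B = x \<cdot>\<^sub>m kronecker A B"
  by (intro eq_matI) (auto simp: kronecker_index div_mod_bounds)

lemma kronecker_smult_right:
  "kronecker A (x \<cdot>\<^sub>m B) = x \<cdot>\<^sub>m kronecker A B"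
  by (intro eq_matI) (auto simp: kronecker_index div_mod_bounds)

lemma kronecker_transpose: "(kronecker A B)\<^sup>T = kronecker A\<^sup>T B\<^sup>T"
  by (intro eq_matI) (auto simp: kronecker_index div_mod_bounds)

lemma kronecker_one: "kronecker (1\<^sub>m n) (1\<^sub>m m) = (1\<^sub>m (n * m) :: 'k::field mat)"
proof (rule eq_matI)
  fix i j assume "i < dim_row (1\<^sub>m (n * m) :: 'k mat)" "j < dim_col (1\<^sub>m (n * m) :: 'k mat)"
  then have ij: "i < n * m" "j < n * m" by auto
  have "i = j \<longleftrightarrow> i div m = j div m \<and> i mod m = j mod m"
    by (metis mult_div_mod_eq)
  then show "kronecker (1\<^sub>m n) (1\<^sub>m m) $$ (i, j) = (1\<^sub>m (n * m) :: 'k mat) $$ (i, j)"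
    using ij by (auto simp: kronecker_index div_mod_bounds)
qed auto

lemma kronecker_one_left [simp]: "kronecker (1\<^sub>m 1) A = (A :: 'k::field mat)"
  "kronecker (1\<^sub>m (Suc 0)) A = A"
  by (intro eq_matI; simp add: kronecker_index)+

lemma kronecker_one_right [simp]: "kronecker A (1\<^sub>m 1) = (A :: 'k::field mat)"
  "kronecker A (1\<^sub>m (Suc 0)) = A"
  by (intro eq_matI; simp add: kronecker_index)+

lemma kronecker_zero_left: "kronecker (0\<^sub>m a b) B = 0\<^sub>m (a * dim_row B) (b * dim_col B)"
  by (intro eq_matI) (auto simp: kronecker_index div_mod_bounds)

text \<open>Row-major coordinates of a matrix, as a column.\<close>

definition vcol :: "'k mat \<Rightarrow> 'k mat" where
  "vcol A = mat (dim_row A * dim_col A) 1 (\<lambda>(k, _). A $$ (k div dim_col A, k mod dim_col A))"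

lemma vcol_dims [simp]: "dim_row (vcol A) = dim_row A * dim_col A" "dim_col (vcol A) = Suc 0"
  by (simp_all add: vcol_def)

lemma vcol_carrier [intro]: "A \<in> carrier_mat n m \<Longrightarrow> vcol A \<in> carrier_mat (n * m) 1"
  by auto

lemma vcol_index: "k < dim_row A * dim_col A \<Longrightarrow> vcol A $$ (k, 0) = A $$ (k div dim_col A, k mod dim_col A)"
  by (simp add: vcol_def)

lemma vcol_inject:
  assumes "A \<in> carrier_mat n m" "B \<in> carrier_mat n m" "vcol A = vcol B"
  shows "A = B"
proof (rule eq_matI)
  fix i j assume ij: "i < dim_row B" "j < dim_col B"
  then have "i * m + j < Suc i * m" using assms by simp
  also have "\<dots> \<le> n * m" using ij assms by (intro mult_le_mono1) auto
  finally have "i * m + j < n * m" .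
  moreover have "(i * m + j) div m = i" "(i * m + j) mod m = j" using ij assms by auto
  ultimately show "A $$ (i, j) = B $$ (i, j)"
    using assms vcol_index[of "i * m + j" A] vcol_index[of "i * m + j" B] by simp
qed (use assms in auto)

lemma vcol_surj:
  assumes "v \<in> carrier_mat (n * m) 1"
  obtains A where "A \<in> carrier_mat n m" "v = vcol A"
proof (rule that)
  define A where "A = mat n m (\<lambda>(i, j). v $$ (i * m + j, 0))"
  show "A \<in> carrier_mat n m" by (simp add: A_def)
  show "v = vcol A"
  proof (rule eq_matI)
    fix i j assume "i < dim_row (vcol A)" "j < dim_col (vcol A)"
    then have "i < n * m" "j = 0" by (auto simp: A_def)
    then show "v $$ (i, j) = vcol A $$ (i, j)"
      by (simp add: vcol_def A_def div_mod_bounds)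
  qed (use assms in \<open>auto simp: A_def\<close>)
qed

text \<open>Reading a vector of a tensor product as a matrix turns the action of a Kronecker product
  into two-sided multiplication. Statements about invariants thereby become matrix
  equations.\<close>

lemma kronecker_vcol:
  assumes "A \<in> carrier_mat a n" "B \<in> carrier_mat b m" "C \<in> carrier_mat n m"
  shows "kronecker A B * vcol C = vcol (A * C * B\<^sup>T)"
proof (rule eq_matI)
  fix i j assume "i < dim_row (vcol (A * C * B\<^sup>T))" "j < dim_col (vcol (A * C * B\<^sup>T))"
  with assms have ij: "i < a * b" "j = 0" by auto
  note b = div_mod_bounds[OF ij(1)]
  have "(kronecker A B * vcol C) $$ (i, j) =
      (\<Sum>k = 0..<n * m. A $$ (i div b, k div m) * B $$ (i mod b, k mod m) * C $$ (k div m, k mod m))"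
    using ij assms by (simp add: scalar_prod_def kronecker_index vcol_index)
  also have "\<dots> = (\<Sum>p = 0..<n. \<Sum>q = 0..<m. A $$ (i div b, p) * B $$ (i mod b, q) * C $$ (p, q))"
    by (rule sum_div_mod)
  also have "\<dots> = vcol (A * C * B\<^sup>T) $$ (i, j)"
    using ij b assms by (simp add: vcol_index scalar_prod_def sum_distrib_left mult_ac)
  finally show "(kronecker A B * vcol C) $$ (i, j) = vcol (A * C * B\<^sup>T) $$ (i, j)" .
qed (use assms in auto)

text \<open>The source of all traces below: a pairing on V \<otimes> W evaluated at a vector of V
  \<otimes> W.\<close>

lemma transpose_vcol_mult_vcol:
  fixes E C :: "'k::field mat"
  assumes "E \<in> carrier_mat n m" "C \<in> carrier_mat n m"
  shows "(vcol E)\<^sup>T * vcol C = mat_trace (E\<^sup>T * C) \<cdot>\<^sub>m 1\<^sub>m 1"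
proof (rule eq_matI)
  fix i j assume "i < dim_row (mat_trace (E\<^sup>T * C) \<cdot>\<^sub>m 1\<^sub>m 1)" "j < dim_col (mat_trace (E\<^sup>T * C) \<cdot>\<^sub>m 1\<^sub>m 1)"
  then have ij: "i = 0" "j = 0" by auto
  have "((vcol E)\<^sup>T * vcol C) $$ (i, j) = (\<Sum>k = 0..<n * m. E $$ (k div m, k mod m) * C $$ (k div m, k mod m))"
    using ij assms by (simp add: scalar_prod_def vcol_index)
  also have "\<dots> = (\<Sum>p = 0..<n. \<Sum>q = 0..<m. E $$ (p, q) * C $$ (p, q))"
    by (rule sum_div_mod)
  also have "\<dots> = (\<Sum>q = 0..<m. \<Sum>p = 0..<n. E $$ (p, q) * C $$ (p, q))"
    by (rule sum.swap)
  also have "\<dots> = mat_trace (E\<^sup>T * C)"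
    using assms by (simp add: mat_trace_def scalar_prod_def)
  finally show "((vcol E)\<^sup>T * vcol C) $$ (i, j) = (mat_trace (E\<^sup>T * C) \<cdot>\<^sub>m 1\<^sub>m 1) $$ (i, j)"
    using ij by simp
qed (use assms in auto)

text \<open>The snake identity of duality, with arbitrary matrices for the coevaluation
  \<open>C\<close> and the evaluation \<open>E\<close>. The transposed form is needed in this
  generality, because the second pair of duality maps of a module is twisted by \<open>v\<close> and
  \<open>u\<close>.\<close>

lemma zigzag:
  assumes "C \<in> carrier_mat n m" "E \<in> carrier_mat m l"
  shows "kronecker (1\<^sub>m n) (vcol E)\<^sup>T * kronecker (vcol C) (1\<^sub>m l) = C * E"
proof (rule eq_matI)
  fix i j assume "i < dim_row (C * E)" "j < dim_col (C * E)"
  with assms have ij: "i < n" "j < l" by auto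
  define K L where "K = kronecker (1\<^sub>m n) (vcol E)\<^sup>T" and "L = kronecker (vcol C) (1\<^sub>m l)"
  have dims: "dim_row K = n" "dim_col K = n * m * l" "dim_row L = n * m * l" "dim_col L = l"
    using assms by (simp_all add: K_def L_def mult.assoc)
  let ?\<delta> = "\<lambda>x y. if x = y then 1 else 0 :: 'a"
  have md: "p mod (m * l) = l * (p div l mod m) + p mod l" and dv: "p div (m * l) = p div l div m" for p
    by (metis mod_mult2_eq mult.commute) (metis div_mult2_eq mult.commute)
  have "(kronecker (1\<^sub>m n) (vcol E)\<^sup>T * kronecker (vcol C) (1\<^sub>m l)) $$ (i, j) =
      (\<Sum>p = 0..<(n * m) * l. (?\<delta> i (p div l div m) * E $$ (p div l mod m, p mod l)) *
         (C $$ (p div l div m, p div l mod m) * ?\<delta> (p mod l) j))"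
  proof -
    have "kronecker (1\<^sub>m n) (vcol E)\<^sup>T $$ (i, p) = ?\<delta> i (p div l div m) * E $$ (p div l mod m, p mod l)"
      "kronecker (vcol C) (1\<^sub>m l) $$ (p, j) = C $$ (p div l div m, p div l mod m) * ?\<delta> (p mod l) j"
      if p: "p < n * m * l" for p
    proof -
      have b: "p div l < n * m" "p mod l < l" using div_mod_bounds[OF p] by auto
      have b': "p div l div m < n" "p div l mod m < m" using div_mod_bounds[OF b(1)] by auto
      have k: "p mod (m * l) < m * l" using p by (auto intro!: mod_less_divisor gr0I)
      have "(p mod (m * l)) div l = p div l mod m" "(p mod (m * l)) mod l = p mod l"
        unfolding md using b by auto
      then show "kronecker (1\<^sub>m n) (vcol E)\<^sup>T $$ (i, p) = ?\<delta> i (p div l div m) * E $$ (p div l mod m, p mod l)"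
        using p b b' k ij assms by (simp add: kronecker_index vcol_index dv mult.assoc)
      show "kronecker (vcol C) (1\<^sub>m l) $$ (p, j) = C $$ (p div l div m, p div l mod m) * ?\<delta> (p mod l) j"
        using p b b' ij assms by (simp add: kronecker_index vcol_index)
    qed
    then show ?thesis
      unfolding K_def[symmetric] L_def[symmetric] using ij dims by (simp add: scalar_prod_def)
  qed
  also have "\<dots> = (\<Sum>q = 0..<n * m. \<Sum>r = 0..<l. (?\<delta> i (q div m) * E $$ (q mod m, r)) *
         (C $$ (q div m, q mod m) * ?\<delta> r j))"
    by (rule sum_div_mod[where f = "\<lambda>q r. (?\<delta> i (q div m) * E $$ (q mod m, r)) *
         (C $$ (q div m, q mod m) * ?\<delta> r j)"])
  also have "\<dots> = (\<Sum>a = 0..<n. \<Sum>b = 0..<m. \<Sum>r = 0..<l. (?\<delta> i a * E $$ (b, r)) * (C $$ (a, b) * ?\<delta> r j))"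
    by (rule sum_div_mod[where f = "\<lambda>a b. \<Sum>r = 0..<l. (?\<delta> i a * E $$ (b, r)) * (C $$ (a, b) * ?\<delta> r j)"])
  also have "\<dots> = (\<Sum>a = 0..<n. \<Sum>b = 0..<m. if a = i then E $$ (b, j) * C $$ (a, b) else 0)"
  proof (intro sum.cong refl)
    fix a b
    have "(?\<delta> i a * E $$ (b, r)) * (C $$ (a, b) * ?\<delta> r j) =
        (if r = j then if a = i then E $$ (b, j) * C $$ (a, b) else 0 else 0)" for r
      by auto
    with ij show "(\<Sum>r = 0..<l. (?\<delta> i a * E $$ (b, r)) * (C $$ (a, b) * ?\<delta> r j)) =
        (if a = i then E $$ (b, j) * C $$ (a, b) else 0)" by simp
  qed
  also have "\<dots> = (\<Sum>b = 0..<m. C $$ (i, b) * E $$ (b, j))"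
    using ij by (subst sum.swap) (simp add: mult.commute)
  also have "\<dots> = (C * E) $$ (i, j)"
    using ij assms by (simp add: scalar_prod_def)
  finally show "(kronecker (1\<^sub>m n) (vcol E)\<^sup>T * kronecker (vcol C) (1\<^sub>m l)) $$ (i, j) = (C * E) $$ (i, j)" .
qed (use assms in auto)

lemma zigzag_transpose:
  assumes "C \<in> carrier_mat n m" "E \<in> carrier_mat m l"
  shows "kronecker (vcol C)\<^sup>T (1\<^sub>m l) * kronecker (1\<^sub>m n) (vcol E) = (C * E)\<^sup>T"
proof -
  have c: "kronecker (1\<^sub>m n) (vcol E)\<^sup>T \<in> carrier_mat n (n * m * l)"
    "kronecker (vcol C) (1\<^sub>m l) \<in> carrier_mat (n * m * l) l"
    using assms by (auto simp: mult.assoc)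
  show ?thesis
    unfolding zigzag[OF assms, symmetric] by (simp add: transpose_mult[OF c] kronecker_transpose)
qed

section \<open>Sweedler sums\<close>

text \<open>The linear extension of \<open>F\<close> to the free vector space.\<close>

definition msum :: "nat \<Rightarrow> nat \<Rightarrow> ('a \<Rightarrow> 'k::field mat) \<Rightarrow> ('a \<Rightarrow>\<^sub>0 'k) \<Rightarrow> 'k mat" where
  "msum r c F t = mat_lincomb r c (Poly_Mapping.keys t) (Poly_Mapping.lookup t) F"

lemma msum_carrier [simp]: "msum r c F t \<in> carrier_mat r c"
  and dim_row_msum [simp]: "dim_row (msum r c F t) = r"
  and dim_col_msum [simp]: "dim_col (msum r c F t) = c"
  by (auto simp: msum_def)

lemma msum_index: "i < r \<Longrightarrow> j < c \<Longrightarrow> msum r c F t $$ (i, j) =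
   (\<Sum>a\<in>Poly_Mapping.keys t. Poly_Mapping.lookup t a * F a $$ (i, j))"
  by (simp add: msum_def mat_lincomb_def)

text \<open>Allows elements of the free vector space with different supports to be evaluated over a
  common finite set.\<close>

lemma msum_index_superset:
  assumes "finite S" "Poly_Mapping.keys t \<subseteq> S" "i < r" "j < c"
  shows "msum r c F t $$ (i, j) = (\<Sum>a\<in>S. Poly_Mapping.lookup t a * F a $$ (i, j))"
  unfolding msum_index[OF assms(3,4)] using assms(1,2)
  by (intro sum.mono_neutral_left) (auto simp: in_keys_iff)

lemma msum_cong:
  "(\<And>a. a \<in> Poly_Mapping.keys t \<Longrightarrow> F a = G a) \<Longrightarrow> msum r c F t = msum r c G t"
  unfolding msum_def by (rule mat_lincomb_cong) auto

lemma msum_zero [simp]: "msum r c F 0 = 0\<^sub>m r c"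
  by (rule eq_matI) (auto simp: msum_index)

lemma msum_add: "msum r c F (t + u) = msum r c F t + msum r c F u"
proof (rule eq_matI)
  fix i j assume "i < dim_row (msum r c F t + msum r c F u)" "j < dim_col (msum r c F t + msum r c F u)"
  then have ij: "i < r" "j < c" by auto
  let ?S = "Poly_Mapping.keys t \<union> Poly_Mapping.keys u"
  show "msum r c F (t + u) $$ (i, j) = (msum r c F t + msum r c F u) $$ (i, j)"
    using ij Poly_Mapping.keys_add[of t u]
    by (simp add: msum_index_superset[of ?S] lookup_add distrib_right sum.distrib)
qed auto

lemma lookup_fsmult: "Poly_Mapping.lookup (fsmult x t) a = x * Poly_Mapping.lookup t a"
  by (simp add: fsmult_def Poly_Mapping.map.rep_eq when_def)

lemma msum_fsmult: "msum r c F (fsmult x t) = x \<cdot>\<^sub>m msum r c F t"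
proof (rule eq_matI)
  fix i j assume "i < dim_row (x \<cdot>\<^sub>m msum r c F t)" "j < dim_col (x \<cdot>\<^sub>m msum r c F t)"
  then have ij: "i < r" "j < c" by auto
  have "Poly_Mapping.keys (fsmult x t) \<subseteq> Poly_Mapping.keys t"
    by (auto simp: in_keys_iff lookup_fsmult)
  then show "msum r c F (fsmult x t) $$ (i, j) = (x \<cdot>\<^sub>m msum r c F t) $$ (i, j)"
    using ij by (simp add: msum_index_superset[of "Poly_Mapping.keys t"] lookup_fsmult sum_distrib_left mult.assoc)
qed auto

lemma msum_diff: "msum r c F (t - u) = msum r c F t - msum r c F u"
proof -
  have "msum r c F t = msum r c F (t - u) + msum r c F u"
    using msum_add[of r c F "t - u" u] by simp
  then show ?thesis
    by (intro eq_matI) auto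
qed

lemma msum_pure [simp]:
  assumes "F a \<in> carrier_mat r c"
  shows "msum r c F (pure a) = F a"
  using assms by (intro eq_matI) (auto simp: msum_index)

lemma msum_sum: "finite A \<Longrightarrow> msum r c F (\<Sum>a\<in>A. f a) = mat_lincomb r c A (\<lambda>_. 1) (\<lambda>a. msum r c F (f a))"
  by (induction A rule: finite_induct) (auto simp: msum_add mat_lincomb_def intro!: eq_matI)

text \<open>Composition of linear extensions; it evaluates the nested sums in the axioms for
  products and coassociativity.\<close>

lemma msum_fextend: "msum r c F (fextend f t) = msum r c (\<lambda>a. msum r c F (f a)) t"
  by (rule eq_matI) (auto simp: fextend_def msum_sum msum_fsmult mat_lincomb_def msum_index)

lemma msum_mult_right:
  assumes "\<And>a. F a \<in> carrier_mat r c" "B \<in> carrier_mat c d"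
  shows "msum r c F t * B = msum r d (\<lambda>a. F a * B) t"
  unfolding msum_def using assms by (rule mat_lincomb_mult_right)

lemma msum_mult_left:
  assumes "\<And>a. F a \<in> carrier_mat c d" "B \<in> carrier_mat r c"
  shows "B * msum c d F t = msum r d (\<lambda>a. B * F a) t"
  unfolding msum_def using assms by (rule mat_lincomb_mult_left)

lemma msum_transpose:
  assumes "\<And>a. F a \<in> carrier_mat r c"
  shows "(msum r c F t)\<^sup>T = msum c r (\<lambda>a. (F a)\<^sup>T) t"
proof -
  have "dim_row (F a) = r" "dim_col (F a) = c" for a using assms[of a] by auto
  then show ?thesis by (intro eq_matI) (auto simp: msum_index)
qed

lemma vcol_msum:
  assumes "\<And>a. F a \<in> carrier_mat r c"
  shows "vcol (msum r c F t) = msum (r * c) 1 (\<lambda>a. vcol (F a)) t"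
proof -
  have "dim_row (F a) = r" "dim_col (F a) = c" for a using assms[of a] by auto
  then show ?thesis
    by (intro eq_matI) (auto simp: msum_index vcol_def div_mod_bounds)
qed

lemma kronecker_msum_left:
  assumes "\<And>a. F a \<in> carrier_mat r c" "B \<in> carrier_mat p q"
  shows "kronecker (msum r c F t) B = msum (r * p) (c * q) (\<lambda>a. kronecker (F a) B) t"
proof -
  have "dim_row (F a) = r" "dim_col (F a) = c" for a using assms(1)[of a] by auto
  then show ?thesis using assms(2)
    by (intro eq_matI) (auto simp: msum_index kronecker_index div_mod_bounds sum_distrib_right mult.assoc)
qed

lemma kronecker_msum_right:
  assumes "\<And>a. F a \<in> carrier_mat r c" "B \<in> carrier_mat p q"
  shows "kronecker B (msum r c F t) = msum (p * r) (q * c) (\<lambda>a. kronecker B (F a)) t"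
proof -
  have "dim_row (F a) = r" "dim_col (F a) = c" for a using assms(1)[of a] by auto
  then show ?thesis using assms(2)
    by (intro eq_matI) (auto simp: msum_index kronecker_index div_mod_bounds sum_distrib_left mult.left_commute)
qed

section \<open>Multilinear maps with matrix values\<close>

definition mat_linear :: "('k::field \<Rightarrow> 'h::ab_group_add \<Rightarrow> 'h) \<Rightarrow> nat \<Rightarrow> nat \<Rightarrow> ('h \<Rightarrow> 'k mat) \<Rightarrow> bool" where
  "mat_linear s r c F \<longleftrightarrow> (\<forall>a. F a \<in> carrier_mat r c) \<and> (\<forall>a b. F (a + b) = F a + F b) \<and>
     (\<forall>x a. F (s x a) = x \<cdot>\<^sub>m F a)"

definition mat_bilinear :: "('k::field \<Rightarrow> 'h::ab_group_add \<Rightarrow> 'h) \<Rightarrow> nat \<Rightarrow> nat \<Rightarrow> ('h \<Rightarrow> 'h \<Rightarrow> 'k mat) \<Rightarrow> bool" where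
  "mat_bilinear s r c F \<longleftrightarrow> (\<forall>b. mat_linear s r c (\<lambda>a. F a b)) \<and> (\<forall>a. mat_linear s r c (F a))"

definition mat_trilinear :: "('k::field \<Rightarrow> 'h::ab_group_add \<Rightarrow> 'h) \<Rightarrow> nat \<Rightarrow> nat \<Rightarrow> ('h \<Rightarrow> 'h \<Rightarrow> 'h \<Rightarrow> 'k mat) \<Rightarrow> bool" where
  "mat_trilinear s r c F \<longleftrightarrow> (\<forall>b. mat_bilinear s r c (\<lambda>a. F a b)) \<and> (\<forall>a. mat_bilinear s r c (F a))"

lemma mat_linearD:
  assumes "mat_linear s r c F"
  shows "F a \<in> carrier_mat r c" "F (a + b) = F a + F b" "F (s x a) = x \<cdot>\<^sub>m F a"
  using assms by (auto simp: mat_linear_def)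

lemma mat_bilinearD:
  assumes "mat_bilinear s r c F"
  shows "F a b \<in> carrier_mat r c" "F (a + a') b = F a b + F a' b" "F a (b + b') = F a b + F a b'"
    "F (s x a) b = x \<cdot>\<^sub>m F a b" "F a (s x b) = x \<cdot>\<^sub>m F a b"
  using assms by (auto simp: mat_bilinear_def mat_linear_def)

lemma mat_trilinearD:
  assumes "mat_trilinear s r c F"
  shows "F a b d \<in> carrier_mat r c" "F (a + a') b d = F a b d + F a' b d"
    "F a (b + b') d = F a b d + F a b' d" "F a b (d + d') = F a b d + F a b d'"
    "F (s x a) b d = x \<cdot>\<^sub>m F a b d" "F a (s x b) d = x \<cdot>\<^sub>m F a b d" "F a b (s x d) = x \<cdot>\<^sub>m F a b d"
  using assms by (auto simp: mat_trilinear_def mat_bilinear_def mat_linear_def)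

lemma mat_sum_diff_zero:
  fixes A B :: "'k::field mat"
  assumes "A \<in> carrier_mat r c" "B \<in> carrier_mat r c"
  shows "A + B - A - B = 0\<^sub>m r c"
  using assms by (intro eq_matI) auto

text \<open>The universal property that makes \<open>tensor2_eq\<close> usable: a bilinear map kills
  every relator, so its value does not depend on the representative of an element of the tensor
  square.\<close>

lemma msum_tensor2_null:
  assumes F: "mat_bilinear s r c F" and "t \<in> tensor2_null s"
  shows "msum r c (\<lambda>(a, b). F a b) t = 0\<^sub>m r c"
  using assms(2)
  by induction (simp_all add: msum_add msum_diff msum_fsmult mat_bilinearD[OF F] mat_sum_diff_zero)

lemma msum_tensor3_null:
  assumes F: "mat_trilinear s r c F" and "t \<in> tensor3_null s"
  shows "msum r c (\<lambda>(a, b, d). F a b d) t = 0\<^sub>m r c"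
  using assms(2)
  by induction (simp_all add: msum_add msum_diff msum_fsmult mat_trilinearD[OF F] mat_sum_diff_zero)

lemma mat_eq_if_diff_zero:
  fixes A B :: "'k::field mat"
  assumes "A \<in> carrier_mat r c" "B \<in> carrier_mat r c" "A - B = 0\<^sub>m r c"
  shows "A = B"
proof (rule eq_matI)
  fix i j assume "i < dim_row B" "j < dim_col B"
  then have "A $$ (i, j) - B $$ (i, j) = (A - B) $$ (i, j)" by simp
  also have "\<dots> = 0"
    unfolding assms(3) using assms(2) \<open>i < dim_row B\<close> \<open>j < dim_col B\<close> by auto
  finally show "A $$ (i, j) = B $$ (i, j)" by simp
qed (use assms in auto)

lemma msum_tensor2_eq:
  assumes "mat_bilinear s r c F" "tensor2_eq s t u"
  shows "msum r c (\<lambda>(a, b). F a b) t = msum r c (\<lambda>(a, b). F a b) u"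
  by (rule mat_eq_if_diff_zero[OF msum_carrier msum_carrier], unfold msum_diff[symmetric])
    (rule msum_tensor2_null[OF assms(1) assms(2)[unfolded tensor2_eq_def]])

lemma msum_tensor3_eq:
  assumes "mat_trilinear s r c F" "tensor3_eq s t u"
  shows "msum r c (\<lambda>(a, b, d). F a b d) t = msum r c (\<lambda>(a, b, d). F a b d) u"
  by (rule mat_eq_if_diff_zero[OF msum_carrier msum_carrier], unfold msum_diff[symmetric])
    (rule msum_tensor3_null[OF assms(1) assms(2)[unfolded tensor3_eq_def]])

lemma one_smult_mat [simp]: "1 \<cdot>\<^sub>m (A :: 'a::semiring_1 mat) = A"
  by (intro eq_matI) auto

section \<open>Modules and homomorphisms in matrix form\<close>

lemma hmod_homI:
  assumes "A \<in> carrier_mat (fst W) (fst V)" "\<And>h. A * snd V h = snd W h * A"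
  shows "A \<in> hmod_hom V W"
  using assms by (simp add: hmod_hom_def)

lemma hmod_homD:
  assumes "A \<in> hmod_hom V W"
  shows "A \<in> carrier_mat (fst W) (fst V)" "A * snd V h = snd W h * A"
  using assms by (simp_all add: hmod_hom_def)

lemma hmodule_carrier: "hmodule H V \<Longrightarrow> snd V h \<in> carrier_mat (fst V) (fst V)"
  by (simp add: hmodule_def split: prod.splits)

lemma hmodule_mult: "hmodule H V \<Longrightarrow> snd V (g * h) = snd V g * snd V h"
  by (simp add: hmodule_def split: prod.splits)

lemma hmodule_one: "hmodule H V \<Longrightarrow> snd V 1 = 1\<^sub>m (fst V)"
  by (simp add: hmodule_def split: prod.splits)

lemma hmodule_linear: "hmodule H V \<Longrightarrow> mat_linear (hscale H) (fst V) (fst V) (snd V)"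
  by (simp add: hmodule_def mat_linear_def split: prod.splits)

lemma hmoduleI:
  assumes "mat_linear (hscale H) (fst V) (fst V) (snd V)" "snd V 1 = 1\<^sub>m (fst V)"
    "\<And>g h. snd V (g * h) = snd V g * snd V h"
  shows "hmodule H V"
  using assms by (cases V) (simp add: hmodule_def mat_linear_def)

lemma hmod_hom_comp:
  assumes "B \<in> hmod_hom V W" "A \<in> hmod_hom U V" "hmodule H U" "hmodule H V" "hmodule H W"
  shows "B * A \<in> hmod_hom U W"
proof (rule hmod_homI)
  note [simp] = hmod_homD(1)[OF assms(1), THEN carrier_matD(1)] hmod_homD(1)[OF assms(1), THEN carrier_matD(2)]
    hmod_homD(1)[OF assms(2), THEN carrier_matD(1)] hmod_homD(1)[OF assms(2), THEN carrier_matD(2)]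
    carrier_matD[OF hmodule_carrier[OF assms(3)]] carrier_matD[OF hmodule_carrier[OF assms(4)]]
    carrier_matD[OF hmodule_carrier[OF assms(5)]]
  show "B * A \<in> carrier_mat (fst W) (fst U)" by auto
  fix h
  have "B * A * snd U h = B * snd V h * A"
    by (simp add: mat_mult_assoc hmod_homD(2)[OF assms(2)])
  then show "B * A * snd U h = snd W h * (B * A)"
    by (simp add: mat_mult_assoc hmod_homD(2)[OF assms(1)])
qed

lemma hmod_hom_one: "hmodule H V \<Longrightarrow> 1\<^sub>m (fst V) \<in> hmod_hom V V"
  using carrier_matD[OF hmodule_carrier[of H V]] by (intro hmod_homI) simp_all

lemma hmod_hom_add:
  assumes "A \<in> hmod_hom V W" "B \<in> hmod_hom V W" "hmodule H V" "hmodule H W"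
  shows "A + B \<in> hmod_hom V W"
proof (rule hmod_homI)
  note c = hmod_homD(1)[OF assms(1)] hmod_homD(1)[OF assms(2)]
  show "A + B \<in> carrier_mat (fst W) (fst V)" using c by auto
  show "(A + B) * snd V h = snd W h * (A + B)" for h
    using add_mult_distrib_mat[OF c hmodule_carrier[OF assms(3), of h]]
      mult_add_distrib_mat[OF hmodule_carrier[OF assms(4), of h] c]
    by (simp add: hmod_homD(2)[OF assms(1)] hmod_homD(2)[OF assms(2)])
qed

lemma hmod_hom_smult:
  assumes "A \<in> hmod_hom V W" "hmodule H V" "hmodule H W"
  shows "x \<cdot>\<^sub>m A \<in> hmod_hom V W"
proof (rule hmod_homI)
  note c = hmod_homD(1)[OF assms(1)]
  show "x \<cdot>\<^sub>m A \<in> carrier_mat (fst W) (fst V)" using c by auto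
  show "x \<cdot>\<^sub>m A * snd V h = snd W h * (x \<cdot>\<^sub>m A)" for h
    using mult_smult_assoc_mat[OF c hmodule_carrier[OF assms(2), of h]]
      mult_smult_distrib[OF hmodule_carrier[OF assms(3), of h] c]
    by (simp add: hmod_homD(2)[OF assms(1)])
qed

lemma mat_bilinearI:
  "(\<And>b. mat_linear s r c (\<lambda>a. F a b)) \<Longrightarrow> (\<And>a. mat_linear s r c (\<lambda>b. F a b)) \<Longrightarrow> mat_bilinear s r c F"
  by (simp add: mat_bilinear_def)

lemma mat_trilinearI:
  assumes "\<And>b d. mat_linear s r c (\<lambda>a. F a b d)" "\<And>a d. mat_linear s r c (\<lambda>b. F a b d)"
    "\<And>a b. mat_linear s r c (\<lambda>d. F a b d)"
  shows "mat_trilinear s r c F"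
  using assms by (simp add: mat_trilinear_def mat_bilinear_def)

lemma mat_linear_mult_right:
  assumes "mat_linear s r c F" "B \<in> carrier_mat c d"
  shows "mat_linear s r d (\<lambda>a. F a * B)"
proof -
  note c = mat_linearD(1)[OF assms(1)]
  show ?thesis
    unfolding mat_linear_def
    by (simp add: mat_linearD(2,3)[OF assms(1)] mult_smult_assoc_mat[OF c assms(2)]
        add_mult_distrib_mat[OF c c assms(2)] mult_carrier_mat[OF c assms(2)])
qed

lemma mat_linear_mult_left:
  assumes "mat_linear s c d F" "B \<in> carrier_mat r c"
  shows "mat_linear s r d (\<lambda>a. B * F a)"
proof -
  note c = mat_linearD(1)[OF assms(1)]
  show ?thesis
    unfolding mat_linear_def
    by (simp add: mat_linearD(2,3)[OF assms(1)] mult_smult_distrib[OF assms(2) c]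
        mult_add_distrib_mat[OF assms(2) c c] mult_carrier_mat[OF assms(2) c])
qed

lemma mat_linear_transpose: "mat_linear s r c F \<Longrightarrow> mat_linear s c r (\<lambda>a. (F a)\<^sup>T)"
  using transpose_add[of _ r c] by (auto simp: mat_linear_def)

lemma mat_linear_kronecker_left:
  assumes "mat_linear s r c F" "B \<in> carrier_mat p q"
  shows "mat_linear s (r * p) (c * q) (\<lambda>a. kronecker (F a) B)"
  using assms kronecker_add_left[of _ r c _ B p q] by (auto simp: mat_linear_def kronecker_smult_left)

lemma mat_linear_kronecker_right:
  assumes "mat_linear s r c F" "B \<in> carrier_mat p q"
  shows "mat_linear s (p * r) (q * c) (\<lambda>a. kronecker B (F a))"
  using assms kronecker_add_right[of _ r c _ B p q] by (auto simp: mat_linear_def kronecker_smult_right)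

lemma mat_linear_msum:
  assumes "\<And>a. mat_linear s r c (\<lambda>x. F x a)"
  shows "mat_linear s r c (\<lambda>x. msum r c (F x) t)"
proof -
  have d: "dim_row (F x a) = r" "dim_col (F x a) = c" for x a
    using mat_linearD(1)[OF assms, of x a] by auto
  show ?thesis
    unfolding mat_linear_def
    by (intro conjI allI msum_carrier; rule eq_matI)
      (auto simp: msum_index mat_linearD(2)[OF assms] mat_linearD(3)[OF assms] d distrib_left
        sum.distrib sum_distrib_left mult.left_commute)
qed

section \<open>The Hopf algebra axioms under matrix-valued maps\<close>

context hopf_algebra
begin

text \<open>Sweedler sums \<open>\<Sum> F(h\<^sub>1, h\<^sub>2)\<close> with values in \<open>r \<times> c\<close> matrices.\<close>

definition sw :: "nat \<Rightarrow> nat \<Rightarrow> ('h \<Rightarrow> 'h \<Rightarrow> 'k mat) \<Rightarrow> 'h \<Rightarrow> 'k mat" where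
  "sw r c F h = msum r c (\<lambda>(a, b). F a b) (comult H h)"

abbreviation lin :: "nat \<Rightarrow> nat \<Rightarrow> ('h \<Rightarrow> 'k mat) \<Rightarrow> bool" where
  "lin \<equiv> mat_linear (hscale H)"

lemma sw_carrier [simp]: "sw r c F h \<in> carrier_mat r c"
  and dim_row_sw [simp]: "dim_row (sw r c F h) = r"
  and dim_col_sw [simp]: "dim_col (sw r c F h) = c"
  by (auto simp: sw_def)

text \<open>\<open>comult H\<close> is additive and homogeneous only modulo relators, which the
  bilinear \<open>F\<close> does not notice.\<close>

lemma lin_sw:
  assumes "\<And>b. lin r c (\<lambda>a. F a b)" "\<And>a. lin r c (\<lambda>b. F a b)"
  shows "lin r c (sw r c F)"
proof -
  have F: "mat_bilinear (hscale H) r c F" by (intro mat_bilinearI assms)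
  show ?thesis
    unfolding mat_linear_def sw_def
    using msum_tensor2_eq[OF F comult_add] msum_tensor2_eq[OF F comult_scale]
    by (simp add: msum_add msum_fsmult)
qed

lemma lin_sw_param: "(\<And>a b. lin r c (\<lambda>x. F x a b)) \<Longrightarrow> lin r c (\<lambda>x. sw r c (F x) h)"
  unfolding sw_def by (rule mat_linear_msum) auto

lemma lin_mult_arg:
  assumes "lin r c F"
  shows "lin r c (\<lambda>a. F (a * h))" "lin r c (\<lambda>a. F (h * a))"
  using assms by (simp_all add: mat_linear_def distrib_left distrib_right
      scale_mult_left[symmetric] scale_mult_right[symmetric])

lemma lin_antipode: "lin r c F \<Longrightarrow> lin r c (\<lambda>a. F (antipode H a))"
  by (simp add: mat_linear_def antipode_add antipode_scale)

lemma lin_counit: "M \<in> carrier_mat r c \<Longrightarrow> lin r c (\<lambda>a. counit H a \<cdot>\<^sub>m M)"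
  by (auto simp: mat_linear_def counit_add counit_scale add_smult_distrib_right_mat intro!: eq_matI)

lemma sw_one:
  assumes "\<And>b. lin r c (\<lambda>a. F a b)" "\<And>a. lin r c (\<lambda>b. F a b)"
  shows "sw r c F 1 = F 1 1"
proof -
  have F: "mat_bilinear (hscale H) r c F" by (intro mat_bilinearI assms)
  show ?thesis
    unfolding sw_def msum_tensor2_eq[OF F comult_one] using mat_bilinearD(1)[OF F] by simp
qed

lemma sw_mult:
  assumes "\<And>b. lin r c (\<lambda>a. F a b)" "\<And>a. lin r c (\<lambda>b. F a b)"
  shows "sw r c F (g * h) = sw r c (\<lambda>a b. sw r c (\<lambda>a' b'. F (a * a') (b * b')) h) g"
proof -
  have F: "mat_bilinear (hscale H) r c F" by (intro mat_bilinearI assms)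
  show ?thesis
    unfolding sw_def msum_tensor2_eq[OF F comult_mult]
    by (auto simp: msum_fextend mat_bilinearD(1)[OF F] intro!: msum_cong)
qed

text \<open>Both nested sums flatten to values of one trilinear map on representatives of the two
  sides of \<open>coassoc\<close>.\<close>

lemma sw_coassoc:
  assumes "\<And>b d. lin r c (\<lambda>a. F a b d)" "\<And>a d. lin r c (\<lambda>b. F a b d)" "\<And>a b. lin r c (\<lambda>d. F a b d)"
  shows "sw r c (\<lambda>a b. sw r c (\<lambda>p q. F p q b) a) h = sw r c (\<lambda>a b. sw r c (\<lambda>p q. F a p q) b) h"
proof -
  have F: "mat_trilinear (hscale H) r c F" by (intro mat_trilinearI assms)
  have "sw r c (\<lambda>a b. sw r c (\<lambda>p q. F p q b) a) h = msum r c (\<lambda>(a, b, d). F a b d)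
      (fextend (\<lambda>(a, b). fextend (\<lambda>(p, q). pure (p, q, b)) (comult H a)) (comult H h))"
    unfolding sw_def by (auto simp: msum_fextend mat_trilinearD(1)[OF F] intro!: msum_cong)
  also have "\<dots> = msum r c (\<lambda>(a, b, d). F a b d)
      (fextend (\<lambda>(a, b). fextend (\<lambda>(p, q). pure (a, p, q)) (comult H b)) (comult H h))"
    by (rule msum_tensor3_eq[OF F coassoc])
  also have "\<dots> = sw r c (\<lambda>a b. sw r c (\<lambda>p q. F a p q) b) h"
    unfolding sw_def by (auto simp: msum_fextend mat_trilinearD(1)[OF F] intro!: msum_cong)
  finally show ?thesis .
qed

lemma lin_zero: "lin r c F \<Longrightarrow> F 0 = 0\<^sub>m r c"
  using mat_linearD(1)[of "hscale H" r c F 0] mat_linearD(3)[of "hscale H" r c F 0 0]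
  by (metis (no_types, lifting) scale_zero_left carrier_matD eq_matI index_smult_mat index_zero_mat mult_zero_left)

lemma lin_sum:
  assumes "lin r c F" "finite J"
  shows "F (\<Sum>j\<in>J. hscale H (a j) (b j)) = mat_lincomb r c J a (\<lambda>j. F (b j))"
  using assms(2)
proof (induction J rule: finite_induct)
  case empty
  then show ?case by (auto simp: lin_zero[OF assms(1)] mat_lincomb_def)
next
  case (insert j J)
  have "dim_row (F (b j)) = r" "dim_col (F (b j)) = c" using mat_linearD(1)[OF assms(1), of "b j"] by auto
  with insert show ?case by (auto simp: mat_linearD[OF assms(1)] mat_lincomb_def intro!: eq_matI)
qed

text \<open>Transfers the counit and antipode axioms, which are equations in H, to matrix-valued
  sums.\<close>

lemma lin_sweedler:
  assumes F: "lin r c F"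
  shows "F (sweedler H f h) = sw r c (\<lambda>a b. F (f a b)) h"
  unfolding sweedler_def by (simp add: lin_sum[OF F] sw_def msum_def case_prod_unfold)

lemma sw_counit_left: "lin r c F \<Longrightarrow> sw r c (\<lambda>a b. counit H a \<cdot>\<^sub>m F b) h = F h"
  using lin_sweedler[of r c F "\<lambda>a b. hscale H (counit H a) b" h]
  by (simp add: counit_left mat_linearD(3)[of "hscale H" r c F])

lemma sw_counit_right: "lin r c F \<Longrightarrow> sw r c (\<lambda>a b. counit H b \<cdot>\<^sub>m F a) h = F h"
  using lin_sweedler[of r c F "\<lambda>a b. hscale H (counit H b) a" h]
  by (simp add: counit_right mat_linearD(3)[of "hscale H" r c F])

lemma sw_antipode_left: "lin r c F \<Longrightarrow> sw r c (\<lambda>a b. F (antipode H a * b)) h = counit H h \<cdot>\<^sub>m F 1"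
  using lin_sweedler[of r c F "\<lambda>a b. antipode H a * b" h]
  by (simp add: antipode_left mat_linearD(3)[of "hscale H" r c F])

lemma sw_antipode_right: "lin r c F \<Longrightarrow> sw r c (\<lambda>a b. F (a * antipode H b)) h = counit H h \<cdot>\<^sub>m F 1"
  using lin_sweedler[of r c F "\<lambda>a b. a * antipode H b" h]
  by (simp add: antipode_right mat_linearD(3)[of "hscale H" r c F])

lemma sw_mult_right:
  assumes "\<And>a b. F a b \<in> carrier_mat r c" "B \<in> carrier_mat c d"
  shows "sw r c F h * B = sw r d (\<lambda>a b. F a b * B) h"
  unfolding sw_def using msum_mult_right[of "\<lambda>(a, b). F a b" r c B d] assms
  by (simp add: case_prod_unfold)

lemma sw_mult_left:
  assumes "\<And>a b. F a b \<in> carrier_mat c d" "B \<in> carrier_mat r c"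
  shows "B * sw c d F h = sw r d (\<lambda>a b. B * F a b) h"
  unfolding sw_def using msum_mult_left[of "\<lambda>(a, b). F a b" c d B r] assms
  by (simp add: case_prod_unfold)

lemma sw_transpose: "(\<And>a b. F a b \<in> carrier_mat r c) \<Longrightarrow> (sw r c F h)\<^sup>T = sw c r (\<lambda>a b. (F a b)\<^sup>T) h"
  unfolding sw_def using msum_transpose[of "\<lambda>(a, b). F a b" r c] by (simp add: case_prod_unfold)

lemma vcol_sw: "(\<And>a b. F a b \<in> carrier_mat r c) \<Longrightarrow> vcol (sw r c F h) = sw (r * c) 1 (\<lambda>a b. vcol (F a b)) h"
  unfolding sw_def using vcol_msum[of "\<lambda>(a, b). F a b" r c] by (simp add: case_prod_unfold)

lemma kronecker_sw_left:
  assumes "\<And>a b. F a b \<in> carrier_mat r c" "B \<in> carrier_mat p q"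
  shows "kronecker (sw r c F h) B = sw (r * p) (c * q) (\<lambda>a b. kronecker (F a b) B) h"
  unfolding sw_def using kronecker_msum_left[of "\<lambda>(a, b). F a b" r c B p q] assms
  by (simp add: case_prod_unfold)

lemma kronecker_sw_right:
  assumes "\<And>a b. F a b \<in> carrier_mat r c" "B \<in> carrier_mat p q"
  shows "kronecker B (sw r c F h) = sw (p * r) (q * c) (\<lambda>a b. kronecker B (F a b)) h"
  unfolding sw_def using kronecker_msum_right[of "\<lambda>(a, b). F a b" r c B p q] assms
  by (simp add: case_prod_unfold)

text \<open>The convolution inverse of \<open>\<rho>\<close> is \<open>\<rho> \<circ> S\<close>.\<close>

lemma convolution_left_cancel:
  assumes V: "hmodule H V" and \<tau>: "lin (fst V) c \<tau>" and M: "M \<in> carrier_mat (fst V) c"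
    and eq: "\<And>h. sw (fst V) c (\<lambda>a b. snd V a * \<tau> b) h = counit H h \<cdot>\<^sub>m M"
  shows "\<tau> h = snd V (antipode H h) * M"
proof -
  define n \<rho> where "n = fst V" and "\<rho> = snd V"
  note \<rho> = hmodule_linear[OF V, folded n_def \<rho>_def]
  note cc = mat_linearD(1)[OF \<rho>] mat_linearD(1)[OF \<tau>, folded n_def]
  note [simp] = carrier_matD[OF mat_linearD(1)[OF \<rho>]] carrier_matD[OF mat_linearD(1)[OF \<tau>, folded n_def]]
  let ?S = "antipode H"
  have "\<tau> h = sw n c (\<lambda>a b. counit H a \<cdot>\<^sub>m \<tau> b) h"
    unfolding n_def by (rule sw_counit_left[OF \<tau>, symmetric])
  \<comment> \<open>The counit is expanded as S(p) q under \<open>\<rho>\<close>. Coassociativity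
    then brings \<open>\<rho> q\<close> next to \<open>\<tau>\<close>, where the hypothesis applies,
    and the counit produced there disappears by the counit axiom.\<close>
  also have "\<dots> = sw n c (\<lambda>a b. sw n c (\<lambda>p q. \<rho> (?S p) * \<rho> q * \<tau> b) a) h"
  proof -
    have "counit H a \<cdot>\<^sub>m \<tau> b = sw n c (\<lambda>p q. \<rho> (?S p) * \<rho> q * \<tau> b) a" for a b
    proof -
      have "sw n c (\<lambda>p q. \<rho> (?S p) * \<rho> q * \<tau> b) a = sw n n (\<lambda>p q. \<rho> (?S p * q)) a * \<tau> b"
        using hmodule_mult[OF V, folded \<rho>_def] cc by (subst sw_mult_right[where d = c]) auto
      also have "\<dots> = counit H a \<cdot>\<^sub>m 1\<^sub>m n * \<tau> b"
        using sw_antipode_left[OF \<rho>] hmodule_one[OF V] by (simp add: \<rho>_def n_def)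
      finally show ?thesis
        using mult_smult_assoc_mat[OF one_carrier_mat cc(2)] by simp
    qed
    then show ?thesis by simp
  qed
  also have "\<dots> = sw n c (\<lambda>a b. sw n c (\<lambda>p q. \<rho> (?S a) * \<rho> p * \<tau> q) b) h"
    by (rule sw_coassoc) (intro mat_linear_mult_right[where c = n] mat_linear_mult_left[where c = n] lin_antipode
        \<rho> \<tau>[folded n_def] cc mult_carrier_mat[OF cc(1) cc(1)])+
  also have "\<dots> = sw n c (\<lambda>a b. counit H b \<cdot>\<^sub>m (\<rho> (?S a) * M)) h"
  proof -
    have "sw n c (\<lambda>p q. \<rho> (?S a) * \<rho> p * \<tau> q) b = counit H b \<cdot>\<^sub>m (\<rho> (?S a) * M)" for a b
    proof -
      have "sw n c (\<lambda>p q. \<rho> (?S a) * \<rho> p * \<tau> q) b = \<rho> (?S a) * sw n c (\<lambda>p q. \<rho> p * \<tau> q) b"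
        using cc by (subst sw_mult_left[where r = n]) (auto simp: mat_mult_assoc)
      also have "\<dots> = \<rho> (?S a) * (counit H b \<cdot>\<^sub>m M)"
        using eq by (simp add: n_def \<rho>_def)
      finally show ?thesis
        using mult_smult_distrib[OF cc(1) M[folded n_def]] by simp
    qed
    then show ?thesis by simp
  qed
  also have "\<dots> = \<rho> (?S h) * M"
    by (rule sw_counit_right) (intro mat_linear_mult_right[where c = n] lin_antipode \<rho> M[folded n_def])
  finally show ?thesis by (simp add: \<rho>_def)
qed

text \<open>The mirror image of the left cancellation: here the counit is expanded as p
  S(q).\<close>

lemma convolution_right_cancel:
  assumes V: "hmodule H V" and \<tau>: "lin c (fst V) \<tau>" and M: "M \<in> carrier_mat c (fst V)"
    and eq: "\<And>h. sw c (fst V) (\<lambda>a b. \<tau> a * snd V b) h = counit H h \<cdot>\<^sub>m M"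
  shows "\<tau> h = M * snd V (antipode H h)"
proof -
  define n \<rho> where "n = fst V" and "\<rho> = snd V"
  note \<rho> = hmodule_linear[OF V, folded n_def \<rho>_def]
  note cc = mat_linearD(1)[OF \<rho>] mat_linearD(1)[OF \<tau>, folded n_def]
  note [simp] = carrier_matD[OF mat_linearD(1)[OF \<rho>]] carrier_matD[OF mat_linearD(1)[OF \<tau>, folded n_def]]
  let ?S = "antipode H"
  have "\<tau> h = sw c n (\<lambda>a b. counit H b \<cdot>\<^sub>m \<tau> a) h"
    unfolding n_def by (rule sw_counit_right[OF \<tau>, symmetric])
  also have "\<dots> = sw c n (\<lambda>a b. sw c n (\<lambda>p q. \<tau> a * \<rho> p * \<rho> (?S q)) b) h"
  proof -
    have "counit H b \<cdot>\<^sub>m \<tau> a = sw c n (\<lambda>p q. \<tau> a * \<rho> p * \<rho> (?S q)) b" for a b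
    proof -
      have "sw c n (\<lambda>p q. \<tau> a * \<rho> p * \<rho> (?S q)) b = \<tau> a * sw n n (\<lambda>p q. \<rho> (p * ?S q)) b"
        using hmodule_mult[OF V, folded \<rho>_def] cc by (subst sw_mult_left[where r = c]) (auto simp: mat_mult_assoc)
      also have "\<dots> = \<tau> a * (counit H b \<cdot>\<^sub>m 1\<^sub>m n)"
        using sw_antipode_right[OF \<rho>] hmodule_one[OF V] by (simp add: \<rho>_def n_def)
      finally show ?thesis
        using mult_smult_distrib[OF cc(2) one_carrier_mat] by simp
    qed
    then show ?thesis by simp
  qed
  also have "\<dots> = sw c n (\<lambda>a b. sw c n (\<lambda>p q. \<tau> p * \<rho> q * \<rho> (?S b)) a) h"
    by (rule sw_coassoc[symmetric]) (intro mat_linear_mult_right[where c = n] mat_linear_mult_left[where c = n] lin_antipode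
        \<rho> \<tau>[folded n_def] cc mult_carrier_mat[OF cc(2) cc(1)])+
  also have "\<dots> = sw c n (\<lambda>a b. counit H a \<cdot>\<^sub>m (M * \<rho> (?S b))) h"
  proof -
    have "sw c n (\<lambda>p q. \<tau> p * \<rho> q * \<rho> (?S b)) a = counit H a \<cdot>\<^sub>m (M * \<rho> (?S b))" for a b
    proof -
      have "sw c n (\<lambda>p q. \<tau> p * \<rho> q * \<rho> (?S b)) a = sw c n (\<lambda>p q. \<tau> p * \<rho> q) a * \<rho> (?S b)"
        using cc by (subst sw_mult_right[where d = n]) auto
      also have "\<dots> = counit H a \<cdot>\<^sub>m M * \<rho> (?S b)"
        using eq by (simp add: n_def \<rho>_def)
      finally show ?thesis
        using mult_smult_assoc_mat[OF M[folded n_def] cc(1)] by simp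
    qed
    then show ?thesis by simp
  qed
  also have "\<dots> = M * \<rho> (?S h)"
    by (rule sw_counit_left) (intro mat_linear_mult_left[where c = n] lin_antipode \<rho> M[folded n_def])
  finally show ?thesis by (simp add: \<rho>_def)
qed

text \<open>The antipode axiom at the unit, whose coproduct is represented by 1 \<otimes> 1.
  Applying the action first makes the bilinear calculus available.\<close>

lemma hmodule_antipode_one:
  assumes V: "hmodule H V"
  shows "snd V (antipode H 1) = 1\<^sub>m (fst V)"
proof -
  note \<rho> = hmodule_linear[OF V]
  have "sw (fst V) (fst V) (\<lambda>a b. snd V (antipode H a * b)) 1 = snd V (antipode H 1 * 1)"
    by (rule sw_one; intro lin_antipode[of _ _ "\<lambda>a. snd V (a * _)"] lin_mult_arg \<rho>)
  then show ?thesis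
    using sw_antipode_left[OF \<rho>, of 1] hmodule_one[OF V] by (simp add: counit_one)
qed

end

section \<open>Tensor products and duals of modules\<close>

lemma vcol_smult: "vcol (x \<cdot>\<^sub>m A) = x \<cdot>\<^sub>m vcol A"
  by (intro eq_matI) (auto simp: vcol_def div_mod_bounds)

lemma fst_hmod_trivial [simp]: "fst (hmod_trivial H) = 1"
  and fst_hmod_tensor [simp]: "fst (hmod_tensor H V W) = fst V * fst W"
  and fst_hmod_dual [simp]: "fst (hmod_dual H V) = fst V"
  and snd_hmod_trivial: "snd (hmod_trivial H) h = counit H h \<cdot>\<^sub>m 1\<^sub>m 1"
  and snd_hmod_dual: "snd (hmod_dual H V) h = (snd V (antipode H h))\<^sup>T"
  by (simp_all add: hmod_trivial_def hmod_tensor_def hmod_dual_def)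

text \<open>The flip from m \<otimes> n coordinates to n \<otimes> m coordinates, as a permutation
  matrix.\<close>

definition swap_mat :: "nat \<Rightarrow> nat \<Rightarrow> 'a::{zero,one} mat" where
  "swap_mat n m = mat (n * m) (m * n) (\<lambda>(p, q). if p div m = q mod n \<and> p mod m = q div n then 1 else 0)"

lemma swap_mat_carrier [simp]: "swap_mat n m \<in> carrier_mat (n * m) (m * n)"
  by (simp add: swap_mat_def)

lemma swap_mat_transpose: "(swap_mat n m)\<^sup>T = swap_mat m n"
  by (intro eq_matI) (auto simp: swap_mat_def)

lemma swap_mat_inverse: "swap_mat n m * swap_mat m n = (1\<^sub>m (n * m) :: 'k::field mat)"
proof (rule eq_matI)
  fix p p' assume "p < dim_row (1\<^sub>m (n * m) :: 'k mat)" "p' < dim_col (1\<^sub>m (n * m) :: 'k mat)"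
  then have p: "p < n * m" "p' < n * m" by auto
  note b = div_mod_bounds[OF p(1)] div_mod_bounds[OF p(2)]
  let ?f = "\<lambda>c d. (if p div m = d \<and> p mod m = c then 1 else 0) * (if c = p' mod m \<and> d = p' div m then 1 else 0) :: 'k"
  have "(swap_mat n m * swap_mat m n) $$ (p, p') = (\<Sum>q = 0..<m * n. ?f (q div n) (q mod n))"
    using p by (simp add: scalar_prod_def swap_mat_def)
  also have "\<dots> = (\<Sum>c = 0..<m. \<Sum>d = 0..<n. ?f c d)" by (rule sum_div_mod)
  also have "\<dots> = (\<Sum>c = 0..<m. \<Sum>d = 0..<n. if d = p div m then if c = p mod m then
      if p mod m = p' mod m \<and> p div m = p' div m then 1 else 0 else 0 else 0)"
    by (intro sum.cong refl) auto
  also have "\<dots> = (if p mod m = p' mod m \<and> p div m = p' div m then 1 else 0)"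
    using b by simp
  also have "\<dots> = (if p = p' then 1 else 0)" by (metis mult_div_mod_eq)
  finally show "(swap_mat n m * swap_mat m n) $$ (p, p') = (1\<^sub>m (n * m) :: 'k mat) $$ (p, p')"
    using p by simp
qed (auto simp: swap_mat_def)

text \<open>A coevaluation for V \<otimes> W arises by inserting that of W into the middle of that
  of V. Read as a matrix it is the flip, which is the candidate for the isomorphism between the dual
  of a tensor product and the reversed tensor product of the duals.\<close>

lemma nested_coevaluation:
  "kronecker (1\<^sub>m n) (kronecker (vcol (1\<^sub>m m)) (1\<^sub>m n)) * vcol (1\<^sub>m n) = (vcol (swap_mat n m) :: 'k::field mat)"
proof -
  let ?K = "kronecker (vcol (1\<^sub>m m)) (1\<^sub>m n) :: 'k mat"
  have K: "?K \<in> carrier_mat (m * m * n) n" by auto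
  have "kronecker (1\<^sub>m n) ?K * vcol (1\<^sub>m n) = vcol (1\<^sub>m n * 1\<^sub>m n * ?K\<^sup>T)"
    by (rule kronecker_vcol[OF one_carrier_mat K one_carrier_mat])
  also have "1\<^sub>m n * 1\<^sub>m n * ?K\<^sup>T = ?K\<^sup>T" using K by simp
  also have "vcol ?K\<^sup>T = vcol (swap_mat n m)"
  proof (rule eq_matI)
    fix k j assume "k < dim_row (vcol (swap_mat n m) :: 'k mat)" "j < dim_col (vcol (swap_mat n m) :: 'k mat)"
    then have k: "k < (n * m) * (m * n)" and j: "j = 0" by (auto simp: swap_mat_def)
    define p q where "p = k div (m * n)" and "q = k mod (m * n)"
    have pq: "p < n * m" "q < m * n" unfolding p_def q_def using div_mod_bounds[OF k] by auto
    \<comment> \<open>The digits of \<open>k\<close> as an index of a fourfold tensor with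
      dimensions n, m, m, n. The left side cuts this index after the first digit and the right side
      in the middle, so the rest is a comparison of digits.\<close>
    define a b c d where "a = p div m" and "b = p mod m" and "c = q div n" and "d = q mod n"
    have bd: "a < n" "b < m" "c < m" "d < n"
      unfolding a_def b_def c_def d_def using div_mod_bounds[OF pq(1)] div_mod_bounds[OF pq(2)] by auto
    have kk: "k < n * (m * m * n)" using k by (simp add: mult_ac)
    define r where "r = k mod (m * m * n)"
    have a': "k div (m * m * n) = a"
      unfolding a_def p_def by (simp add: div_mult2_eq[symmetric] mult_ac)
    have r: "r = (m * n) * b + q"
    proof -
      have "k mod ((m * n) * m) = (m * n) * (k div (m * n) mod m) + k mod (m * n)" by (rule mod_mult2_eq)
      then show ?thesis by (simp add: r_def b_def p_def q_def mult_ac)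
    qed
    have "r div n = m * b + c"
    proof -
      have "r = q + (m * b) * n" by (simp add: r)
      then show ?thesis using bd by (simp add: c_def)
    qed
    then have r1: "r div n div m = b" "r div n mod m = c" using bd by auto
    have r2: "r mod n = d"
    proof -
      have "r = q + (m * b) * n" by (simp add: r)
      then show ?thesis by (simp add: d_def)
    qed
    have rb: "r < m * m * n" "r div n < m * m"
    proof -
      show "r < m * m * n" unfolding r_def using kk by (auto intro!: mod_less_divisor gr0I)
      then show "r div n < m * m" by (rule div_mod_bounds)
    qed
    have "vcol ?K\<^sup>T $$ (k, 0) = ?K $$ (r, a)"
      using kk a' bd rb by (simp add: vcol_index r_def)
    also have "\<dots> = (if b = c then 1 else 0) * (if d = a then 1 else 0)"
      using bd rb r1 r2 by (simp add: kronecker_index vcol_index)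
    also have "\<dots> = swap_mat n m $$ (p, q)"
      using pq by (simp add: swap_mat_def a_def b_def c_def d_def)
    also have "\<dots> = vcol (swap_mat n m) $$ (k, 0)"
      using k by (simp add: vcol_index p_def q_def carrier_matD[OF swap_mat_carrier])
    finally show "vcol ?K\<^sup>T $$ (k, j) = vcol (swap_mat n m) $$ (k, j)" by (simp add: j)
  qed (auto simp: swap_mat_def mult_ac)
  finally show ?thesis .
qed

context hopf_algebra
begin

lemma sw_swap: "sw r c (\<lambda>a b. sw r c (\<lambda>a' b'. F a b a' b') h) g = sw r c (\<lambda>a' b'. sw r c (\<lambda>a b. F a b a' b') g) h"
proof (rule eq_matI)
  fix i j assume "i < dim_row (sw r c (\<lambda>a' b'. sw r c (\<lambda>a b. F a b a' b') g) h)"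
    "j < dim_col (sw r c (\<lambda>a' b'. sw r c (\<lambda>a b. F a b a' b') g) h)"
  then show "sw r c (\<lambda>a b. sw r c (\<lambda>a' b'. F a b a' b') h) g $$ (i, j) =
      sw r c (\<lambda>a' b'. sw r c (\<lambda>a b. F a b a' b') g) h $$ (i, j)"
    by (simp add: sw_def msum_index case_prod_unfold sum_distrib_left mult.left_commute)
      (rule sum.swap)
qed auto

text \<open>
  \<open>\<Sum> \<rho>(S(g\<^sub>1 h)) \<rho>(g\<^sub>2) = \<epsilon>(g) \<rho>(S(h))\<close>, by cancellation in \<open>h\<close>; cancellation in \<open>g\<close> then gives
  \<open>\<rho>(S(g h)) = \<rho>(S(h)) \<rho>(S(g))\<close>.
\<close>

lemma hmodule_antipode_mult:
  assumes V: "hmodule H V"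
  shows "snd V (antipode H (g * h)) = snd V (antipode H h) * snd V (antipode H g)"
proof -
  define n \<rho> \<sigma> where "n = fst V" and "\<rho> = snd V" and "\<sigma> = (\<lambda>h. \<rho> (antipode H h))"
  note \<rho> = hmodule_linear[OF V, folded n_def \<rho>_def]
  have \<sigma>: "lin n n \<sigma>" unfolding \<sigma>_def by (intro lin_antipode \<rho>)
  note c = mat_linearD(1)[OF \<rho>] mat_linearD(1)[OF \<sigma>]
  note [simp] = carrier_matD[OF c(1)] carrier_matD[OF c(2)]
  define \<tau> where "\<tau> g h = sw n n (\<lambda>a b. \<sigma> (a * h) * \<rho> b) g" for g h
  have lin\<tau>: "lin n n (\<tau> g)" for g
    unfolding \<tau>_def by (intro lin_sw_param mat_linear_mult_right[where c = n] lin_mult_arg \<sigma> c)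
  have "\<tau> g h = counit H g \<cdot>\<^sub>m \<sigma> h" for g h
  proof -
    have "sw n n (\<lambda>a b. \<tau> g a * \<rho> b) h = counit H h \<cdot>\<^sub>m (counit H g \<cdot>\<^sub>m 1\<^sub>m n)" for h
    proof -
      have "sw n n (\<lambda>a b. \<tau> g a * \<rho> b) h = sw n n (\<lambda>a b. sw n n (\<lambda>p q. \<sigma> (p * a) * \<rho> (q * b)) g) h"
      proof -
        have "\<tau> g a * \<rho> b = sw n n (\<lambda>p q. \<sigma> (p * a) * \<rho> (q * b)) g" for a b
          unfolding \<tau>_def using c hmodule_mult[OF V, folded \<rho>_def]
          by (subst sw_mult_right[where d = n]) (auto simp: mat_mult_assoc)
        then show ?thesis by simp
      qed
      also have "\<dots> = sw n n (\<lambda>p q. sw n n (\<lambda>a b. \<sigma> (p * a) * \<rho> (q * b)) h) g"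
        by (rule sw_swap)
      also have "\<dots> = sw n n (\<lambda>a b. \<sigma> a * \<rho> b) (g * h)"
        by (rule sw_mult[symmetric]; intro mat_linear_mult_right[where c = n] mat_linear_mult_left[where c = n] \<sigma> \<rho> c)
      also have "\<dots> = counit H (g * h) \<cdot>\<^sub>m 1\<^sub>m n"
        using sw_antipode_left[OF \<rho>, of "g * h"] hmodule_mult[OF V, folded \<rho>_def] hmodule_one[OF V]
        by (simp add: \<sigma>_def \<rho>_def n_def)
      finally show ?thesis by (auto simp: counit_mult mult_ac intro!: eq_matI)
    qed
    then have "\<tau> g h = counit H g \<cdot>\<^sub>m 1\<^sub>m n * snd V (antipode H h)"
      using convolution_right_cancel[OF V, of n "\<tau> g" "counit H g \<cdot>\<^sub>m 1\<^sub>m n"] lin\<tau>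
      by (simp add: n_def \<rho>_def)
    also have "snd V (antipode H h) = \<sigma> h" by (simp add: \<sigma>_def \<rho>_def)
    also have "counit H g \<cdot>\<^sub>m 1\<^sub>m n * \<sigma> h = counit H g \<cdot>\<^sub>m \<sigma> h"
      by (simp add: mult_smult_assoc_mat[OF one_carrier_mat c(2)])
    finally show ?thesis .
  qed
  then have "sw n n (\<lambda>a b. \<sigma> (a * h) * \<rho> b) g = counit H g \<cdot>\<^sub>m \<sigma> h" for g
    by (simp add: \<tau>_def)
  then have "\<sigma> (g * h) = \<sigma> h * snd V (antipode H g)"
    using convolution_right_cancel[OF V, of n "\<lambda>a. \<sigma> (a * h)" "\<sigma> h"] c lin_mult_arg(1)[OF \<sigma>]
    by (simp add: n_def \<rho>_def)
  then show ?thesis by (simp add: \<sigma>_def \<rho>_def)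
qed

text \<open>The antipode and the transposition both reverse products, so the dual is again a left
  module.\<close>

lemma hmodule_dual:
  assumes V: "hmodule H V"
  shows "hmodule H (hmod_dual H V)"
proof (rule hmoduleI)
  show "lin (fst (hmod_dual H V)) (fst (hmod_dual H V)) (snd (hmod_dual H V))"
    unfolding snd_hmod_dual[abs_def] fst_hmod_dual
    by (intro mat_linear_transpose lin_antipode hmodule_linear V)
  show "snd (hmod_dual H V) 1 = 1\<^sub>m (fst (hmod_dual H V))"
    by (simp add: snd_hmod_dual hmodule_antipode_one[OF V])
  show "snd (hmod_dual H V) (g * h) = snd (hmod_dual H V) g * snd (hmod_dual H V) h" for g h
    by (simp add: snd_hmod_dual hmodule_antipode_mult[OF V]
        transpose_mult[OF hmodule_carrier[OF V] hmodule_carrier[OF V]])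
qed

lemma hmod_dual_hom:
  assumes "A \<in> hmod_hom V W" "hmodule H V" "hmodule H W"
  shows "A\<^sup>T \<in> hmod_hom (hmod_dual H W) (hmod_dual H V)"
proof (rule hmod_homI)
  note c = hmod_homD(1)[OF assms(1)]
  show "A\<^sup>T \<in> carrier_mat (fst (hmod_dual H V)) (fst (hmod_dual H W))" using c by simp
  show "A\<^sup>T * snd (hmod_dual H W) h = snd (hmod_dual H V) h * A\<^sup>T" for h
    by (simp add: snd_hmod_dual transpose_mult[OF c hmodule_carrier[OF assms(2)], symmetric]
        transpose_mult[OF hmodule_carrier[OF assms(3)] c, symmetric] hmod_homD(2)[OF assms(1)])
qed

lemma hmodule_trivial: "hmodule H (hmod_trivial H)"
proof (rule hmoduleI)
  show "lin (fst (hmod_trivial H)) (fst (hmod_trivial H)) (snd (hmod_trivial H))"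
    unfolding snd_hmod_trivial[abs_def] by (intro lin_counit) simp
qed (auto simp: snd_hmod_trivial counit_one counit_mult intro!: eq_matI)

lemma snd_hmod_tensor:
  "snd (hmod_tensor H V W) h = sw (fst V * fst W) (fst V * fst W) (\<lambda>a b. kronecker (snd V a) (snd W b)) h"
  by (simp add: hmod_tensor_def sw_def msum_def mat_lincomb_def case_prod_unfold)

lemma hmodule_tensor:
  assumes V: "hmodule H V" and W: "hmodule H W"
  shows "hmodule H (hmod_tensor H V W)"
proof (rule hmoduleI)
  note l = hmodule_linear[OF V] hmodule_linear[OF W]
  note c = hmodule_carrier[OF V] hmodule_carrier[OF W]
  note [simp] = carrier_matD[OF c(1)] carrier_matD[OF c(2)]
  let ?F = "\<lambda>a b. kronecker (snd V a) (snd W b)" and ?n = "fst V * fst W"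
  have F: "\<And>b. lin ?n ?n (\<lambda>a. ?F a b)" "\<And>a. lin ?n ?n (\<lambda>b. ?F a b)"
    by (intro mat_linear_kronecker_left mat_linear_kronecker_right l c)+
  have Fc: "?F a b \<in> carrier_mat ?n ?n" for a b by (intro kronecker_carrier c)
  show "lin (fst (hmod_tensor H V W)) (fst (hmod_tensor H V W)) (snd (hmod_tensor H V W))"
    unfolding snd_hmod_tensor[abs_def] fst_hmod_tensor by (rule lin_sw[OF F])
  show "snd (hmod_tensor H V W) 1 = 1\<^sub>m (fst (hmod_tensor H V W))"
    by (simp add: snd_hmod_tensor sw_one[OF F] hmodule_one[OF V] hmodule_one[OF W] kronecker_one)
  fix g h
  have "snd (hmod_tensor H V W) (g * h) = sw ?n ?n (\<lambda>a b. sw ?n ?n (\<lambda>a' b'. ?F a b * ?F a' b') h) g"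
    by (simp add: snd_hmod_tensor sw_mult[OF F] hmodule_mult[OF V] hmodule_mult[OF W] kronecker_mult)
  also have "\<dots> = sw ?n ?n ?F g * sw ?n ?n ?F h"
    by (simp only: sw_mult_right[OF Fc sw_carrier] sw_mult_left[OF Fc Fc])
  finally show "snd (hmod_tensor H V W) (g * h) = snd (hmod_tensor H V W) g * snd (hmod_tensor H V W) h"
    by (simp add: snd_hmod_tensor)
qed

text \<open>An equality of modules: the underlying Kronecker products associate strictly, and
  coassociativity matches the actions.\<close>

lemma hmod_tensor_assoc:
  assumes U: "hmodule H U" and V: "hmodule H V" and W: "hmodule H W"
  shows "hmod_tensor H (hmod_tensor H U V) W = hmod_tensor H U (hmod_tensor H V W)"
proof (rule prod_eqI)
  note l = hmodule_linear[OF U] hmodule_linear[OF V] hmodule_linear[OF W]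
  note c = hmodule_carrier[OF U] hmodule_carrier[OF V] hmodule_carrier[OF W]
  let ?n = "fst U * fst V * fst W"
  let ?F = "\<lambda>p q b. kronecker (kronecker (snd U p) (snd V q)) (snd W b)"
  have "snd (hmod_tensor H (hmod_tensor H U V) W) h = snd (hmod_tensor H U (hmod_tensor H V W)) h" for h
  proof -
    have "snd (hmod_tensor H (hmod_tensor H U V) W) h = sw ?n ?n (\<lambda>a b. sw ?n ?n (\<lambda>p q. ?F p q b) a) h"
      by (simp only: snd_hmod_tensor fst_hmod_tensor kronecker_sw_left[OF kronecker_carrier[OF c(1,2)] c(3)])
    also have "\<dots> = sw ?n ?n (\<lambda>a b. sw ?n ?n (\<lambda>p q. ?F a p q) b) h"
      by (rule sw_coassoc; intro mat_linear_kronecker_left mat_linear_kronecker_right l c kronecker_carrier)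
    also have "\<dots> = snd (hmod_tensor H U (hmod_tensor H V W)) h"
      by (simp only: snd_hmod_tensor fst_hmod_tensor kronecker_sw_right[OF kronecker_carrier[OF c(2,3)] c(1)]
          kronecker_assoc mult.assoc)
    finally show ?thesis .
  qed
  then show "snd (hmod_tensor H (hmod_tensor H U V) W) = snd (hmod_tensor H U (hmod_tensor H V W))" by blast
qed (simp add: mult.assoc)

lemma hmod_tensor_trivial_left: "hmodule H V \<Longrightarrow> hmod_tensor H (hmod_trivial H) V = V"
  by (rule prod_eqI)
    (auto simp: snd_hmod_tensor snd_hmod_trivial kronecker_smult_left sw_counit_left hmodule_linear)

lemma hmod_tensor_trivial_right: "hmodule H V \<Longrightarrow> hmod_tensor H V (hmod_trivial H) = V"
  by (rule prod_eqI)
    (auto simp: snd_hmod_tensor snd_hmod_trivial kronecker_smult_right sw_counit_right hmodule_linear)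

lemma hmod_tensor_hom:
  assumes A: "A \<in> hmod_hom V V'" and B: "B \<in> hmod_hom W W'"
    and m: "hmodule H V" "hmodule H V'" "hmodule H W" "hmodule H W'"
  shows "kronecker A B \<in> hmod_hom (hmod_tensor H V W) (hmod_tensor H V' W')"
proof (rule hmod_homI)
  note AB = hmod_homD(1)[OF A] hmod_homD(1)[OF B]
  note c = hmodule_carrier[OF m(1)] hmodule_carrier[OF m(2)] hmodule_carrier[OF m(3)] hmodule_carrier[OF m(4)]
  note [simp] = carrier_matD[OF AB(1)] carrier_matD[OF AB(2)] carrier_matD[OF c(1)] carrier_matD[OF c(2)]
    carrier_matD[OF c(3)] carrier_matD[OF c(4)]
  show "kronecker A B \<in> carrier_mat (fst (hmod_tensor H V' W')) (fst (hmod_tensor H V W))"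
    using AB by auto
  fix h
  have "kronecker A B * snd (hmod_tensor H V W) h =
      sw (fst V' * fst W') (fst V * fst W) (\<lambda>a b. kronecker A B * kronecker (snd V a) (snd W b)) h"
    unfolding snd_hmod_tensor
    by (rule sw_mult_left[OF kronecker_carrier[OF c(1,3)] kronecker_carrier[OF AB]])
  also have "\<dots> = sw (fst V' * fst W') (fst V * fst W) (\<lambda>a b. kronecker (snd V' a) (snd W' b) * kronecker A B) h"
    by (simp add: kronecker_mult hmod_homD(2)[OF A] hmod_homD(2)[OF B])
  also have "\<dots> = snd (hmod_tensor H V' W') h * kronecker A B"
    unfolding snd_hmod_tensor
    by (rule sw_mult_right[symmetric, OF kronecker_carrier[OF c(2,4)] kronecker_carrier[OF AB]])
  finally show "kronecker A B * snd (hmod_tensor H V W) h = snd (hmod_tensor H V' W') h * kronecker A B" .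
qed

text \<open>Invariants of \<open>V \<otimes> D\<close> are the homomorphisms \<open>V\<^sup>* \<rightarrow> D\<close>.\<close>

lemma vcol_hom_iff:
  assumes V: "hmodule H V" and D: "hmodule H D" and C: "C \<in> carrier_mat (fst V) (fst D)"
  shows "vcol C \<in> hmod_hom (hmod_trivial H) (hmod_tensor H V D) \<longleftrightarrow> C\<^sup>T \<in> hmod_hom (hmod_dual H V) D"
proof -
  define n m \<rho> \<delta> where "n = fst V" and "m = fst D" and "\<rho> = snd V" and "\<delta> = snd D"
  note l = hmodule_linear[OF V, folded n_def \<rho>_def] hmodule_linear[OF D, folded m_def \<delta>_def]
  note c = hmodule_carrier[OF V, folded n_def \<rho>_def] hmodule_carrier[OF D, folded m_def \<delta>_def] C[folded n_def m_def]
  note [simp] = carrier_matD[OF c(1)] carrier_matD[OF c(2)] carrier_matD[OF c(3)]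
  let ?S = "antipode H"
  define act where "act h = sw n m (\<lambda>a b. \<rho> a * (C * (\<delta> b)\<^sup>T)) h" for h
  have act: "snd (hmod_tensor H V D) h * vcol C = vcol (act h)" for h
  proof -
    have "snd (hmod_tensor H V D) h * vcol C = sw (n * m) 1 (\<lambda>a b. kronecker (\<rho> a) (\<delta> b) * vcol C) h"
      unfolding snd_hmod_tensor n_def[symmetric] m_def[symmetric] \<rho>_def[symmetric] \<delta>_def[symmetric]
      by (rule sw_mult_right[OF kronecker_carrier[OF c(1,2)] vcol_carrier[OF c(3)]])
    also have "\<dots> = sw (n * m) 1 (\<lambda>a b. vcol (\<rho> a * (C * (\<delta> b)\<^sup>T))) h"
      by (simp add: kronecker_vcol[OF c(1,2,3)] mat_mult_assoc)
    also have "\<dots> = vcol (act h)"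
      unfolding act_def by (rule vcol_sw[symmetric]) auto
    finally show ?thesis .
  qed
  have triv: "vcol C * (x \<cdot>\<^sub>m 1\<^sub>m (Suc 0)) = x \<cdot>\<^sub>m vcol C" for x
    using mult_smult_distrib[OF vcol_carrier[OF c(3)], of "1\<^sub>m 1" 1 x] by simp
  have "vcol C \<in> hmod_hom (hmod_trivial H) (hmod_tensor H V D) \<longleftrightarrow>
      (\<forall>h. counit H h \<cdot>\<^sub>m vcol C = vcol (act h))"
    by (auto simp: hmod_hom_def act snd_hmod_trivial triv n_def[symmetric]
        m_def[symmetric] intro!: carrier_matI)
  also have "\<dots> \<longleftrightarrow> (\<forall>h. act h = counit H h \<cdot>\<^sub>m C)"
  proof -
    have "counit H h \<cdot>\<^sub>m vcol C = vcol (act h) \<longleftrightarrow> act h = counit H h \<cdot>\<^sub>m C" for h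
      using vcol_inject[of "act h" n m "counit H h \<cdot>\<^sub>m C"] c(3) by (auto simp: vcol_smult act_def)
    then show ?thesis by simp
  qed
  also have "\<dots> \<longleftrightarrow> (\<forall>h. C * (\<delta> h)\<^sup>T = \<rho> (?S h) * C)"
  proof
    \<comment> \<open>Invariance is a convolution equation with left factor \<open>\<rho>\<close>.
      Cancelling this factor moves it to the other side composed with the antipode, which is the
      action on the dual up to transposition.\<close>
    assume a: "\<forall>h. act h = counit H h \<cdot>\<^sub>m C"
    have "lin n m (\<lambda>b. C * (\<delta> b)\<^sup>T)"
      by (intro mat_linear_mult_left[where c = m] mat_linear_transpose l c)
    then show "\<forall>h. C * (\<delta> h)\<^sup>T = \<rho> (?S h) * C"
      using convolution_left_cancel[OF V, of m "\<lambda>b. C * (\<delta> b)\<^sup>T" C] a c(3)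
      by (simp add: act_def n_def \<rho>_def)
  next
    assume "\<forall>h. C * (\<delta> h)\<^sup>T = \<rho> (?S h) * C"
    then have "act h = sw n m (\<lambda>a b. \<rho> (a * ?S b) * C) h" for h
      using hmodule_mult[OF V, folded \<rho>_def] by (simp add: act_def mat_mult_assoc)
    also have "\<dots> h = counit H h \<cdot>\<^sub>m (\<rho> 1 * C)" for h
      by (rule sw_antipode_right) (intro mat_linear_mult_right[where c = n] l c)
    finally show "\<forall>h. act h = counit H h \<cdot>\<^sub>m C"
      using hmodule_one[OF V] by (simp add: \<rho>_def n_def[symmetric])
  qed
  also have "\<dots> \<longleftrightarrow> C\<^sup>T \<in> hmod_hom (hmod_dual H V) D"
  proof -
    have "C * (\<delta> h)\<^sup>T = \<rho> (?S h) * C \<longleftrightarrow> C\<^sup>T * (\<rho> (?S h))\<^sup>T = \<delta> h * C\<^sup>T" for h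
    proof -
      have "(C * (\<delta> h)\<^sup>T)\<^sup>T = \<delta> h * C\<^sup>T"
        using transpose_mult[of C n m "(\<delta> h)\<^sup>T" m] c by simp
      moreover have "(\<rho> (?S h) * C)\<^sup>T = C\<^sup>T * (\<rho> (?S h))\<^sup>T"
        by (rule transpose_mult[OF c(1,3)])
      ultimately show ?thesis by (metis transpose_mat_eq)
    qed
    then show ?thesis
      using C by (simp add: hmod_hom_def snd_hmod_dual \<rho>_def \<delta>_def)
  qed
  finally show ?thesis .
qed

text \<open>Invariant pairings \<open>D \<otimes> V \<rightarrow> k\<close> are the homomorphisms \<open>D \<rightarrow> V\<^sup>*\<close>.\<close>

lemma transpose_vcol_hom_iff:
  assumes V: "hmodule H V" and D: "hmodule H D" and E: "E \<in> carrier_mat (fst D) (fst V)"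
  shows "(vcol E)\<^sup>T \<in> hmod_hom (hmod_tensor H D V) (hmod_trivial H) \<longleftrightarrow> E\<^sup>T \<in> hmod_hom D (hmod_dual H V)"
proof -
  define n m \<rho> \<delta> where "n = fst V" and "m = fst D" and "\<rho> = snd V" and "\<delta> = snd D"
  note l = hmodule_linear[OF V, folded n_def \<rho>_def] hmodule_linear[OF D, folded m_def \<delta>_def]
  note c = hmodule_carrier[OF V, folded n_def \<rho>_def] hmodule_carrier[OF D, folded m_def \<delta>_def] E[folded n_def m_def]
  note [simp] = carrier_matD[OF c(1)] carrier_matD[OF c(2)] carrier_matD[OF c(3)]
  let ?S = "antipode H"
  have ct: "(\<delta> a)\<^sup>T \<in> carrier_mat m m" "(\<rho> a)\<^sup>T \<in> carrier_mat n n" for a using c by auto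
  define act where "act h = sw m n (\<lambda>a b. (\<delta> a)\<^sup>T * E * \<rho> b) h" for h
  have act: "(vcol E)\<^sup>T * snd (hmod_tensor H D V) h = (vcol (act h))\<^sup>T" for h
  proof -
    let ?M = "snd (hmod_tensor H D V) h"
    have M: "?M \<in> carrier_mat (m * n) (m * n)"
      using hmodule_carrier[OF hmodule_tensor[OF D V]] by (simp add: n_def m_def)
    have "?M\<^sup>T * vcol E = sw (m * n) 1 (\<lambda>a b. kronecker (\<delta> a)\<^sup>T (\<rho> b)\<^sup>T * vcol E) h"
      unfolding snd_hmod_tensor n_def[symmetric] m_def[symmetric] \<rho>_def[symmetric] \<delta>_def[symmetric]
      by (subst sw_transpose[OF kronecker_carrier[OF c(2,1)]])
        (simp only: kronecker_transpose sw_mult_right[OF kronecker_carrier[OF ct] vcol_carrier[OF c(3)]])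
    also have "\<dots> = sw (m * n) 1 (\<lambda>a b. vcol ((\<delta> a)\<^sup>T * E * \<rho> b)) h"
      by (simp add: kronecker_vcol[OF ct c(3)])
    also have "\<dots> = vcol (act h)"
      unfolding act_def by (rule vcol_sw[symmetric]) auto
    finally have "(vcol (act h))\<^sup>T = (?M\<^sup>T * vcol E)\<^sup>T" by simp
    also have "\<dots> = (vcol E)\<^sup>T * ?M"
      using transpose_mult[of "?M\<^sup>T" "m * n" "m * n" "vcol E" 1] M vcol_carrier[OF c(3)] by simp
    finally show ?thesis by simp
  qed
  have triv: "x \<cdot>\<^sub>m 1\<^sub>m (Suc 0) * (vcol E)\<^sup>T = x \<cdot>\<^sub>m (vcol E)\<^sup>T" for x
    using mult_smult_assoc_mat[of "1\<^sub>m 1" 1 1 "(vcol E)\<^sup>T" "m * n" x] vcol_carrier[OF c(3)] by simp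
  have "(vcol E)\<^sup>T \<in> hmod_hom (hmod_tensor H D V) (hmod_trivial H) \<longleftrightarrow>
      (\<forall>h. (vcol (act h))\<^sup>T = counit H h \<cdot>\<^sub>m (vcol E)\<^sup>T)"
    by (auto simp: hmod_hom_def act snd_hmod_trivial triv n_def[symmetric]
        m_def[symmetric] intro!: carrier_matI)
  also have "\<dots> \<longleftrightarrow> (\<forall>h. act h = counit H h \<cdot>\<^sub>m E)"
  proof -
    have "(vcol (act h))\<^sup>T = counit H h \<cdot>\<^sub>m (vcol E)\<^sup>T \<longleftrightarrow> act h = counit H h \<cdot>\<^sub>m E" for h
    proof -
      have "counit H h \<cdot>\<^sub>m (vcol E)\<^sup>T = (vcol (counit H h \<cdot>\<^sub>m E))\<^sup>T"
        unfolding vcol_smult by (intro eq_matI) auto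
      then show ?thesis
        using vcol_inject[of "act h" m n "counit H h \<cdot>\<^sub>m E"] c(3) by (auto simp: act_def)
    qed
    then show ?thesis by simp
  qed
  also have "\<dots> \<longleftrightarrow> (\<forall>h. (\<delta> h)\<^sup>T * E = E * \<rho> (?S h))"
  proof
    assume a: "\<forall>h. act h = counit H h \<cdot>\<^sub>m E"
    have "lin m n (\<lambda>b. (\<delta> b)\<^sup>T * E)"
      by (intro mat_linear_mult_right[where c = m] mat_linear_transpose l c)
    then show "\<forall>h. (\<delta> h)\<^sup>T * E = E * \<rho> (?S h)"
      using convolution_right_cancel[OF V, of m "\<lambda>b. (\<delta> b)\<^sup>T * E" E] a c(3)
      by (simp add: act_def n_def \<rho>_def)
  next
    assume "\<forall>h. (\<delta> h)\<^sup>T * E = E * \<rho> (?S h)"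
    then have "act h = sw m n (\<lambda>a b. E * \<rho> (?S a * b)) h" for h
      using hmodule_mult[OF V, folded \<rho>_def] by (simp add: act_def mat_mult_assoc)
    also have "\<dots> h = counit H h \<cdot>\<^sub>m (E * \<rho> 1)" for h
      by (rule sw_antipode_left) (intro mat_linear_mult_left[where c = n] l c)
    finally show "\<forall>h. act h = counit H h \<cdot>\<^sub>m E"
      using hmodule_one[OF V] by (simp add: \<rho>_def n_def[symmetric])
  qed
  also have "\<dots> \<longleftrightarrow> E\<^sup>T \<in> hmod_hom D (hmod_dual H V)"
  proof -
    have "(\<delta> h)\<^sup>T * E = E * \<rho> (?S h) \<longleftrightarrow> E\<^sup>T * \<delta> h = (\<rho> (?S h))\<^sup>T * E\<^sup>T" for h
    proof -
      have "((\<delta> h)\<^sup>T * E)\<^sup>T = E\<^sup>T * \<delta> h"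
        using transpose_mult[of "(\<delta> h)\<^sup>T" m m E n] c by simp
      moreover have "(E * \<rho> (?S h))\<^sup>T = (\<rho> (?S h))\<^sup>T * E\<^sup>T"
        by (rule transpose_mult[OF c(3,1)])
      ultimately show ?thesis by (metis transpose_mat_eq)
    qed
    then show ?thesis
      using E by (simp add: hmod_hom_def snd_hmod_dual \<rho>_def \<delta>_def)
  qed
  finally show ?thesis .
qed

text \<open>It corresponds to the identity of the dual module, and so does the evaluation.\<close>

lemma coevaluation_hom:
  assumes V: "hmodule H V"
  shows "vcol (1\<^sub>m (fst V)) \<in> hmod_hom (hmod_trivial H) (hmod_tensor H V (hmod_dual H V))"
  using vcol_hom_iff[OF V hmodule_dual[OF V], of "1\<^sub>m (fst V)"] hmod_hom_one[OF hmodule_dual[OF V]] by simp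

lemma evaluation_hom:
  assumes V: "hmodule H V"
  shows "(vcol (1\<^sub>m (fst V)))\<^sup>T \<in> hmod_hom (hmod_tensor H (hmod_dual H V) V) (hmod_trivial H)"
  using transpose_vcol_hom_iff[OF V hmodule_dual[OF V], of "1\<^sub>m (fst V)"] hmod_hom_one[OF hmodule_dual[OF V]]
  by simp

text \<open>The nested coevaluation is a composite of homomorphisms, hence invariant, and
  \<open>vcol_hom_iff\<close> turns it into a homomorphism out of the dual of V \<otimes> W. Its
  matrix is a flip and therefore invertible. No formula for the coproduct of S(h) enters.\<close>

lemma hmod_dual_tensor_iso:
  assumes V: "hmodule H V" and W: "hmodule H W"
  shows "hmod_iso (hmod_dual H (hmod_tensor H V W)) (hmod_tensor H (hmod_dual H W) (hmod_dual H V))"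
proof -
  let ?V = "hmod_dual H V" and ?W = "hmod_dual H W" and ?k = "hmod_trivial H"
  let ?n = "fst V" and ?m = "fst W"
  note V' = hmodule_dual[OF V] and W' = hmodule_dual[OF W]
  note WW = hmodule_tensor[OF W W']
  have "kronecker (vcol (1\<^sub>m ?m)) (1\<^sub>m (fst ?V)) \<in> hmod_hom (hmod_tensor H ?k ?V) (hmod_tensor H (hmod_tensor H W ?W) ?V)"
    by (intro hmod_tensor_hom coevaluation_hom hmod_hom_one[OF V'] W V' hmodule_trivial WW)
  then have "kronecker (1\<^sub>m ?n) (kronecker (vcol (1\<^sub>m ?m)) (1\<^sub>m ?n)) \<in>
      hmod_hom (hmod_tensor H V ?V) (hmod_tensor H V (hmod_tensor H (hmod_tensor H W ?W) ?V))"
    using hmod_tensor_hom[OF hmod_hom_one[OF V], of _ ?V "hmod_tensor H (hmod_tensor H W ?W) ?V"]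
    by (simp add: hmod_tensor_trivial_left V V' hmodule_tensor WW)
  then have "kronecker (1\<^sub>m ?n) (kronecker (vcol (1\<^sub>m ?m)) (1\<^sub>m ?n)) * vcol (1\<^sub>m ?n) \<in>
      hmod_hom ?k (hmod_tensor H V (hmod_tensor H (hmod_tensor H W ?W) ?V))"
    by (rule hmod_hom_comp[OF _ coevaluation_hom[OF V] hmodule_trivial]) (intro hmodule_tensor V V' W W')+
  then have "vcol (swap_mat ?n ?m) \<in> hmod_hom ?k (hmod_tensor H (hmod_tensor H V W) (hmod_tensor H ?W ?V))"
    by (simp add: nested_coevaluation hmod_tensor_assoc V W V' W' hmodule_tensor)
  then have 1: "(swap_mat ?n ?m)\<^sup>T \<in> hmod_hom (hmod_dual H (hmod_tensor H V W)) (hmod_tensor H ?W ?V)"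
    using vcol_hom_iff[of "hmod_tensor H V W" "hmod_tensor H ?W ?V" "swap_mat ?n ?m"] hmodule_tensor V W V' W'
    by simp
  note hom = hmod_homD[OF 1]
  let ?A = "swap_mat ?m ?n :: 'k mat" and ?B = "swap_mat ?n ?m :: 'k mat"
  let ?X = "hmod_dual H (hmod_tensor H V W)" and ?Y = "hmod_tensor H ?W ?V"
  have X: "hmodule H ?X" and Y: "hmodule H ?Y" by (intro hmodule_dual hmodule_tensor V W)+
  have cX: "snd ?X h \<in> carrier_mat (?n * ?m) (?n * ?m)" and cY: "snd ?Y h \<in> carrier_mat (?m * ?n) (?m * ?n)" for h
    using hmodule_carrier[OF X] hmodule_carrier[OF Y] by auto
  note [simp] = carrier_matD[OF cX] carrier_matD[OF cY] carrier_matD[OF swap_mat_carrier]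
  have 2: "?B \<in> hmod_hom ?Y ?X"
  proof (rule hmod_homI)
    fix h
    have "?B * snd ?Y h = ?B * (snd ?Y h * ?A * ?B)"
      by (simp add: mat_mult_assoc swap_mat_inverse)
    also have "snd ?Y h * ?A = ?A * snd ?X h" using hom(2)[of h] by (simp add: swap_mat_transpose)
    also have "?B * (?A * snd ?X h * ?B) = ?B * ?A * (snd ?X h * ?B)"
      by (simp add: mat_mult_assoc)
    finally show "?B * snd ?Y h = snd ?X h * ?B" by (simp add: swap_mat_inverse)
  qed simp
  show ?thesis
    unfolding hmod_iso_def
    using 1 2 swap_mat_inverse[of ?n ?m] swap_mat_inverse[of ?m ?n]
    by (intro bexI[of _ ?A] bexI[of _ ?B]) (auto simp: swap_mat_transpose)
qed

end

section \<open>The Krull--Schmidt theorem\<close>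

text \<open>Like \<open>mat_mult_assoc\<close>, this and its variants have dimension equations in
  place of carrier conditions: the simplifier solves these once the dimensions of the matrices at
  hand are rewrite rules.\<close>

lemma mat_add_mult:
  fixes A B C :: "'a::semiring_0 mat"
  assumes "dim_row A = dim_row B" "dim_col A = dim_col B" "dim_col A = dim_row C"
  shows "(A + B) * C = A * C + B * C"
  using assms by (intro add_mult_distrib_mat[of A "dim_row A" "dim_col A" B C "dim_col C"]) auto

lemma mat_mult_add:
  fixes A B C :: "'a::semiring_0 mat"
  assumes "dim_row A = dim_row B" "dim_col A = dim_col B" "dim_col C = dim_row A"
  shows "C * (A + B) = C * A + C * B"
  using assms by (intro mult_add_distrib_mat[of C "dim_row C" "dim_col C" A "dim_col A" B]) auto

lemma mat_diff_mult:
  fixes A B C :: "'a::ring mat"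
  assumes "dim_row A = dim_row B" "dim_col A = dim_col B" "dim_col A = dim_row C"
  shows "(A - B) * C = A * C - B * C"
  using assms by (intro minus_mult_distrib_mat[of A "dim_row A" "dim_col A" B C "dim_col C"]) auto

lemma mat_mult_diff:
  fixes A B C :: "'a::ring mat"
  assumes "dim_row A = dim_row B" "dim_col A = dim_col B" "dim_col C = dim_row A"
  shows "C * (A - B) = C * A - C * B"
  using assms by (intro mult_minus_distrib_mat[of C "dim_row C" "dim_col C" A "dim_col A" B]) auto

lemma mult_eq_one_imp_dim_le:
  fixes A B :: "'k::field mat"
  assumes A: "A \<in> carrier_mat m n" and B: "B \<in> carrier_mat n m" and BA: "B * A = 1\<^sub>m n"
  shows "n \<le> m"
proof (rule ccontr)
  assume "\<not> n \<le> m"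
  then obtain v where v: "v \<in> carrier_vec n" "v \<noteq> 0\<^sub>v n" "A *\<^sub>v v = 0\<^sub>v m"
    using wide_matrix_kernel[OF A] by auto
  have "B *\<^sub>v (A *\<^sub>v v) = v"
    using assoc_mult_mat_vec[OF B A v(1)] BA v(1) by simp
  moreover have "B *\<^sub>v 0\<^sub>v m = 0\<^sub>v n" using B by (intro eq_vecI) auto
  ultimately show False using v by simp
qed

lemma left_inverse_imp_right_inverse:
  fixes A B :: "'k::field mat"
  assumes "A \<in> carrier_mat n n" "B \<in> carrier_mat n n" "B * A = 1\<^sub>m n"
  shows "A * B = 1\<^sub>m n"
  using mat_mult_left_right_inverse[OF assms(2,1,3)] .

section \<open>Direct sums as biproducts\<close>

lemma fst_hmod_sum [simp]: "fst (hmod_sum V W) = fst V + fst W"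
  and snd_hmod_sum: "snd (hmod_sum V W) h =
    four_block_mat (snd V h) (0\<^sub>m (fst V) (fst W)) (0\<^sub>m (fst W) (fst V)) (snd W h)"
  by (simp_all add: hmod_sum_def)

text \<open>With \<open>inj2\<close>, the two inclusions into a direct sum of coordinate spaces;
  their transposes are the projections.\<close>

definition inj1 :: "nat \<Rightarrow> nat \<Rightarrow> 'a::{zero,one} mat" where
  "inj1 n m = mat (n + m) n (\<lambda>(i, j). if i = j then 1 else 0)"

definition inj2 :: "nat \<Rightarrow> nat \<Rightarrow> 'a::{zero,one} mat" where
  "inj2 n m = mat (n + m) m (\<lambda>(i, j). if i = n + j then 1 else 0)"

lemma inj_carrier [simp]: "inj1 n m \<in> carrier_mat (n + m) n" "inj2 n m \<in> carrier_mat (n + m) m"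
  by (simp_all add: inj1_def inj2_def)

lemma inj_dims [simp]: "dim_row (inj1 n m) = n + m" "dim_col (inj1 n m) = n"
  "dim_row (inj2 n m) = n + m" "dim_col (inj2 n m) = m"
  by (simp_all add: inj1_def inj2_def)

lemma mult_inj:
  fixes M :: "'a::semiring_1 mat"
  assumes "M \<in> carrier_mat r (n + m)"
  shows "M * inj1 n m = mat r n (\<lambda>(i, j). M $$ (i, j))" "M * inj2 n m = mat r m (\<lambda>(i, j). M $$ (i, n + j))"
  using assms by (auto simp: inj1_def inj2_def scalar_prod_def if_distrib cong: if_cong intro!: eq_matI)

lemma inj_mult:
  fixes A :: "'a::semiring_1 mat"
  shows "A \<in> carrier_mat n c \<Longrightarrow> inj1 n m * A = mat (n + m) c (\<lambda>(i, j). if i < n then A $$ (i, j) else 0)"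
    "A \<in> carrier_mat m c \<Longrightarrow> inj2 n m * A = mat (n + m) c (\<lambda>(i, j). if i < n then 0 else A $$ (i - n, j))"
proof -
  show "inj1 n m * A = mat (n + m) c (\<lambda>(i, j). if i < n then A $$ (i, j) else 0)" if "A \<in> carrier_mat n c"
    using that by (intro eq_matI) (auto simp: inj1_def scalar_prod_def if_distrib [where f = "\<lambda>x. x * _"] cong: if_cong)
  show "inj2 n m * A = mat (n + m) c (\<lambda>(i, j). if i < n then 0 else A $$ (i - n, j))" if A: "A \<in> carrier_mat m c"
  proof (rule eq_matI)
    fix i j assume "i < dim_row (mat (n + m) c (\<lambda>(i, j). if i < n then 0 else A $$ (i - n, j)))"
      "j < dim_col (mat (n + m) c (\<lambda>(i, j). if i < n then 0 else A $$ (i - n, j)))"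
    then have ij: "i < n + m" "j < c" by auto
    have "(inj2 n m * A) $$ (i, j) = (\<Sum>k = 0..<m. if i = n + k then A $$ (k, j) else 0)"
      using ij A by (simp add: inj2_def scalar_prod_def if_distrib [where f = "\<lambda>x. x * _"] cong: if_cong)
    also have "\<dots> = (if i < n then 0 else A $$ (i - n, j))"
    proof (cases "i < n")
      case False
      then have "i = n + k \<longleftrightarrow> k = i - n" for k by auto
      moreover have "i - n < m" using False ij by linarith
      ultimately show ?thesis using False by simp
    qed (auto intro: sum.neutral)
    finally show "(inj2 n m * A) $$ (i, j) = mat (n + m) c (\<lambda>(i, j). if i < n then 0 else A $$ (i - n, j)) $$ (i, j)"
      using ij by simp
  qed (use A in auto)
qed

lemma inj_biproduct:
  "(inj1 n m)\<^sup>T * inj1 n m = (1\<^sub>m n :: 'a::semiring_1 mat)" "(inj2 n m)\<^sup>T * inj2 n m = (1\<^sub>m m :: 'a mat)"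
  "inj1 n m * (inj1 n m)\<^sup>T + inj2 n m * (inj2 n m)\<^sup>T = (1\<^sub>m (n + m) :: 'a mat)"
  by (intro eq_matI; simp add: mult_inj[of _ n n m] mult_inj[of _ m n m] inj_mult[of _ _ "n + m"]; simp add: inj1_def inj2_def)+

lemma four_block_inj:
  fixes A D :: "'a::semiring_1 mat"
  assumes A: "A \<in> carrier_mat n n" and D: "D \<in> carrier_mat m m"
  defines "M \<equiv> four_block_mat A (0\<^sub>m n m) (0\<^sub>m m n) D"
  shows "M * inj1 n m = inj1 n m * A" "M * inj2 n m = inj2 n m * D"
proof -
  have M: "M \<in> carrier_mat (n + m) (n + m)" unfolding M_def using assms by (intro four_block_carrier_mat)
  note [simp] = carrier_matD[OF A] carrier_matD[OF D]
  show "M * inj1 n m = inj1 n m * A"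
    unfolding mult_inj[OF M] inj_mult(1)[OF A] by (rule eq_matI) (auto simp: M_def)
  show "M * inj2 n m = inj2 n m * D"
    unfolding mult_inj[OF M] inj_mult(2)[OF D] by (rule eq_matI) (auto simp: M_def)
qed

lemma inj_transpose_four_block:
  fixes A D :: "'a::comm_semiring_1 mat"
  assumes A: "A \<in> carrier_mat n n" and D: "D \<in> carrier_mat m m"
  defines "M \<equiv> four_block_mat A (0\<^sub>m n m) (0\<^sub>m m n) D"
  shows "(inj1 n m)\<^sup>T * M = A * (inj1 n m)\<^sup>T" "(inj2 n m)\<^sup>T * M = D * (inj2 n m)\<^sup>T"
proof -
  have M: "M \<in> carrier_mat (n + m) (n + m)" unfolding M_def using assms by (intro four_block_carrier_mat)
  have At: "A\<^sup>T \<in> carrier_mat n n" and Dt: "D\<^sup>T \<in> carrier_mat m m" and Mt: "M\<^sup>T \<in> carrier_mat (n + m) (n + m)"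
    using A D M by simp_all
  have MT: "M\<^sup>T = four_block_mat A\<^sup>T (0\<^sub>m n m) (0\<^sub>m m n) D\<^sup>T"
    unfolding M_def using A D by (subst transpose_four_block_mat[of _ n n _ m _ m]) auto
  note e = four_block_inj[OF At Dt, folded MT]
  show "(inj1 n m)\<^sup>T * M = A * (inj1 n m)\<^sup>T"
    using arg_cong[OF e(1), of transpose_mat] transpose_mult[OF Mt inj_carrier(1)] transpose_mult[OF inj_carrier(1) At]
    by simp
  show "(inj2 n m)\<^sup>T * M = D * (inj2 n m)\<^sup>T"
    using arg_cong[OF e(2), of transpose_mat] transpose_mult[OF Mt inj_carrier(2)] transpose_mult[OF inj_carrier(2) Dt]
    by simp
qed

text \<open>Decompositions are handled through inclusions and projections, which pass through tensor
  products, duals and isomorphisms more easily than block matrices. The vanishing of the cross terms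
  is not demanded because it follows.\<close>

definition is_biproduct ::
    "('k::field, 'h) hmod \<Rightarrow> ('k, 'h) hmod \<Rightarrow> ('k, 'h) hmod \<Rightarrow> 'k mat \<Rightarrow> 'k mat \<Rightarrow> 'k mat \<Rightarrow> 'k mat \<Rightarrow> bool" where
  "is_biproduct M A B i p j q \<longleftrightarrow>
     i \<in> hmod_hom A M \<and> p \<in> hmod_hom M A \<and> j \<in> hmod_hom B M \<and> q \<in> hmod_hom M B \<and>
     p * i = 1\<^sub>m (fst A) \<and> q * j = 1\<^sub>m (fst B) \<and> i * p + j * q = 1\<^sub>m (fst M)"

lemma is_biproductD:
  assumes "is_biproduct M A B i p j q"
  shows "i \<in> hmod_hom A M" "p \<in> hmod_hom M A" "j \<in> hmod_hom B M" "q \<in> hmod_hom M B"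
    "p * i = 1\<^sub>m (fst A)" "q * j = 1\<^sub>m (fst B)" "i * p + j * q = 1\<^sub>m (fst M)"
  using assms by (simp_all add: is_biproduct_def)

lemma is_biproduct_dims:
  assumes "is_biproduct M A B i p j q"
  shows "dim_row i = fst M" "dim_col i = fst A" "dim_row p = fst A" "dim_col p = fst M"
    "dim_row j = fst M" "dim_col j = fst B" "dim_row q = fst B" "dim_col q = fst M"
  using is_biproductD(1-4)[OF assms] by (auto dest!: hmod_homD(1))

lemma is_biproduct_commute:
  assumes "is_biproduct M A B i p j q"
  shows "is_biproduct M B A j q i p"
proof -
  note [simp] = is_biproduct_dims[OF assms]
  have "j * q + i * p = i * p + j * q" by (rule comm_add_mat[of _ "fst M" "fst M"]) auto
  with assms show ?thesis by (simp add: is_biproduct_def)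
qed

lemma add_eq_self_imp_zero:
  fixes A B :: "'a::ab_group_add mat"
  assumes "A \<in> carrier_mat n m" "B \<in> carrier_mat n m" "A + B = A"
  shows "B = 0\<^sub>m n m"
proof (rule eq_matI)
  fix i j assume "i < dim_row (0\<^sub>m n m :: 'a mat)" "j < dim_col (0\<^sub>m n m :: 'a mat)"
  moreover have "(A + B) $$ (i, j) = A $$ (i, j)" using assms(3) by simp
  ultimately show "B $$ (i, j) = 0\<^sub>m n m $$ (i, j)"
    using assms(1,2) by simp
qed (use assms in auto)

text \<open>Multiplying \<open>i * p + j * q = 1\<^sub>m (fst M)\<close> by \<open>p\<close> from
  the left leaves \<open>p * j * q\<close> equal to zero, and \<open>q\<close> cancels against
  \<open>j\<close>.\<close>

lemma is_biproduct_cross: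
  assumes "is_biproduct M A B i p j q"
  shows "p * j = 0\<^sub>m (fst A) (fst B)"
proof -
  note [simp] = is_biproduct_dims[OF assms]
  have "p * (i * p + j * q) = p" unfolding is_biproductD(7)[OF assms] by simp
  then have "p * i * p + p * j * q = p" by (simp add: mat_mult_add mat_mult_assoc)
  then have "p + p * j * q = p" unfolding is_biproductD(5)[OF assms] by simp
  then have "p * j * q = 0\<^sub>m (fst A) (fst M)"
    by (intro add_eq_self_imp_zero[of p]) auto
  then have "p * j * q * j = 0\<^sub>m (fst A) (fst B)" by simp
  then show ?thesis by (simp add: mat_mult_assoc is_biproductD(6)[OF assms])
qed

lemma is_biproduct_cross':
  assumes "is_biproduct M A B i p j q"
  shows "q * i = 0\<^sub>m (fst B) (fst A)"
  using is_biproduct_cross[OF is_biproduct_commute[OF assms]] .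

lemma hmod_iso_refl: "hmodule H V \<Longrightarrow> hmod_iso V V"
  unfolding hmod_iso_def using hmod_hom_one[of H V] by (intro bexI[of _ "1\<^sub>m (fst V)"]) auto

lemma hmod_iso_sym: "hmod_iso V W \<Longrightarrow> hmod_iso W V"
  unfolding hmod_iso_def by blast

lemma hmod_isoI:
  assumes "A \<in> hmod_hom V W" "B \<in> hmod_hom W V" "B * A = 1\<^sub>m (fst V)" "A * B = 1\<^sub>m (fst W)"
  shows "hmod_iso V W"
  using assms unfolding hmod_iso_def by blast

lemma hmod_isoE:
  assumes "hmod_iso V W"
  obtains A B where "A \<in> hmod_hom V W" "B \<in> hmod_hom W V" "B * A = 1\<^sub>m (fst V)" "A * B = 1\<^sub>m (fst W)"
    "A \<in> carrier_mat (fst W) (fst V)" "B \<in> carrier_mat (fst V) (fst W)"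
  using assms unfolding hmod_iso_def by (auto dest: hmod_homD(1))

lemma hmod_iso_trans:
  assumes "hmod_iso U V" "hmod_iso V W" "hmodule H U" "hmodule H V" "hmodule H W"
  shows "hmod_iso U W"
proof -
  obtain A B where A: "A \<in> hmod_hom U V" "B \<in> hmod_hom V U" "B * A = 1\<^sub>m (fst U)" "A * B = 1\<^sub>m (fst V)"
    and c: "A \<in> carrier_mat (fst V) (fst U)" "B \<in> carrier_mat (fst U) (fst V)"
    using assms(1) by (rule hmod_isoE)
  obtain C D where C: "C \<in> hmod_hom V W" "D \<in> hmod_hom W V" "D * C = 1\<^sub>m (fst V)" "C * D = 1\<^sub>m (fst W)"
    and d: "C \<in> carrier_mat (fst W) (fst V)" "D \<in> carrier_mat (fst V) (fst W)"
    using assms(2) by (rule hmod_isoE)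
  note [simp] = carrier_matD[OF c(1)] carrier_matD[OF c(2)] carrier_matD[OF d(1)] carrier_matD[OF d(2)]
  have "(B * D) * (C * A) = B * (D * C) * A" "(C * A) * (B * D) = C * (A * B) * D"
    by (simp_all add: mat_mult_assoc)
  then have "(B * D) * (C * A) = 1\<^sub>m (fst U)" "(C * A) * (B * D) = 1\<^sub>m (fst W)"
    by (simp_all add: A C)
  then show ?thesis
    by (rule hmod_isoI[OF hmod_hom_comp[OF C(1) A(1) assms(3-5)] hmod_hom_comp[OF A(2) C(2) assms(5,4,3)]])
qed

lemma hmod_iso_imp_fst_eq:
  assumes "hmod_iso V W"
  shows "fst V = fst W"
proof -
  obtain A B where "A \<in> hmod_hom V W" "B \<in> hmod_hom W V" "B * A = 1\<^sub>m (fst V)" "A * B = 1\<^sub>m (fst W)"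
    and c: "A \<in> carrier_mat (fst W) (fst V)" "B \<in> carrier_mat (fst V) (fst W)"
    using assms by (rule hmod_isoE)
  then show ?thesis
    using mult_eq_one_imp_dim_le[OF c] mult_eq_one_imp_dim_le[OF c(2,1)] by simp
qed

lemma biproducts_iso:
  assumes 1: "is_biproduct M A B i p j q" and 2: "is_biproduct M' A B i' p' j' q'"
    and m: "hmodule H M" "hmodule H M'" "hmodule H A" "hmodule H B"
  shows "hmod_iso M M'"
proof -
  have 3: "i' * p + j' * q \<in> hmod_hom M M' \<and> (i * p' + j * q') * (i' * p + j' * q) = 1\<^sub>m (fst M)"
    if 1: "is_biproduct M A B i p j q" and 2: "is_biproduct M' A B i' p' j' q'"
      and m: "hmodule H M" "hmodule H M'" for M M' i p j q i' p' j' q'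
  proof
    note [simp] = is_biproduct_dims[OF 1] is_biproduct_dims[OF 2]
    show "i' * p + j' * q \<in> hmod_hom M M'"
      by (intro hmod_hom_add[where H = H] hmod_hom_comp[where H = H, OF is_biproductD(1)[OF 2] is_biproductD(2)[OF 1]]
        hmod_hom_comp[where H = H, OF is_biproductD(3)[OF 2] is_biproductD(4)[OF 1]] m \<open>hmodule H A\<close> \<open>hmodule H B\<close>)
    have "(i * p' + j * q') * (i' * p + j' * q) =
        i * ((p' * i') * p) + j * ((q' * i') * p) + (i * ((p' * j') * q) + j * ((q' * j') * q))"
      by (simp add: mat_add_mult mat_mult_add mat_mult_assoc)
    also have "\<dots> = i * p + j * q"
      by (simp add: is_biproductD(5,6)[OF 2] is_biproduct_cross[OF 2] is_biproduct_cross'[OF 2] carrier_matI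
          left_add_zero_mat[of "j * q" "fst M" "fst M"] right_add_zero_mat[of "i * p" "fst M" "fst M"])
    finally show "(i * p' + j * q') * (i' * p + j' * q) = 1\<^sub>m (fst M)"
      using is_biproductD(7)[OF 1] by simp
  qed
  show ?thesis
    using 3[OF 1 2 m(1,2)] 3[OF 2 1 m(2,1)] by (intro hmod_isoI[of "i' * p + j' * q" M M' "i * p' + j * q'"]) auto
qed

lemma hmodule_sum:
  assumes U: "hmodule H U" and W: "hmodule H W"
  shows "hmodule H (hmod_sum U W)"
proof (rule hmoduleI)
  note c = hmodule_carrier[OF U] hmodule_carrier[OF W]
  note [simp] = carrier_matD[OF c(1)] carrier_matD[OF c(2)]
  note l = hmodule_linear[OF U] hmodule_linear[OF W]
  show "mat_linear (hscale H) (fst (hmod_sum U W)) (fst (hmod_sum U W)) (snd (hmod_sum U W))"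
    unfolding mat_linear_def
  proof (intro conjI allI)
    show "snd (hmod_sum U W) a \<in> carrier_mat (fst (hmod_sum U W)) (fst (hmod_sum U W))" for a
      by (auto simp: snd_hmod_sum)
    show "snd (hmod_sum U W) (a + b) = snd (hmod_sum U W) a + snd (hmod_sum U W) b" for a b
      by (intro eq_matI) (auto simp: snd_hmod_sum mat_linearD(2)[OF l(1)] mat_linearD(2)[OF l(2)])
    show "snd (hmod_sum U W) (hscale H x a) = x \<cdot>\<^sub>m snd (hmod_sum U W) a" for x a
      by (intro eq_matI) (auto simp: snd_hmod_sum mat_linearD(3)[OF l(1)] mat_linearD(3)[OF l(2)])
  qed
  show "snd (hmod_sum U W) 1 = 1\<^sub>m (fst (hmod_sum U W))"
    by (simp add: snd_hmod_sum hmodule_one[OF U] hmodule_one[OF W])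
  show "snd (hmod_sum U W) (g * h) = snd (hmod_sum U W) g * snd (hmod_sum U W) h" for g h
    unfolding snd_hmod_sum hmodule_mult[OF U] hmodule_mult[OF W]
    by (subst mult_four_block_mat[OF c(1) zero_carrier_mat zero_carrier_mat c(2) c(1) zero_carrier_mat
          zero_carrier_mat c(2)]) (simp add: mult_carrier_mat[OF c(1) c(1)] mult_carrier_mat[OF c(2) c(2)])
qed

lemma hmod_sum_biproduct:
  assumes U: "hmodule H U" and W: "hmodule H W"
  shows "is_biproduct (hmod_sum U W) U W (inj1 (fst U) (fst W)) (inj1 (fst U) (fst W))\<^sup>T
    (inj2 (fst U) (fst W)) (inj2 (fst U) (fst W))\<^sup>T"
proof -
  note c = hmodule_carrier[OF U] hmodule_carrier[OF W]
  show ?thesis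
    unfolding is_biproduct_def
    using inj_biproduct[of "fst U" "fst W"] four_block_inj[OF c] inj_transpose_four_block[OF c]
    by (auto simp: hmod_hom_def snd_hmod_sum)
qed

lemma biproduct_iso_sum:
  assumes "is_biproduct M A B i p j q" "hmodule H M" "hmodule H A" "hmodule H B"
  shows "hmod_iso M (hmod_sum A B)"
  using assms by (intro biproducts_iso[OF assms(1) hmod_sum_biproduct[of H A B] assms(2)] hmodule_sum)

lemma is_biproduct_cong:
  assumes 1: "is_biproduct M A B i p j q" and A: "hmod_iso A A'" and B: "hmod_iso B B'"
    and m: "hmodule H M" "hmodule H A" "hmodule H B" "hmodule H A'" "hmodule H B'"
  shows "\<exists>i p j q. is_biproduct M A' B' i p j q"
proof -
  obtain f g where f: "f \<in> hmod_hom A A'" "g \<in> hmod_hom A' A" "g * f = 1\<^sub>m (fst A)" "f * g = 1\<^sub>m (fst A')"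
    and fc: "f \<in> carrier_mat (fst A') (fst A)" "g \<in> carrier_mat (fst A) (fst A')"
    using A by (rule hmod_isoE)
  obtain f' g' where f': "f' \<in> hmod_hom B B'" "g' \<in> hmod_hom B' B" "g' * f' = 1\<^sub>m (fst B)" "f' * g' = 1\<^sub>m (fst B')"
    and fc': "f' \<in> carrier_mat (fst B') (fst B)" "g' \<in> carrier_mat (fst B) (fst B')"
    using B by (rule hmod_isoE)
  note [simp] = is_biproduct_dims[OF 1] carrier_matD[OF fc(1)] carrier_matD[OF fc(2)]
    carrier_matD[OF fc'(1)] carrier_matD[OF fc'(2)]
  note D = is_biproductD[OF 1]
  have "f * p * (i * g) = f * (p * i) * g" "f' * q * (j * g') = f' * (q * j) * g'"
    "i * g * (f * p) = i * (g * f) * p" "j * g' * (f' * q) = j * (g' * f') * q"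
    by (simp_all add: mat_mult_assoc)
  then have "is_biproduct M A' B' (i * g) (f * p) (j * g') (f' * q)"
    unfolding is_biproduct_def using D
    by (auto simp: f f' intro!: hmod_hom_comp[where H = H, OF D(1) f(2)] hmod_hom_comp[where H = H, OF f(1) D(2)]
        hmod_hom_comp[where H = H, OF D(3) f'(2)] hmod_hom_comp[where H = H, OF f'(1) D(4)] m)
  then show ?thesis by blast
qed

lemma hmod_sum_cong:
  assumes "hmod_iso A A'" "hmod_iso B B'" "hmodule H A" "hmodule H B" "hmodule H A'" "hmodule H B'"
  shows "hmod_iso (hmod_sum A B) (hmod_sum A' B')"
  using is_biproduct_cong[OF hmod_sum_biproduct[OF assms(3,4)] assms(1,2) hmodule_sum[OF assms(3,4)] assms(3-6)]
    biproduct_iso_sum[of _ A' B' _ _ _ _ H] hmodule_sum assms by blast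

lemma hmod_sum_commute:
  assumes "hmodule H A" "hmodule H B"
  shows "hmod_iso (hmod_sum A B) (hmod_sum B A)"
  by (rule biproduct_iso_sum[where H = H, OF is_biproduct_commute[OF hmod_sum_biproduct[OF assms]]])
    (intro hmodule_sum assms)+

lemma hmod_sum_assoc:
  assumes "hmodule H A" "hmodule H B" "hmodule H C"
  shows "hmod_sum (hmod_sum A B) C = hmod_sum A (hmod_sum B C)"
proof (rule prod_eqI)
  note [simp] = carrier_matD[OF hmodule_carrier[OF assms(1)]] carrier_matD[OF hmodule_carrier[OF assms(2)]]
    carrier_matD[OF hmodule_carrier[OF assms(3)]]
  have "snd (hmod_sum (hmod_sum A B) C) h = snd (hmod_sum A (hmod_sum B C)) h" for h
    by (rule eq_matI) (auto simp: snd_hmod_sum)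
  then show "snd (hmod_sum (hmod_sum A B) C) = snd (hmod_sum A (hmod_sum B C))" by blast
qed simp

section \<open>Finite direct sums and split idempotents\<close>

definition hmod_zero :: "('k::field, 'h) hmod" where
  "hmod_zero = (0, \<lambda>_. 0\<^sub>m 0 0)"

lemma fst_hmod_zero [simp]: "fst hmod_zero = 0"
  by (simp add: hmod_zero_def)

lemma hmodule_zero: "hmodule H hmod_zero"
  by (rule hmoduleI) (auto simp: hmod_zero_def mat_linear_def intro!: eq_matI)

lemma hmod_sum_zero:
  assumes "hmodule H V"
  shows "hmod_sum V hmod_zero = V" "hmod_sum hmod_zero V = V"
proof -
  note [simp] = carrier_matD[OF hmodule_carrier[OF assms]]
  have "snd (hmod_sum V hmod_zero) h = snd V h" "snd (hmod_sum hmod_zero V) h = snd V h" for h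
    by (rule eq_matI; auto simp: snd_hmod_sum hmod_zero_def)+
  then have "snd (hmod_sum V hmod_zero) = snd V" "snd (hmod_sum hmod_zero V) = snd V" by blast+
  then show "hmod_sum V hmod_zero = V" "hmod_sum hmod_zero V = V" by (auto intro: prod_eqI)
qed

lemma hmod_iso_zero:
  assumes "hmodule H V" "fst V = 0"
  shows "hmod_iso V hmod_zero"
proof (rule hmod_isoI)
  note [simp] = carrier_matD[OF hmodule_carrier[OF assms(1)]] assms(2)
  show "0\<^sub>m 0 0 \<in> hmod_hom V hmod_zero" "0\<^sub>m 0 0 \<in> hmod_hom hmod_zero V"
    by (rule hmod_homI; (rule eq_matI)?; simp add: hmod_zero_def)+
  show "0\<^sub>m 0 0 * 0\<^sub>m 0 0 = 1\<^sub>m (fst V)" "0\<^sub>m 0 0 * 0\<^sub>m 0 0 = 1\<^sub>m (fst hmod_zero)"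
    by (rule eq_matI; simp)+
qed

fun hmod_sum_list :: "('k::field, 'h) hmod list \<Rightarrow> ('k, 'h) hmod" where
  "hmod_sum_list [] = hmod_zero"
| "hmod_sum_list (V # Vs) = hmod_sum V (hmod_sum_list Vs)"

lemma hmodule_sum_list: "(\<And>V. V \<in> set Vs \<Longrightarrow> hmodule H V) \<Longrightarrow> hmodule H (hmod_sum_list Vs)"
  by (induction Vs) (auto simp: hmodule_zero hmodule_sum)

lemma hmod_sum_list_append:
  "(\<And>V. V \<in> set (Us @ Vs) \<Longrightarrow> hmodule H V) \<Longrightarrow>
   hmod_sum_list (Us @ Vs) = hmod_sum (hmod_sum_list Us) (hmod_sum_list Vs)"
proof (induction Us)
  case Nil
  then show ?case using hmod_sum_zero(2)[OF hmodule_sum_list[of Vs H]] by simp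
next
  case (Cons U Us)
  then show ?case
    using hmod_sum_assoc[of H U "hmod_sum_list Us" "hmod_sum_list Vs"] hmodule_sum_list[of Us H] hmodule_sum_list[of Vs H]
    by simp
qed

lemma fst_hmod_sum_list: "fst (hmod_sum_list Vs) = sum_list (map fst Vs)"
  by (induction Vs) auto

text \<open>With \<open>A * B = e\<close> and \<open>B * A\<close> the identity, \<open>h\<close>
  acts on the image of \<open>e\<close> by \<open>B * \<rho> h * A\<close>. This is multiplicative
  because \<open>e\<close> commutes with the action.\<close>

lemma idempotent_splits:
  assumes V: "hmodule H V" and e: "e \<in> hmod_hom V V" and idem: "e * e = e"
  obtains X i p where "hmodule H X" "i \<in> hmod_hom X V" "p \<in> hmod_hom V X" "p * i = 1\<^sub>m (fst X)" "i * p = e"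
proof -
  define n \<rho> where "n = fst V" and "\<rho> = snd V"
  have ec: "e \<in> carrier_mat n n" and e\<rho>: "e * \<rho> h = \<rho> h * e" for h
    using hmod_homD[OF e] by (simp_all add: n_def \<rho>_def)
  obtain r A B where A: "A \<in> carrier_mat n r" and B: "B \<in> carrier_mat r n"
    and AB: "A * B = e" and BA: "B * A = 1\<^sub>m r"
    using idempotent_factorization[OF ec idem] .
  have \<rho>: "\<rho> h \<in> carrier_mat n n" for h using hmodule_carrier[OF V] by (simp add: n_def \<rho>_def)
  note [simp] = carrier_matD[OF A] carrier_matD[OF B] carrier_matD[OF \<rho>] carrier_matD[OF ec]
  have eA: "e * A = A" by (simp add: AB[symmetric] mat_mult_assoc BA)
  have Be: "B * e = B" by (simp add: AB[symmetric] mat_mult_assoc[symmetric] BA)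
  define X where "X = (r, \<lambda>h. B * \<rho> h * A)"
  have i: "A * (B * \<rho> h * A) = \<rho> h * A" for h
  proof -
    have "A * (B * \<rho> h * A) = e * \<rho> h * A" by (simp add: AB[symmetric] mat_mult_assoc)
    also have "\<dots> = \<rho> h * (e * A)" by (simp add: e\<rho> mat_mult_assoc)
    finally show ?thesis by (simp add: eA)
  qed
  have p: "B * \<rho> h * A * B = B * \<rho> h" for h
  proof -
    have "B * \<rho> h * A * B = B * (\<rho> h * e)" by (simp add: AB[symmetric] mat_mult_assoc)
    also have "\<dots> = B * e * \<rho> h" by (simp add: e\<rho>[symmetric] mat_mult_assoc)
    finally show ?thesis by (simp add: Be)
  qed
  have X: "hmodule H X"
  proof (rule hmoduleI)
    show "mat_linear (hscale H) (fst X) (fst X) (snd X)"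
      unfolding X_def fst_conv snd_conv
      by (rule mat_linear_mult_right[where c = n], rule mat_linear_mult_left[where c = n])
        (use hmodule_linear[OF V] A B in \<open>simp_all add: n_def \<rho>_def\<close>)
    show "snd X 1 = 1\<^sub>m (fst X)"
      using hmodule_one[OF V] by (simp add: X_def \<rho>_def[symmetric] n_def[symmetric] BA right_mult_one_mat[OF B])
    show "snd X (g * h) = snd X g * snd X h" for g h
    proof -
      have "snd X g * snd X h = B * \<rho> g * (A * (B * \<rho> h * A))" by (simp add: X_def mat_mult_assoc)
      also have "\<dots> = B * (\<rho> g * \<rho> h) * A" unfolding i by (simp add: mat_mult_assoc)
      finally show ?thesis using hmodule_mult[OF V] by (simp add: X_def \<rho>_def)
    qed
  qed
  have iX: "A \<in> hmod_hom X V" and pX: "B \<in> hmod_hom V X"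
    using A B i p by (auto intro!: hmod_homI simp: X_def n_def \<rho>_def)
  show thesis by (rule that[OF X iX pX]) (simp_all add: BA AB X_def)
qed

text \<open>The complement is the image of the idempotent
  \<open>1\<^sub>m (fst V) - i * p\<close>.\<close>

lemma split_mono_complement:
  assumes V: "hmodule H V" and X: "hmodule H X" and i: "i \<in> hmod_hom X V" and p: "p \<in> hmod_hom V X"
    and pi: "p * i = 1\<^sub>m (fst X)"
  obtains W j q where "hmodule H W" "is_biproduct V X W i p j q"
proof -
  note c = hmod_homD(1)[OF i] hmod_homD(1)[OF p]
  note [simp] = carrier_matD[OF c(1)] carrier_matD[OF c(2)]
  have P: "i * p \<in> hmod_hom V V" by (intro hmod_hom_comp[where H = H, OF i p] V X)
  have Pc: "i * p \<in> carrier_mat (fst V) (fst V)" using hmod_homD(1)[OF P] .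
  have PP: "i * p * (i * p) = i * p"
  proof -
    have "i * p * (i * p) = i * (p * i * p)" by (simp add: mat_mult_assoc)
    then show ?thesis by (simp add: pi)
  qed
  define e where "e = 1\<^sub>m (fst V) + (-1) \<cdot>\<^sub>m (i * p)"
  have e: "e \<in> hmod_hom V V"
    unfolding e_def by (intro hmod_hom_add[where H = H] hmod_hom_smult[where H = H] hmod_hom_one[OF V] P V)
  have e': "e = 1\<^sub>m (fst V) - i * p"
    unfolding e_def by (rule eq_matI) auto
  have "e * e = e"
  proof -
    have "e * e = e - e * (i * p)" by (subst (2) e') (use hmod_homD(1)[OF e] in \<open>simp add: mat_mult_diff\<close>)
    also have "e * (i * p) = i * p - i * p * (i * p)" unfolding e' by (simp add: mat_diff_mult)
    also have "\<dots> = 0\<^sub>m (fst V) (fst V)" unfolding PP by (rule minus_r_inv_mat[OF Pc])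
    finally show ?thesis using hmod_homD(1)[OF e] by (auto intro!: eq_matI)
  qed
  then obtain W j q where W: "hmodule H W" "j \<in> hmod_hom W V" "q \<in> hmod_hom V W" "q * j = 1\<^sub>m (fst W)" "j * q = e"
    using idempotent_splits[OF V e] by metis
  have "i * p + j * q = 1\<^sub>m (fst V)" unfolding W(5) e' by (rule eq_matI) auto
  then have "is_biproduct V X W i p j q" by (simp add: is_biproduct_def i p pi W)
  with W(1) that show thesis by blast
qed

section \<open>Local endomorphism rings\<close>

lemma indecomposableD:
  assumes "indecomposable H V"
  shows "hmodule H V" "fst V \<noteq> 0"
    "\<And>U W. hmodule H U \<Longrightarrow> hmodule H W \<Longrightarrow> hmod_iso V (hmod_sum U W) \<Longrightarrow> fst U = 0 \<or> fst W = 0"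
  using assms unfolding indecomposable_def by blast+

lemma mult_inner_dim_zero:
  assumes "A \<in> carrier_mat n 0" "B \<in> carrier_mat 0 m"
  shows "A * B = 0\<^sub>m n m"
  using assms by (intro eq_matI) (auto simp: scalar_prod_def)

text \<open>Fitting's lemma. The projection onto the stable image commutes with everything that
  commutes with \<open>\<phi>\<close>, in particular with the action, so it decomposes V. One part
  is zero, which makes \<open>\<phi>\<close> nilpotent or invertible.\<close>

lemma indecomposable_endomorphism:
  assumes V: "indecomposable H V" and \<phi>: "\<phi> \<in> hmod_hom V V"
  shows "(\<exists>\<psi> \<in> hmod_hom V V. \<psi> * \<phi> = 1\<^sub>m (fst V) \<and> \<phi> * \<psi> = 1\<^sub>m (fst V)) \<or> (\<exists>k. \<phi> ^\<^sub>m k = 0\<^sub>m (fst V) (fst V))"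
proof -
  note mV = indecomposableD(1)[OF V]
  note c = hmod_homD(1)[OF \<phi>]
  obtain E T k where E: "E \<in> carrier_mat (fst V) (fst V)" "T \<in> carrier_mat (fst V) (fst V)" "E * E = E"
    and T: "\<phi> * T = E" "T * \<phi> = E" "\<phi> ^\<^sub>m k * E = \<phi> ^\<^sub>m k"
    and comm: "\<And>B. B \<in> carrier_mat (fst V) (fst V) \<Longrightarrow> \<phi> * B = B * \<phi> \<Longrightarrow> E * B = B * E"
      "\<And>B. B \<in> carrier_mat (fst V) (fst V) \<Longrightarrow> \<phi> * B = B * \<phi> \<Longrightarrow> T * B = B * T"
    using fitting_idempotent[OF c] by blast
  have hom: "E \<in> hmod_hom V V" "T \<in> hmod_hom V V"
    using comm hmodule_carrier[OF mV] hmod_homD(2)[OF \<phi>] E by (auto intro!: hmod_homI)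
  obtain X i p where X: "hmodule H X" "i \<in> hmod_hom X V" "p \<in> hmod_hom V X" "p * i = 1\<^sub>m (fst X)" "i * p = E"
    using idempotent_splits[OF mV hom(1) E(3)] .
  obtain W j q where W: "hmodule H W" and b: "is_biproduct V X W i p j q"
    using split_mono_complement[OF mV X(1-4)] .
  have "fst X = 0 \<or> fst W = 0"
    by (rule indecomposableD(3)[OF V X(1) W biproduct_iso_sum[OF b mV X(1) W]])
  then show ?thesis
  proof
    assume "fst X = 0"
    then have "E = 0\<^sub>m (fst V) (fst V)"
      using mult_inner_dim_zero[of i "fst V" p "fst V"] hmod_homD(1)[OF X(2)] hmod_homD(1)[OF X(3)] X(5) by simp
    then have "\<phi> ^\<^sub>m k = \<phi> ^\<^sub>m k * 0\<^sub>m (fst V) (fst V)" using T(3) by simp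
    also have "\<dots> = 0\<^sub>m (fst V) (fst V)" by (rule right_mult_zero_mat[OF pow_carrier_mat[OF c]])
    finally show ?thesis by blast
  next
    assume "fst W = 0"
    then have "j * q = 0\<^sub>m (fst V) (fst V)"
      using mult_inner_dim_zero[of j "fst V" q "fst V"] hmod_homD(1)[OF is_biproductD(3)[OF b]]
        hmod_homD(1)[OF is_biproductD(4)[OF b]] by simp
    then have "E = 1\<^sub>m (fst V)" using is_biproductD(7)[OF b] X(5) E(1) by simp
    then have "\<phi> * T = 1\<^sub>m (fst V)" "T * \<phi> = 1\<^sub>m (fst V)" using T by simp_all
    with hom(2) show ?thesis by blast
  qed
qed

text \<open>\<open>N\<close> is the last nonvanishing power of \<open>A\<close>. One exists because
  the zeroth power, the identity, is nonzero in positive dimension.\<close>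

lemma nilpotent_annihilates:
  fixes A :: "'a::field mat"
  assumes A: "A \<in> carrier_mat n n" and "n \<noteq> 0" and "A ^\<^sub>m k = 0\<^sub>m n n"
  obtains N where "N \<in> carrier_mat n n" "N \<noteq> 0\<^sub>m n n" "A * N = 0\<^sub>m n n"
proof -
  define l where "l = (LEAST k. A ^\<^sub>m k = 0\<^sub>m n n)"
  have l: "A ^\<^sub>m l = 0\<^sub>m n n" unfolding l_def by (rule LeastI) (rule assms(3))
  have "l \<noteq> 0"
  proof
    assume "l = 0"
    then have "(1\<^sub>m n :: 'a mat) = 0\<^sub>m n n" using l A by simp
    then have "(1\<^sub>m n :: 'a mat) $$ (0, 0) = 0\<^sub>m n n $$ (0, 0)" by simp
    with \<open>n \<noteq> 0\<close> show False by simp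
  qed
  then obtain m where m: "l = Suc m" by (cases l) auto
  have "A ^\<^sub>m m \<noteq> 0\<^sub>m n n" using not_less_Least[of m "\<lambda>k. A ^\<^sub>m k = 0\<^sub>m n n"] m by (simp add: l_def)
  moreover have "A * A ^\<^sub>m m = 0\<^sub>m n n"
    using l m pow_mat_commutes[OF A A refl, of m] by simp
  ultimately show thesis using that pow_carrier_mat[OF A] by blast
qed

text \<open>If both summands were nilpotent, a nonzero \<open>N\<close> with
  \<open>\<phi> * N\<close> zero would satisfy \<open>\<psi> * N = N\<close>, so that no power of
  \<open>\<psi>\<close> could vanish.\<close>

lemma indecomposable_local:
  assumes V: "indecomposable H V" and \<phi>: "\<phi> \<in> hmod_hom V V" and \<psi>: "\<psi> \<in> hmod_hom V V"
    and sum: "\<phi> + \<psi> = 1\<^sub>m (fst V)"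
  shows "(\<exists>w \<in> hmod_hom V V. w * \<phi> = 1\<^sub>m (fst V)) \<or> (\<exists>w \<in> hmod_hom V V. w * \<psi> = 1\<^sub>m (fst V))"
proof (rule ccontr)
  assume "\<not> ?thesis"
  then obtain k l where k: "\<phi> ^\<^sub>m k = 0\<^sub>m (fst V) (fst V)" and l: "\<psi> ^\<^sub>m l = 0\<^sub>m (fst V) (fst V)"
    using indecomposable_endomorphism[OF V \<phi>] indecomposable_endomorphism[OF V \<psi>] by blast
  note c = hmod_homD(1)[OF \<phi>] hmod_homD(1)[OF \<psi>]
  obtain N where N: "N \<in> carrier_mat (fst V) (fst V)" "N \<noteq> 0\<^sub>m (fst V) (fst V)" "\<phi> * N = 0\<^sub>m (fst V) (fst V)"
    using nilpotent_annihilates[OF c(1) indecomposableD(2)[OF V] k] .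
  note [simp] = carrier_matD[OF c(1)] carrier_matD[OF c(2)] carrier_matD[OF N(1)]
  have "\<phi> * N + \<psi> * N = N" by (simp add: mat_add_mult[symmetric] sum)
  then have \<psi>N: "\<psi> * N = N" using N c(2) by simp
  have "\<psi> ^\<^sub>m l * N = N"
  proof (induction l)
    case (Suc l)
    have "\<psi> ^\<^sub>m Suc l * N = \<psi> ^\<^sub>m l * (\<psi> * N)" by (simp add: mat_mult_assoc)
    with Suc show ?case by (simp add: \<psi>N)
  qed simp
  with l N show False by simp
qed

text \<open>The complement of \<open>X\<close> has dimension 0, so \<open>i * p\<close> is the
  identity.\<close>

lemma summand_of_indecomposable:
  assumes V: "indecomposable H V" and X: "hmodule H X" "fst X \<noteq> 0"
    and i: "i \<in> hmod_hom X V" and p: "p \<in> hmod_hom V X" and pi: "p * i = 1\<^sub>m (fst X)"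
  shows "hmod_iso X V"
proof -
  note mV = indecomposableD(1)[OF V]
  obtain W j q where W: "hmodule H W" and b: "is_biproduct V X W i p j q"
    using split_mono_complement[OF mV X(1) i p pi] .
  have "fst X = 0 \<or> fst W = 0"
    by (rule indecomposableD(3)[OF V X(1) W biproduct_iso_sum[OF b mV X(1) W]])
  then have "fst W = 0" using X(2) by simp
  then have "j * q = 0\<^sub>m (fst V) (fst V)"
    using mult_inner_dim_zero[of j "fst V" q "fst V"] hmod_homD(1)[OF is_biproductD(3)[OF b]]
      hmod_homD(1)[OF is_biproductD(4)[OF b]] by simp
  then have "i * p = 1\<^sub>m (fst V)"
    using is_biproductD(7)[OF b] mult_carrier_mat[OF hmod_homD(1)[OF i] hmod_homD(1)[OF p]] by simp
  then show ?thesis by (rule hmod_isoI[OF i p pi])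
qed

section \<open>Direct summands and cancellation\<close>

definition hmod_summand :: "('k::field, 'h) hmod \<Rightarrow> ('k, 'h) hmod \<Rightarrow> bool" where
  "hmod_summand X V \<longleftrightarrow> (\<exists>i \<in> hmod_hom X V. \<exists>p \<in> hmod_hom V X. p * i = 1\<^sub>m (fst X))"

lemma hmod_summandI:
  "i \<in> hmod_hom X V \<Longrightarrow> p \<in> hmod_hom V X \<Longrightarrow> p * i = 1\<^sub>m (fst X) \<Longrightarrow> hmod_summand X V"
  unfolding hmod_summand_def by blast

lemma hmod_summand_iso:
  assumes "hmod_summand X V" "hmod_iso V W" and m: "hmodule H X" "hmodule H V" "hmodule H W"
  shows "hmod_summand X W"
proof -
  obtain i p where i: "i \<in> hmod_hom X V" and p: "p \<in> hmod_hom V X" and pi: "p * i = 1\<^sub>m (fst X)"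
    using assms(1) unfolding hmod_summand_def by blast
  obtain A B where A: "A \<in> hmod_hom V W" "B \<in> hmod_hom W V" "B * A = 1\<^sub>m (fst V)"
    and c: "A \<in> carrier_mat (fst W) (fst V)" "B \<in> carrier_mat (fst V) (fst W)"
    using assms(2) by (rule hmod_isoE)
  note d = hmod_homD(1)[OF i] hmod_homD(1)[OF p]
  note [simp] = carrier_matD[OF c(1)] carrier_matD[OF c(2)] carrier_matD[OF d(1)] carrier_matD[OF d(2)]
  have "p * B * (A * i) = p * (B * A) * i" by (simp add: mat_mult_assoc)
  then have "p * B * (A * i) = 1\<^sub>m (fst X)" by (simp add: A pi)
  then show ?thesis
    by (intro hmod_summandI[OF hmod_hom_comp[where H = H, OF A(1) i] hmod_hom_comp[where H = H, OF p A(2)]] m)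
qed

text \<open>The identity of X is the sum of its components through A and B. By locality one of them
  has a left inverse, which completes it to a splitting.\<close>

lemma indecomposable_summand_sum:
  assumes X: "indecomposable H X" and s: "hmod_summand X (hmod_sum A B)" and A: "hmodule H A" and B: "hmodule H B"
  shows "hmod_summand X A \<or> hmod_summand X B"
proof -
  note mX = indecomposableD(1)[OF X] and mM = hmodule_sum[OF A B]
  let ?M = "hmod_sum A B"
  obtain f g where f: "f \<in> hmod_hom X ?M" and g: "g \<in> hmod_hom ?M X" and gf: "g * f = 1\<^sub>m (fst X)"
    using s unfolding hmod_summand_def by blast
  obtain i p j q where b: "is_biproduct ?M A B i p j q" using hmod_sum_biproduct[OF A B] by blast
  note D = is_biproductD[OF b]
  note c = hmod_homD(1)[OF f] hmod_homD(1)[OF g]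
  note [simp] = is_biproduct_dims[OF b, simplified] carrier_matD[OF c(1), simplified] carrier_matD[OF c(2), simplified]
  have h: "g * i \<in> hmod_hom A X" "p * f \<in> hmod_hom X A" "g * j \<in> hmod_hom B X" "q * f \<in> hmod_hom X B"
    by (intro hmod_hom_comp[where H = H, OF g D(1)] hmod_hom_comp[where H = H, OF D(2) f] hmod_hom_comp[where H = H, OF g D(3)] hmod_hom_comp[where H = H, OF D(4) f] A B mX mM)+
  have "g * i * (p * f) + g * j * (q * f) = g * (i * p + j * q) * f"
    by (simp add: mat_mult_assoc mat_add_mult mat_mult_add)
  also have "\<dots> = 1\<^sub>m (fst X)" unfolding D(7) by (simp add: gf)
  finally have sum: "g * i * (p * f) + g * j * (q * f) = 1\<^sub>m (fst X)" .
  have *: "hmod_summand X C" if r: "r \<in> hmod_hom C X" and t: "t \<in> hmod_hom X C" and C: "hmodule H C"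
    and w: "w \<in> hmod_hom X X" "w * (r * t) = 1\<^sub>m (fst X)" for C r t w
  proof (rule hmod_summandI[OF t])
    show "w * r \<in> hmod_hom C X" by (rule hmod_hom_comp[where H = H, OF w(1) r C mX mX])
    show "w * r * t = 1\<^sub>m (fst X)"
      using mat_mult_assoc[of w r t] hmod_homD(1)[OF r] hmod_homD(1)[OF t] hmod_homD(1)[OF w(1)] w(2) by simp
  qed
  show ?thesis
    using indecomposable_local[OF X hmod_hom_comp[where H = H, OF h(1,2) mX A mX] hmod_hom_comp[where H = H, OF h(3,4) mX B mX] sum]
      *[OF h(1,2) A] *[OF h(3,4) B] by blast
qed

lemma hmod_summand_sum_left: "hmodule H A \<Longrightarrow> hmodule H B \<Longrightarrow> hmod_summand A (hmod_sum A B)"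
  using is_biproductD[OF hmod_sum_biproduct[of H A B]] by (intro hmod_summandI)

lemma hmod_hom_diff:
  assumes "A \<in> hmod_hom V W" "B \<in> hmod_hom V W" "hmodule H V" "hmodule H W"
  shows "A - B \<in> hmod_hom V W"
proof -
  have "A - B = A + (-1) \<cdot>\<^sub>m B"
    using hmod_homD(1)[OF assms(1)] hmod_homD(1)[OF assms(2)] by (intro eq_matI) auto
  then show ?thesis
    using hmod_hom_add[OF assms(1) hmod_hom_smult[OF assms(2-4)] assms(3,4)] by simp
qed

lemma hmod_isoI_inverse:
  assumes A: "A \<in> hmod_hom V W" and B: "B \<in> carrier_mat (fst V) (fst W)"
    and inv: "B * A = 1\<^sub>m (fst V)" "A * B = 1\<^sub>m (fst W)" and V: "hmodule H V" and W: "hmodule H W"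
  shows "hmod_iso V W"
proof (rule hmod_isoI[OF A _ inv], rule hmod_homI[OF B])
  note c = hmod_homD(1)[OF A]
  note [simp] = carrier_matD[OF B] carrier_matD[OF c] carrier_matD[OF hmodule_carrier[OF V]]
    carrier_matD[OF hmodule_carrier[OF W]]
  fix h
  have "B * snd W h = B * (snd W h * A) * B" by (simp add: mat_mult_assoc inv)
  also have "\<dots> = B * (A * snd V h) * B" by (simp add: hmod_homD(2)[OF A])
  also have "\<dots> = B * A * (snd V h * B)" by (simp add: mat_mult_assoc)
  finally show "B * snd W h = snd V h * B" by (simp add: inv)
qed

text \<open>Here \<open>w\<close> inverts the component \<open>p' * i\<close>. The map
  \<open>e\<close> kills the image of \<open>i\<close> and fixes the image of \<open>j'\<close>: it
  is the projection onto the second complement along the first copy of X. Inserting it between the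
  two complements gives the mutually inverse maps \<open>q' * e * j\<close> and
  \<open>q * j'\<close>.\<close>

lemma biproduct_complements_iso:
  assumes b: "is_biproduct M X A i p j q" and b': "is_biproduct M X B i' p' j' q'"
    and w: "w \<in> hmod_hom X X" "w * (p' * i) = 1\<^sub>m (fst X)" "p' * i * w = 1\<^sub>m (fst X)"
    and m: "hmodule H M" "hmodule H X" "hmodule H A" "hmodule H B"
  shows "hmod_iso A B"
proof -
  note D = is_biproductD[OF b] and D' = is_biproductD[OF b']
  note [simp] = is_biproduct_dims[OF b] is_biproduct_dims[OF b'] carrier_matD[OF hmod_homD(1)[OF w(1)]]
  define e where "e = 1\<^sub>m (fst M) - i * w * p'"
  have "i * w * p' \<in> hmod_hom M M"
    by (rule hmod_hom_comp[OF hmod_hom_comp[OF D(1) w(1) m(2,2,1)] D'(2) m(1,2,1)])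
  then have e: "e \<in> hmod_hom M M"
    unfolding e_def by (rule hmod_hom_diff[OF hmod_hom_one[OF m(1)] _ m(1,1)])
  note [simp] = carrier_matD[OF hmod_homD(1)[OF e]]
  have ei: "e * i = 0\<^sub>m (fst M) (fst X)"
  proof -
    have "e * i = i - i * (w * (p' * i))" by (simp add: e_def mat_diff_mult mat_mult_assoc)
    then show ?thesis by (simp add: w(2) minus_r_inv_mat[of _ "fst M" "fst X"] carrier_matI)
  qed
  have pe: "p' * e = 0\<^sub>m (fst X) (fst M)"
  proof -
    have "p' * e = p' - p' * i * w * p'" by (simp add: e_def mat_mult_diff mat_mult_assoc)
    then show ?thesis by (simp add: w(3) minus_r_inv_mat[of _ "fst X" "fst M"] carrier_matI)
  qed
  have ejq: "e * (j * q) = e"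
  proof -
    have "e * (i * p + j * q) = e * i * p + e * (j * q)" by (simp add: mat_mult_add mat_mult_assoc)
    then show ?thesis
      by (simp add: D(7) ei carrier_matI left_add_zero_mat[of "e * (j * q)" "fst M" "fst M"])
  qed
  have jqe: "j' * q' * e = e"
  proof -
    have "(i' * p' + j' * q') * e = i' * (p' * e) + j' * q' * e" by (simp add: mat_add_mult mat_mult_assoc)
    then show ?thesis
      by (simp add: D'(7) pe carrier_matI left_add_zero_mat[of "j' * q' * e" "fst M" "fst M"])
  qed
  have ej: "e * j' = j'"
  proof -
    have "e * j' = j' - i * w * (p' * j')" by (simp add: e_def mat_diff_mult mat_mult_assoc)
    then show ?thesis by (auto simp: is_biproduct_cross[OF b'] intro!: eq_matI)
  qed
  have qe: "q * e = q"
  proof -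
    have "q * e = q - q * i * w * p'" by (simp add: e_def mat_mult_diff mat_mult_assoc)
    then show ?thesis by (auto simp: is_biproduct_cross'[OF b] intro!: eq_matI)
  qed
  have 1: "(q' * e * j) * (q * j') = 1\<^sub>m (fst B)"
  proof -
    have "(q' * e * j) * (q * j') = q' * (e * (j * q) * j')" by (simp add: mat_mult_assoc)
    then show ?thesis by (simp add: ejq ej D'(6))
  qed
  have 2: "(q * j') * (q' * e * j) = 1\<^sub>m (fst A)"
  proof -
    have "(q * j') * (q' * e * j) = q * (j' * q' * e) * j" by (simp add: mat_mult_assoc)
    then show ?thesis by (simp add: jqe qe D(6))
  qed
  have "q' * e * j \<in> hmod_hom A B"
    by (rule hmod_hom_comp[OF hmod_hom_comp[OF D'(4) e m(1,1,4)] D(3) m(3,1,4)])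
  moreover have "q * j' \<in> hmod_hom B A" by (rule hmod_hom_comp[OF D(4) D'(3) m(4,1,3)])
  ultimately show ?thesis by (rule hmod_isoI[OF _ _ 2 1])
qed

text \<open>The inclusion of X stays, its retraction changes by \<open>t * q\<close>, and the
  complement moves within M while remaining a copy of B. This freedom adjusts one component of a map
  between two decompositions.\<close>

lemma biproduct_shear:
  assumes b: "is_biproduct M X B i p j q" and t: "t \<in> hmod_hom B X"
    and m: "hmodule H M" "hmodule H X" "hmodule H B"
  shows "is_biproduct M X B i (p + t * q) (j - i * t) q"
proof -
  note D = is_biproductD[OF b]
  note [simp] = is_biproduct_dims[OF b] carrier_matD[OF hmod_homD(1)[OF t]]
  have "p + t * q \<in> hmod_hom M X"
    by (rule hmod_hom_add[OF D(2) hmod_hom_comp[OF t D(4) m(1,3,2)] m(1,2)])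
  moreover have "j - i * t \<in> hmod_hom B M"
    by (rule hmod_hom_diff[OF D(3) hmod_hom_comp[OF D(1) t m(3,2,1)] m(3,1)])
  moreover have "(p + t * q) * i = 1\<^sub>m (fst X)"
  proof -
    have "(p + t * q) * i = p * i + t * (q * i)" by (simp add: mat_add_mult mat_mult_assoc)
    then show ?thesis by (simp add: D(5) is_biproduct_cross'[OF b])
  qed
  moreover have "q * (j - i * t) = 1\<^sub>m (fst B)"
  proof -
    have "q * (j - i * t) = q * j - q * i * t" by (simp add: mat_mult_diff mat_mult_assoc)
    then show ?thesis by (auto simp: D(6) is_biproduct_cross'[OF b] intro!: eq_matI)
  qed
  moreover have "i * (p + t * q) + (j - i * t) * q = 1\<^sub>m (fst M)"
  proof -
    have "i * (p + t * q) + (j - i * t) * q = (i * p + i * (t * q)) + (j * q - i * (t * q))"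
      by (simp add: mat_mult_add mat_diff_mult mat_mult_assoc)
    also have "\<dots> = i * p + j * q" by (rule eq_matI) auto
    finally show ?thesis by (simp add: D(7))
  qed
  ultimately show ?thesis using D by (simp add: is_biproduct_def)
qed

lemma is_biproduct_transport:
  assumes b: "is_biproduct M A B i p j q" and iso: "hmod_iso M M'"
    and m: "hmodule H M" "hmodule H M'" "hmodule H A" "hmodule H B"
  shows "\<exists>i p j q. is_biproduct M' A B i p j q"
proof -
  note D = is_biproductD[OF b]
  obtain f g where f: "f \<in> hmod_hom M M'" "g \<in> hmod_hom M' M" "g * f = 1\<^sub>m (fst M)" "f * g = 1\<^sub>m (fst M')"
    and c: "f \<in> carrier_mat (fst M') (fst M)" "g \<in> carrier_mat (fst M) (fst M')"
    using iso by (rule hmod_isoE)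
  note [simp] = is_biproduct_dims[OF b] carrier_matD[OF c(1)] carrier_matD[OF c(2)]
  have "p * g * (f * i) = p * (g * f) * i" "q * g * (f * j) = q * (g * f) * j"
    by (simp_all add: mat_mult_assoc)
  moreover have "f * i * (p * g) + f * j * (q * g) = f * (i * p + j * q) * g"
    by (simp add: mat_mult_add mat_add_mult mat_mult_assoc)
  ultimately have "is_biproduct M' A B (f * i) (p * g) (f * j) (q * g)"
    unfolding is_biproduct_def
    using hmod_hom_comp[OF f(1) D(1) m(3,1,2)] hmod_hom_comp[OF D(2) f(2) m(2,1,3)]
      hmod_hom_comp[OF f(1) D(3) m(4,1,2)] hmod_hom_comp[OF D(4) f(2) m(2,1,4)]
    by (simp add: f D)
  then show ?thesis by blast
qed

text \<open>
  If the component \<open>a : X \<rightarrow> X\<close> of the isomorphism is invertible, then Gaussian elimination applies.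
  Otherwise the local ring \<open>End(X)\<close> provides a shear of \<open>X \<oplus> B\<close> that replaces \<open>a\<close> by the identity.
\<close>

lemma hmod_sum_cancel:
  assumes X: "indecomposable H X" and A: "hmodule H A" and B: "hmodule H B"
    and iso: "hmod_iso (hmod_sum X A) (hmod_sum X B)"
  shows "hmod_iso A B"
proof -
  note mX = indecomposableD(1)[OF X]
  define M where "M = hmod_sum X A"
  have M: "hmodule H M" unfolding M_def by (rule hmodule_sum[OF mX A])
  obtain i p j q where b: "is_biproduct M X A i p j q"
    unfolding M_def using hmod_sum_biproduct[OF mX A] by blast
  obtain i' p' j' q' where b': "is_biproduct M X B i' p' j' q'"
    using is_biproduct_transport[OF hmod_sum_biproduct[OF mX B] hmod_iso_sym[OF iso], folded M_def]
      hmodule_sum[OF mX B] M mX B by blast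
  note D = is_biproductD[OF b] and D' = is_biproductD[OF b']
  note [simp] = is_biproduct_dims[OF b] is_biproduct_dims[OF b']
  have a: "p' * i \<in> hmod_hom X X" and a': "p * i' \<in> hmod_hom X X"
    by (rule hmod_hom_comp[OF D'(2) D(1) mX M mX], rule hmod_hom_comp[OF D(2) D'(1) mX M mX])
  have c: "q' * i \<in> hmod_hom X B" and d: "p * j' \<in> hmod_hom B X"
    by (rule hmod_hom_comp[OF D'(4) D(1) mX M B], rule hmod_hom_comp[OF D(2) D'(3) B M mX])
  have "p * i' * (p' * i) + p * j' * (q' * i) = p * (i' * p' + j' * q') * i"
    by (simp add: mat_mult_add mat_add_mult mat_mult_assoc)
  also have "\<dots> = 1\<^sub>m (fst X)" unfolding D'(7) by (simp add: D(5))
  finally have sum: "p * i' * (p' * i) + p * j' * (q' * i) = 1\<^sub>m (fst X)" .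
  consider u where "u \<in> hmod_hom X X" "u * (p * i' * (p' * i)) = 1\<^sub>m (fst X)"
    | u where "u \<in> hmod_hom X X" "u * (p * j' * (q' * i)) = 1\<^sub>m (fst X)"
    using indecomposable_local[OF X hmod_hom_comp[OF a' a mX mX mX] hmod_hom_comp[OF d c mX B mX] sum] by blast
  then show ?thesis
  proof cases
    case (1 u)
    note [simp] = carrier_matD[OF hmod_homD(1)[OF 1(1)]]
    \<comment> \<open>\<open>?w\<close> is a left inverse of \<open>p' * i\<close>, and for square
      matrices this is a two-sided inverse.\<close>
    let ?w = "u * (p * i')"
    have w: "?w \<in> hmod_hom X X" by (rule hmod_hom_comp[OF 1(1) a' mX mX mX])
    have "?w * (p' * i) = 1\<^sub>m (fst X)" using 1(2) by (simp add: mat_mult_assoc)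
    then show ?thesis
      using left_inverse_imp_right_inverse[OF hmod_homD(1)[OF a] hmod_homD(1)[OF w]]
      by (intro biproduct_complements_iso[OF b b' w _ _ M mX A B])
  next
    case (2 u)
    note [simp] = carrier_matD[OF hmod_homD(1)[OF 2(1)]]
    define s where "s = 1\<^sub>m (fst X) - p' * i"
    have s: "s \<in> hmod_hom X X" unfolding s_def by (rule hmod_hom_diff[OF hmod_hom_one[OF mX] a mX mX])
    note [simp] = carrier_matD[OF hmod_homD(1)[OF s]]
    \<comment> \<open>\<open>u * (p * j')\<close> is a left inverse of \<open>q' * i\<close>, so
      \<open>t * (q' * i)\<close> equals \<open>s\<close>, exactly what \<open>p' * i\<close> lacks
      to be the identity.\<close>
    define t where "t = s * u * (p * j')"
    have t: "t \<in> hmod_hom B X"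
      unfolding t_def by (rule hmod_hom_comp[OF hmod_hom_comp[OF s 2(1) mX mX mX] d B mX mX])
    note [simp] = carrier_matD[OF hmod_homD(1)[OF t]]
    have "(p' + t * q') * i = p' * i + s * (u * (p * j' * (q' * i)))"
      by (simp add: t_def mat_add_mult mat_mult_assoc)
    also have "\<dots> = 1\<^sub>m (fst X)" unfolding 2(2) s_def by (rule eq_matI) auto
    finally have "(p' + t * q') * i = 1\<^sub>m (fst X)" .
    then show ?thesis
      by (intro biproduct_complements_iso[OF b biproduct_shear[OF b' t M mX B] hmod_hom_one[OF mX] _ _ M mX A B])
        simp_all
  qed
qed

section \<open>Existence and uniqueness of decompositions\<close>

lemma exists_indecomposable_decomposition:
  assumes "hmodule H V"
  shows "\<exists>Xs. (\<forall>X \<in> set Xs. indecomposable H X) \<and> hmod_iso V (hmod_sum_list Xs)"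
  using assms
proof (induction "fst V" arbitrary: V rule: less_induct)
  case less
  note V = less.prems
  have mod: "hmodule H (hmod_sum_list Xs)" if "\<forall>X \<in> set Xs. indecomposable H X" for Xs
    using that by (intro hmodule_sum_list) (auto dest: indecomposableD(1))
  consider "fst V = 0" | "indecomposable H V"
    | U W where "hmodule H U" "hmodule H W" "fst U \<noteq> 0" "fst W \<noteq> 0" "hmod_iso V (hmod_sum U W)"
    using V unfolding indecomposable_def by blast
  then show ?case
  proof cases
    case 1
    then show ?thesis using hmod_iso_zero[OF V] by (intro exI[of _ "[]"]) simp
  next
    case 2
    then show ?thesis using hmod_iso_refl[OF V] hmod_sum_zero(1)[OF V] by (intro exI[of _ "[V]"]) simp
  next
    case (3 U W)
    have "fst V = fst U + fst W" using hmod_iso_imp_fst_eq[OF 3(5)] by simp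
    with 3 have "fst U < fst V" "fst W < fst V" by auto
    then obtain Us Ws where Us: "\<forall>X \<in> set Us. indecomposable H X" "hmod_iso U (hmod_sum_list Us)"
      and Ws: "\<forall>X \<in> set Ws. indecomposable H X" "hmod_iso W (hmod_sum_list Ws)"
      using less.hyps 3 by meson
    have "hmod_iso (hmod_sum U W) (hmod_sum (hmod_sum_list Us) (hmod_sum_list Ws))"
      by (rule hmod_sum_cong[OF Us(2) Ws(2) 3(1,2) mod[OF Us(1)] mod[OF Ws(1)]])
    also have "hmod_sum (hmod_sum_list Us) (hmod_sum_list Ws) = hmod_sum_list (Us @ Ws)"
      using Us Ws by (intro hmod_sum_list_append[symmetric, of _ _ H]) (auto dest: indecomposableD(1))
    finally have "hmod_iso V (hmod_sum_list (Us @ Ws))"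
      using Us Ws by (intro hmod_iso_trans[OF 3(5) _ V hmodule_sum[OF 3(1,2)]] mod) auto
    then show ?thesis using Us Ws by (intro exI[of _ "Us @ Ws"]) auto
  qed
qed

text \<open>The dichotomy for two summands peels off one entry at a time, and an indecomposable
  summand of an indecomposable entry is isomorphic to it. A zero module has no nonzero summand,
  which excludes the empty list.\<close>

lemma indecomposable_summand_sum_list:
  assumes X: "indecomposable H X" and "\<forall>Y \<in> set Ys. indecomposable H Y" and "hmod_summand X (hmod_sum_list Ys)"
  shows "\<exists>Ys\<^sub>1 Y Ys\<^sub>2. Ys = Ys\<^sub>1 @ Y # Ys\<^sub>2 \<and> hmod_iso X Y"
  using assms(2,3)
proof (induction Ys)
  case Nil
  then obtain i p where "i \<in> hmod_hom X hmod_zero" "p \<in> hmod_hom hmod_zero X" "p * i = 1\<^sub>m (fst X)"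
    unfolding hmod_summand_def by auto
  then have "fst X \<le> 0" using mult_eq_one_imp_dim_le[of i 0 "fst X" p] by (auto dest!: hmod_homD(1))
  then show ?case using indecomposableD(2)[OF X] by simp
next
  case (Cons Y Ys)
  have Y: "indecomposable H Y" and Ys: "\<forall>Y \<in> set Ys. indecomposable H Y" using Cons.prems by auto
  have mYs: "hmodule H (hmod_sum_list Ys)"
    using Ys by (intro hmodule_sum_list) (auto dest: indecomposableD(1))
  have "hmod_summand X Y \<or> hmod_summand X (hmod_sum_list Ys)"
    using indecomposable_summand_sum[OF X _ indecomposableD(1)[OF Y] mYs] Cons.prems by simp
  then show ?case
  proof
    assume "hmod_summand X Y"
    then have "hmod_iso X Y"
      unfolding hmod_summand_def
      using summand_of_indecomposable[OF Y indecomposableD(1,2)[OF X]] by blast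
    then show ?thesis by (intro exI[of _ "[]"]) auto
  next
    assume "hmod_summand X (hmod_sum_list Ys)"
    then obtain Ys\<^sub>1 Z Ys\<^sub>2 where "Ys = Ys\<^sub>1 @ Z # Ys\<^sub>2" "hmod_iso X Z" using Cons.IH[OF Ys] by blast
    then show ?thesis by (intro exI[of _ "Y # Ys\<^sub>1"]) auto
  qed
qed

lemma iso_class_eq_iff:
  assumes "hmodule H V" "hmodule H W"
  shows "iso_class H V = iso_class H W \<longleftrightarrow> hmod_iso V W"
proof
  assume "iso_class H V = iso_class H W"
  moreover have "W \<in> iso_class H W" using assms hmod_iso_refl by (simp add: iso_class_def)
  ultimately have "W \<in> iso_class H V" by simp
  then show "hmod_iso V W" by (simp add: iso_class_def)
next
  assume "hmod_iso V W"
  then show "iso_class H V = iso_class H W"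
    unfolding iso_class_def using assms hmod_iso_trans hmod_iso_sym by blast
qed

text \<open>The head of the first list is a summand of the second sum and so isomorphic to one of
  its entries. That entry is moved to the front, and \<open>hmod_sum_cancel\<close> removes
  both.\<close>

theorem krull_schmidt:
  assumes "\<forall>X \<in> set Xs. indecomposable H X" "\<forall>Y \<in> set Ys. indecomposable H Y"
    and "hmod_iso (hmod_sum_list Xs) (hmod_sum_list Ys)"
  shows "mset (map (iso_class H) Xs) = mset (map (iso_class H) Ys)"
  using assms
proof (induction Xs arbitrary: Ys)
  case Nil
  then have "sum_list (map fst Ys) = 0"
    using hmod_iso_imp_fst_eq[OF Nil(3)] by (simp add: fst_hmod_sum_list)
  with Nil(2) have "Ys = []" using indecomposableD(2) by (cases Ys) fastforce+
  then show ?case by simp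
next
  case (Cons X Xs)
  have mod: "hmodule H (hmod_sum_list Xs)" if "\<forall>X \<in> set Xs. indecomposable H X" for Xs
    using that by (intro hmodule_sum_list) (auto dest: indecomposableD(1))
  have X: "indecomposable H X" and Xs: "\<forall>X \<in> set Xs. indecomposable H X" using Cons.prems by auto
  note mX = indecomposableD(1)[OF X]
  have "hmod_summand X (hmod_sum_list Ys)"
    using hmod_summand_iso[OF hmod_summand_sum_left[OF mX mod[OF Xs]] _ mX hmodule_sum[OF mX mod[OF Xs]] mod[OF Cons.prems(2)]]
      Cons.prems(3) by simp
  then obtain Ys\<^sub>1 Y Ys\<^sub>2 where Ys: "Ys = Ys\<^sub>1 @ Y # Ys\<^sub>2" and XY: "hmod_iso X Y"
    using indecomposable_summand_sum_list[OF X Cons.prems(2)] by blast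
  have Y: "indecomposable H Y" and Ys': "\<forall>X \<in> set (Ys\<^sub>1 @ Ys\<^sub>2). indecomposable H X"
    and Y1: "\<forall>X \<in> set Ys\<^sub>1. indecomposable H X" and Y2: "\<forall>X \<in> set Ys\<^sub>2. indecomposable H X"
    using Cons.prems(2) Ys by auto
  note mY = indecomposableD(1)[OF Y] and m1 = mod[OF Y1] and m2 = mod[OF Y2]
  let ?A = "hmod_sum_list Ys\<^sub>1" and ?B = "hmod_sum_list Ys\<^sub>2"
  have Yseq: "hmod_sum_list Ys = hmod_sum (hmod_sum ?A Y) ?B"
    using hmod_sum_list_append[of Ys\<^sub>1 "Y # Ys\<^sub>2" H] Y1 Y2 Y hmod_sum_assoc[OF m1 mY m2]
    by (auto simp: Ys dest: indecomposableD(1))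
  have Y'eq: "hmod_sum Y (hmod_sum_list (Ys\<^sub>1 @ Ys\<^sub>2)) = hmod_sum (hmod_sum Y ?A) ?B"
  proof -
    have "hmod_sum_list (Ys\<^sub>1 @ Ys\<^sub>2) = hmod_sum ?A ?B"
      using Y1 Y2 by (intro hmod_sum_list_append[of _ _ H]) (auto dest: indecomposableD(1))
    then show ?thesis using hmod_sum_assoc[OF mY m1 m2] by simp
  qed
  have 1: "hmod_iso (hmod_sum_list Ys) (hmod_sum Y (hmod_sum_list (Ys\<^sub>1 @ Ys\<^sub>2)))"
    unfolding Yseq Y'eq
    by (rule hmod_sum_cong[where H = H, OF hmod_sum_commute[OF m1 mY] hmod_iso_refl[OF m2]])
      (intro hmodule_sum m1 m2 mY)+
  have 2: "hmod_iso (hmod_sum Y (hmod_sum_list (Ys\<^sub>1 @ Ys\<^sub>2))) (hmod_sum X (hmod_sum_list (Ys\<^sub>1 @ Ys\<^sub>2)))"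
    by (rule hmod_sum_cong[where H = H, OF hmod_iso_sym[OF XY] hmod_iso_refl[OF mod[OF Ys']]]) (intro mY mX mod[OF Ys'])+
  note s = hmodule_sum[OF mX mod[OF Xs]] mod[OF Cons.prems(2)] hmodule_sum[OF mY mod[OF Ys']] hmodule_sum[OF mX mod[OF Ys']]
  have "hmod_iso (hmod_sum X (hmod_sum_list Xs)) (hmod_sum X (hmod_sum_list (Ys\<^sub>1 @ Ys\<^sub>2)))"
    using hmod_iso_trans[OF hmod_iso_trans[OF _ 1 s(1-3)] 2 s(1,3,4)] Cons.prems(3) by simp
  then have "hmod_iso (hmod_sum_list Xs) (hmod_sum_list (Ys\<^sub>1 @ Ys\<^sub>2))"
    by (rule hmod_sum_cancel[OF X mod[OF Xs] mod[OF Ys']])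
  then have "mset (map (iso_class H) Xs) = mset (map (iso_class H) (Ys\<^sub>1 @ Ys\<^sub>2))"
    by (rule Cons.IH[OF Xs Ys'])
  moreover have "iso_class H X = iso_class H Y" using iso_class_eq_iff[OF mX mY] XY by simp
  ultimately show ?case by (simp add: Ys)
qed

section \<open>Direct sums under tensor products and duals\<close>

context hopf_algebra
begin

lemma is_biproduct_tensor_right:
  assumes b: "is_biproduct M A B i p j q" and m: "hmodule H M" "hmodule H A" "hmodule H B" and V: "hmodule H V"
  shows "is_biproduct (hmod_tensor H M V) (hmod_tensor H A V) (hmod_tensor H B V)
    (kronecker i (1\<^sub>m (fst V))) (kronecker p (1\<^sub>m (fst V))) (kronecker j (1\<^sub>m (fst V))) (kronecker q (1\<^sub>m (fst V)))"
proof -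
  note D = is_biproductD[OF b]
  note [simp] = is_biproduct_dims[OF b]
  let ?I = "1\<^sub>m (fst V)"
  have "kronecker (i * p) ?I + kronecker (j * q) ?I = kronecker (i * p + j * q) ?I"
    by (rule kronecker_add_left[symmetric, of _ "fst M" "fst M" _ _ "fst V" "fst V"]) auto
  then show ?thesis
    unfolding is_biproduct_def
    using hmod_tensor_hom[OF D(1) hmod_hom_one[OF V] m(2,1) V V] hmod_tensor_hom[OF D(2) hmod_hom_one[OF V] m(1,2) V V]
      hmod_tensor_hom[OF D(3) hmod_hom_one[OF V] m(3,1) V V] hmod_tensor_hom[OF D(4) hmod_hom_one[OF V] m(1,3) V V]
    by (simp add: kronecker_mult D kronecker_one)
qed

lemma is_biproduct_tensor_left:
  assumes b: "is_biproduct M A B i p j q" and m: "hmodule H M" "hmodule H A" "hmodule H B" and V: "hmodule H V"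
  shows "is_biproduct (hmod_tensor H V M) (hmod_tensor H V A) (hmod_tensor H V B)
    (kronecker (1\<^sub>m (fst V)) i) (kronecker (1\<^sub>m (fst V)) p) (kronecker (1\<^sub>m (fst V)) j) (kronecker (1\<^sub>m (fst V)) q)"
proof -
  note D = is_biproductD[OF b]
  note [simp] = is_biproduct_dims[OF b]
  let ?I = "1\<^sub>m (fst V)"
  have "kronecker ?I (i * p) + kronecker ?I (j * q) = kronecker ?I (i * p + j * q)"
    by (rule kronecker_add_right[symmetric, of _ "fst M" "fst M" _ _ "fst V" "fst V"]) auto
  then show ?thesis
    unfolding is_biproduct_def
    using hmod_tensor_hom[OF hmod_hom_one[OF V] D(1) V V m(2,1)] hmod_tensor_hom[OF hmod_hom_one[OF V] D(2) V V m(1,2)]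
      hmod_tensor_hom[OF hmod_hom_one[OF V] D(3) V V m(3,1)] hmod_tensor_hom[OF hmod_hom_one[OF V] D(4) V V m(1,3)]
    by (simp add: kronecker_mult D kronecker_one)
qed

lemma hmod_tensor_sum_right:
  assumes "hmodule H A" "hmodule H B" "hmodule H V"
  shows "hmod_iso (hmod_tensor H (hmod_sum A B) V) (hmod_sum (hmod_tensor H A V) (hmod_tensor H B V))"
  by (rule biproduct_iso_sum[where H = H, OF is_biproduct_tensor_right[OF hmod_sum_biproduct[where H = H]]])
    (intro hmodule_tensor hmodule_sum assms)+

lemma hmod_tensor_sum_left:
  assumes "hmodule H A" "hmodule H B" "hmodule H V"
  shows "hmod_iso (hmod_tensor H V (hmod_sum A B)) (hmod_sum (hmod_tensor H V A) (hmod_tensor H V B))"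
  by (rule biproduct_iso_sum[where H = H, OF is_biproduct_tensor_left[OF hmod_sum_biproduct[where H = H]]])
    (intro hmodule_tensor hmodule_sum assms)+

lemma hmod_tensor_cong:
  assumes "hmod_iso V V'" "hmod_iso W W'" and m: "hmodule H V" "hmodule H V'" "hmodule H W" "hmodule H W'"
  shows "hmod_iso (hmod_tensor H V W) (hmod_tensor H V' W')"
proof -
  obtain A B where A: "A \<in> hmod_hom V V'" "B \<in> hmod_hom V' V" "B * A = 1\<^sub>m (fst V)" "A * B = 1\<^sub>m (fst V')"
    and c: "A \<in> carrier_mat (fst V') (fst V)" "B \<in> carrier_mat (fst V) (fst V')"
    using assms(1) by (rule hmod_isoE)
  obtain C D where C: "C \<in> hmod_hom W W'" "D \<in> hmod_hom W' W" "D * C = 1\<^sub>m (fst W)" "C * D = 1\<^sub>m (fst W')"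
    and d: "C \<in> carrier_mat (fst W') (fst W)" "D \<in> carrier_mat (fst W) (fst W')"
    using assms(2) by (rule hmod_isoE)
  note [simp] = carrier_matD[OF c(1)] carrier_matD[OF c(2)] carrier_matD[OF d(1)] carrier_matD[OF d(2)]
  show ?thesis
    by (rule hmod_isoI[OF hmod_tensor_hom[OF A(1) C(1) m] hmod_tensor_hom[OF A(2) C(2) m(2,1,4,3)]])
      (simp_all add: kronecker_mult A C kronecker_one)
qed

lemma hmod_dual_cong:
  assumes "hmod_iso V W" and m: "hmodule H V" "hmodule H W"
  shows "hmod_iso (hmod_dual H V) (hmod_dual H W)"
proof -
  obtain A B where A: "A \<in> hmod_hom V W" "B \<in> hmod_hom W V" "B * A = 1\<^sub>m (fst V)" "A * B = 1\<^sub>m (fst W)"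
    and c: "A \<in> carrier_mat (fst W) (fst V)" "B \<in> carrier_mat (fst V) (fst W)"
    using assms(1) by (rule hmod_isoE)
  show ?thesis
    by (rule hmod_isoI[OF hmod_dual_hom[OF A(2) m(2,1)] hmod_dual_hom[OF A(1) m]])
      (simp_all add: transpose_mult[OF c(1,2), symmetric] transpose_mult[OF c(2,1), symmetric] A)
qed

lemma hmod_dual_sum:
  assumes A: "hmodule H A" and B: "hmodule H B"
  shows "hmod_iso (hmod_dual H (hmod_sum A B)) (hmod_sum (hmod_dual H A) (hmod_dual H B))"
proof -
  let ?M = "hmod_sum A B"
  obtain i p j q where b: "is_biproduct ?M A B i p j q" using hmod_sum_biproduct[OF A B] by blast
  note D = is_biproductD[OF b] and M = hmodule_sum[OF A B]
  note c = hmod_homD(1)[OF D(1)] hmod_homD(1)[OF D(2)] hmod_homD(1)[OF D(3)] hmod_homD(1)[OF D(4)]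
  have "p\<^sup>T * i\<^sup>T + q\<^sup>T * j\<^sup>T = (i * p + j * q)\<^sup>T"
    by (subst transpose_add[OF mult_carrier_mat[OF c(1,2)] mult_carrier_mat[OF c(3,4)]])
      (simp only: transpose_mult[OF c(1,2)] transpose_mult[OF c(3,4)])
  then have "is_biproduct (hmod_dual H ?M) (hmod_dual H A) (hmod_dual H B) p\<^sup>T i\<^sup>T q\<^sup>T j\<^sup>T"
    unfolding is_biproduct_def
    using hmod_dual_hom[OF D(1) A M] hmod_dual_hom[OF D(2) M A] hmod_dual_hom[OF D(3) B M] hmod_dual_hom[OF D(4) M B]
    by (simp add: transpose_mult[OF c(2,1), symmetric] transpose_mult[OF c(4,3), symmetric] D)
  then show ?thesis by (rule biproduct_iso_sum[where H = H]) (intro hmodule_dual M A B)+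
qed

end

section \<open>Splitting the trivial module\<close>

lemma mat_power_eq_zero_if_commuting_factor:
  fixes A N :: "'a::field mat"
  assumes A: "A \<in> carrier_mat n n" and N: "N \<in> carrier_mat n n" and "A * N = N * A" and "N ^\<^sub>m k = 0\<^sub>m n n"
  shows "(A * N) ^\<^sub>m k = 0\<^sub>m n n"
  using pow_mat_mult_commuting[OF A N assms(3), of k] right_mult_zero_mat[OF pow_carrier_mat[OF A]] assms(4) by simp

locale hopf_algebra_inner = hopf_algebra H
  for H :: "('k::field, 'h::ring_1, 'z) hopf_data_scheme" +
  fixes u v :: 'h
  assumes uv: "u * v = 1" and vu: "v * u = 1"
    and antipode_antipode: "antipode H (antipode H h) = u * h * v"
begin

lemma hmodule_unit:
  assumes V: "hmodule H V"
  shows "snd V u * snd V v = 1\<^sub>m (fst V)" "snd V v * snd V u = 1\<^sub>m (fst V)"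
  by (simp_all add: hmodule_mult[OF V, symmetric] uv vu hmodule_one[OF V])

text \<open>The two transpositions cancel, so \<open>h\<close> acts on the double dual as the square
  of the antipode at \<open>h\<close>, that is, by the matrix of \<open>h\<close> conjugated by that
  of \<open>u\<close>.\<close>

lemma double_dual_hom:
  assumes V: "hmodule H V"
  shows "snd V u \<in> hmod_hom V (hmod_dual H (hmod_dual H V))"
    and "snd V v \<in> hmod_hom (hmod_dual H (hmod_dual H V)) V"
proof -
  note c = hmodule_carrier[OF V]
  note [simp] = carrier_matD[OF c]
  have dd: "snd (hmod_dual H (hmod_dual H V)) h = snd V u * snd V h * snd V v" for h
    by (simp add: snd_hmod_dual antipode_antipode hmodule_mult[OF V])
  show "snd V u \<in> hmod_hom V (hmod_dual H (hmod_dual H V))"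
    using c by (intro hmod_homI) (simp_all add: dd mat_mult_assoc hmodule_unit[OF V])
  show "snd V v \<in> hmod_hom (hmod_dual H (hmod_dual H V)) V"
  proof (rule hmod_homI)
    fix h
    have "snd V v * snd (hmod_dual H (hmod_dual H V)) h = snd V v * snd V u * (snd V h * snd V v)"
      by (simp add: dd mat_mult_assoc)
    then show "snd V v * snd (hmod_dual H (hmod_dual H V)) h = snd V h * snd V v"
      by (simp add: hmodule_unit[OF V])
  qed (use c in simp)
qed

lemma double_dual_iso: "hmodule H V \<Longrightarrow> hmod_iso V (hmod_dual H (hmod_dual H V))"
  using double_dual_hom[of V] hmodule_unit[of V] by (intro hmod_isoI[of "snd V u" _ _ "snd V v"]) auto

text \<open>A decomposition of the dual dualizes to one of the double dual, which is isomorphic to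
  V.\<close>

lemma indecomposable_dual:
  assumes V: "indecomposable H V"
  shows "indecomposable H (hmod_dual H V)"
proof -
  note mV = indecomposableD(1)[OF V]
  have dec: "fst U = 0 \<or> fst W = 0" if U: "hmodule H U" and W: "hmodule H W"
    and iso: "hmod_iso (hmod_dual H V) (hmod_sum U W)" for U W
  proof -
    note m = hmodule_dual[OF mV] hmodule_sum[OF U W] hmodule_dual[OF U] hmodule_dual[OF W]
    have "hmod_iso V (hmod_dual H (hmod_sum U W))"
      by (rule hmod_iso_trans[OF double_dual_iso[OF mV] hmod_dual_cong[OF iso m(1,2)] mV hmodule_dual[OF m(1)] hmodule_dual[OF m(2)]])
    then have "hmod_iso V (hmod_sum (hmod_dual H U) (hmod_dual H W))"
      by (rule hmod_iso_trans[OF _ hmod_dual_sum[OF U W] mV hmodule_dual[OF m(2)] hmodule_sum[OF m(3,4)]])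
    then show ?thesis using indecomposableD(3)[OF V m(3,4)] by simp
  qed
  show ?thesis
    unfolding indecomposable_def fst_hmod_dual
  proof (intro conjI notI hmodule_dual[OF mV])
    show False if "fst V = 0" using that indecomposableD(2)[OF V] by simp
    assume "\<exists>U W. hmodule H U \<and> hmodule H W \<and> fst U \<noteq> 0 \<and> fst W \<noteq> 0 \<and> hmod_iso (hmod_dual H V) (hmod_sum U W)"
    then show False
    proof (elim exE conjE)
      fix U W assume "hmodule H U" "hmodule H W" "fst U \<noteq> 0" "fst W \<noteq> 0" "hmod_iso (hmod_dual H V) (hmod_sum U W)"
      then show False using dec[of U W] by simp
    qed
  qed
qed

text \<open>
  A splitting of \<open>k \<rightarrow> V \<otimes> W \<rightarrow> k\<close> amounts to \<open>F : V \<rightarrow> W\<^sup>*\<close> and \<open>G : W\<^sup>* \<rightarrow> V\<close> such that the trace of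
  \<open>F G\<close>, twisted by the action of \<open>u\<close>, is \<open>1\<close>.  As \<open>u\<close> commutes with \<open>F G\<close>, the latter is not nilpotent.
\<close>

lemma trivial_summand_tensor:
  assumes V: "indecomposable H V" and W: "indecomposable H W"
    and s: "hmod_summand (hmod_trivial H) (hmod_tensor H V W)"
  shows "hmod_iso W (hmod_dual H V)"
proof -
  let ?k = "hmod_trivial H" and ?W = "hmod_dual H W" and ?V = "hmod_dual H V"
  note mV = indecomposableD(1)[OF V] and mW = indecomposableD(1)[OF W]
  note mV' = hmodule_dual[OF mV] and mW' = hmodule_dual[OF mW]
  define n m where "n = fst V" and "m = fst W"
  obtain \<alpha> \<beta> where \<alpha>: "\<alpha> \<in> hmod_hom ?k (hmod_tensor H V W)" and \<beta>: "\<beta> \<in> hmod_hom (hmod_tensor H V W) ?k"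
    and \<beta>\<alpha>: "\<beta> * \<alpha> = 1\<^sub>m (fst ?k)"
    using s unfolding hmod_summand_def by blast
  obtain C where C: "C \<in> carrier_mat n m" "\<alpha> = vcol C"
    using vcol_surj[of \<alpha> n m] hmod_homD(1)[OF \<alpha>] by (auto simp: n_def m_def)
  obtain E where E: "E \<in> carrier_mat n m" "\<beta>\<^sup>T = vcol E"
    using vcol_surj[of "\<beta>\<^sup>T" n m] hmod_homD(1)[OF \<beta>] by (auto simp: n_def m_def)
  have \<beta>E: "\<beta> = (vcol E)\<^sup>T" using E(2) by (metis transpose_transpose)
  have F: "E\<^sup>T \<in> hmod_hom V ?W"
    using transpose_vcol_hom_iff[OF mW mV, of E] E(1) \<beta> \<beta>E by (simp add: n_def m_def)
  have "C\<^sup>T \<in> hmod_hom ?V W"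
    using vcol_hom_iff[OF mV mW, of C] C \<alpha> by (simp add: n_def m_def)
  then have "C \<in> hmod_hom ?W (hmod_dual H ?V)"
    using hmod_dual_hom[of "C\<^sup>T" ?V W] mV' mW by simp
  \<comment> \<open>\<open>C\<close> takes values in the double dual of V; the action of
    \<open>v\<close> brings them back to V.\<close>
  then have G: "snd V v * C \<in> hmod_hom ?W V"
    by (rule hmod_hom_comp[OF double_dual_hom(2)[OF mV] _ mW' hmodule_dual[OF mV'] mV])
  let ?N = "E\<^sup>T * (snd V v * C)"
  have N: "?N \<in> hmod_hom ?W ?W" by (rule hmod_hom_comp[OF F G mW' mV mW'])
  have c: "snd V h \<in> carrier_mat n n" "snd ?W h \<in> carrier_mat m m" for h
    using hmodule_carrier[OF mV] hmodule_carrier[OF mW'] by (simp_all add: n_def m_def)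
  note [simp] = carrier_matD[OF C(1)] carrier_matD[OF E(1)] carrier_matD[OF c(1)] carrier_matD[OF c(2)]
  \<comment> \<open>The scalar \<open>\<beta> * \<alpha>\<close> is the trace of the left side,
    which is not itself a module endomorphism. Inserting \<open>u * v = 1\<close> and pulling
    \<open>u\<close> through the homomorphism \<open>E\<^sup>T\<close> isolates the endomorphism
    \<open>?N\<close>.\<close>
  have EC: "E\<^sup>T * C = snd ?W u * ?N"
  proof -
    have "E\<^sup>T * C = E\<^sup>T * (snd V u * snd V v) * C"
      using hmodule_unit[OF mV] by (simp add: n_def[symmetric] right_mult_one_mat[of _ m n] carrier_matI)
    also have "\<dots> = E\<^sup>T * snd V u * (snd V v * C)" by (simp add: mat_mult_assoc)
    also have "\<dots> = snd ?W u * ?N" by (simp add: hmod_homD(2)[OF F] mat_mult_assoc)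
    finally show ?thesis .
  qed
  have not_nilpotent: "?N ^\<^sub>m k \<noteq> 0\<^sub>m m m" for k
  proof
    assume "?N ^\<^sub>m k = 0\<^sub>m m m"
    then have "(E\<^sup>T * C) ^\<^sub>m k = 0\<^sub>m m m"
      unfolding EC using hmod_homD[OF N] c(2)
      by (intro mat_power_eq_zero_if_commuting_factor[of "snd ?W u" m ?N k]) (simp_all add: m_def)
    then have "mat_trace (E\<^sup>T * C) = 0"
      by (intro mat_trace_nilpotent[of _ m]) (simp_all add: carrier_matI)
    then have "\<beta> * \<alpha> = 0 \<cdot>\<^sub>m 1\<^sub>m 1"
      unfolding \<beta>E C(2) using transpose_vcol_mult_vcol[OF E(1) C(1)] by simp
    then have "(1\<^sub>m 1 :: 'k mat) = 0 \<cdot>\<^sub>m 1\<^sub>m 1" using \<beta>\<alpha> by simp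
    then have "(1\<^sub>m 1 :: 'k mat) $$ (0, 0) = (0 \<cdot>\<^sub>m 1\<^sub>m 1) $$ (0, 0)" by metis
    then show False by simp
  qed
  then obtain \<psi> where \<psi>: "\<psi> \<in> hmod_hom ?W ?W" "\<psi> * ?N = 1\<^sub>m (fst ?W)"
    using indecomposable_endomorphism[OF indecomposable_dual[OF W] N] by (auto simp: m_def)
  \<comment> \<open>This exhibits the dual of W as a summand of the indecomposable V.\<close>
  have "\<psi> * E\<^sup>T * (snd V v * C) = 1\<^sub>m (fst ?W)"
    using \<psi>(2) hmod_homD(1)[OF \<psi>(1)] by (simp add: mat_mult_assoc m_def)
  then have "hmod_iso ?W V"
    using indecomposableD(2)[OF W]
    by (intro summand_of_indecomposable[OF V mW' _ G hmod_hom_comp[OF \<psi>(1) F mV mW' mW']]) auto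
  then have "hmod_iso (hmod_dual H ?W) ?V" by (rule hmod_dual_cong[OF _ mW' mV])
  then show ?thesis
    by (rule hmod_iso_trans[OF double_dual_iso[OF mW] _ mW hmodule_dual[OF mW'] mV'])
qed

text \<open>
  The two embeddings \<open>coev \<otimes> V\<close>, \<open>V \<otimes> coev'\<close> of \<open>V\<close> into \<open>V \<otimes> V\<^sup>* \<otimes> V\<close> and the two projections
  \<open>V \<otimes> ev\<close>, \<open>ev' \<otimes> V\<close> pair to a matrix with diagonal entries \<open>1\<close>; if \<open>k\<close> is not a summand of
  \<open>V \<otimes> V\<^sup>*\<close>, then the entry \<open>(ev' \<otimes> V) (coev \<otimes> V)\<close> vanishes.
\<close>

lemma double_summand:
  assumes V: "hmodule H V" and no: "\<not> hmod_summand (hmod_trivial H) (hmod_tensor H V (hmod_dual H V))"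
  shows "\<exists>W. hmodule H W \<and>
    hmod_iso (hmod_tensor H (hmod_tensor H V (hmod_dual H V)) V) (hmod_sum V (hmod_sum V W))"
proof -
  let ?k = "hmod_trivial H" and ?V = "hmod_dual H V"
  define n where "n = fst V"
  note V' = hmodule_dual[OF V] and VV' = hmodule_tensor[OF V hmodule_dual[OF V]]
    and V'V = hmodule_tensor[OF hmodule_dual[OF V] V]
  define M where "M = hmod_tensor H (hmod_tensor H V ?V) V"
  have M: "hmodule H M" unfolding M_def by (rule hmodule_tensor[OF VV' V])
  have M': "M = hmod_tensor H V (hmod_tensor H ?V V)"
    unfolding M_def by (rule hmod_tensor_assoc[OF V V' V])
  have c: "snd V h \<in> carrier_mat n n" for h using hmodule_carrier[OF V] by (simp add: n_def)
  note [simp] = carrier_matD[OF c]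
  let ?I = "1\<^sub>m n :: 'k mat"
  have I: "?I \<in> hmod_hom V V" using hmod_hom_one[OF V] by (simp add: n_def)
  have co: "vcol ?I \<in> hmod_hom ?k (hmod_tensor H V ?V)"
    using coevaluation_hom[OF V] by (simp add: n_def)
  have ev: "(vcol ?I)\<^sup>T \<in> hmod_hom (hmod_tensor H ?V V) ?k"
    using evaluation_hom[OF V] by (simp add: n_def)
  \<comment> \<open>The duality maps of the dual module involve its own dual. \<open>?C\<close> and
    \<open>?E\<close> encode the coevaluation and the evaluation after the double dual has been
    replaced by V through \<open>v\<close> and \<open>u\<close>.\<close>
  let ?C = "(snd V v)\<^sup>T" and ?E = "(snd V u)\<^sup>T"
  have co': "vcol ?C \<in> hmod_hom ?k (hmod_tensor H ?V V)"
    using vcol_hom_iff[OF V' V, of ?C] double_dual_hom(2)[OF V] c by (simp add: n_def)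
  have ev': "(vcol ?E)\<^sup>T \<in> hmod_hom (hmod_tensor H V ?V) ?k"
    using transpose_vcol_hom_iff[OF V' V, of ?E] double_dual_hom(1)[OF V] c by (simp add: n_def)
  define f g f' g' where "f = kronecker (vcol ?I) ?I" and "g = kronecker ?I (vcol ?I)\<^sup>T"
    and "f' = kronecker ?I (vcol ?C)" and "g' = kronecker (vcol ?E)\<^sup>T ?I"
  have f: "f \<in> hmod_hom V M" and g': "g' \<in> hmod_hom M V"
    using hmod_tensor_hom[OF co I hmodule_trivial VV' V V] hmod_tensor_hom[OF ev' I VV' hmodule_trivial V V]
    by (simp_all add: f_def g'_def M_def hmod_tensor_trivial_left V)
  have f': "f' \<in> hmod_hom V M" and g: "g \<in> hmod_hom M V"
    using hmod_tensor_hom[OF I co' V V hmodule_trivial V'V] hmod_tensor_hom[OF I ev V V V'V hmodule_trivial]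
    by (simp_all add: f'_def g_def M' hmod_tensor_trivial_right V)
  note hc = hmod_homD(1)[OF f] hmod_homD(1)[OF g] hmod_homD(1)[OF f'] hmod_homD(1)[OF g']
  note [simp] = carrier_matD[OF hc(1), folded n_def] carrier_matD[OF hc(2), folded n_def]
    carrier_matD[OF hc(3), folded n_def] carrier_matD[OF hc(4), folded n_def]
  have gf: "g * f = ?I" unfolding g_def f_def by (subst zigzag[of _ n n]) auto
  have g'f': "g' * f' = ?I"
  proof -
    have ct: "?E \<in> carrier_mat n n" "?C \<in> carrier_mat n n" using c by auto
    have "g' * f' = (?E * ?C)\<^sup>T" unfolding g'_def f'_def by (rule zigzag_transpose[OF ct])
    also have "\<dots> = snd V v * snd V u" using transpose_mult[OF ct] by simp
    finally show ?thesis using hmodule_unit[OF V] by (simp add: n_def)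
  qed
  \<comment> \<open>A nonzero value could be rescaled to 1, and the trivial module would split
    off.\<close>
  have pairing: "(vcol ?E)\<^sup>T * vcol ?I = 0\<^sub>m 1 1"
  proof (rule ccontr)
    let ?P = "(vcol ?E)\<^sup>T * vcol ?I"
    assume "?P \<noteq> 0\<^sub>m 1 1"
    moreover have P: "?P \<in> carrier_mat 1 1" by (rule carrier_matI) auto
    ultimately have nz: "?P $$ (0, 0) \<noteq> 0" by (auto intro!: eq_matI)
    have "(inverse (?P $$ (0, 0)) \<cdot>\<^sub>m (vcol ?E)\<^sup>T) * vcol ?I = inverse (?P $$ (0, 0)) \<cdot>\<^sub>m ?P"
      by (rule mult_smult_assoc_mat[of _ 1 "n * n" _ 1]) (auto simp: carrier_matI)
    also have "\<dots> = 1\<^sub>m 1"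
    proof (rule eq_matI)
      fix i j assume "i < dim_row (1\<^sub>m 1 :: 'k mat)" "j < dim_col (1\<^sub>m 1 :: 'k mat)"
      then have "i = 0" "j = 0" by auto
      with nz P show "(inverse (?P $$ (0, 0)) \<cdot>\<^sub>m ?P) $$ (i, j) = (1\<^sub>m 1 :: 'k mat) $$ (i, j)"
        by (simp del: index_mult_mat)
    qed auto
    finally have "hmod_summand ?k (hmod_tensor H V ?V)"
      by (intro hmod_summandI[OF co hmod_hom_smult[OF ev' VV' hmodule_trivial]]) simp
    with no show False by simp
  qed
  have g'f: "g' * f = 0\<^sub>m n n"
  proof -
    have "g' * f = kronecker ((vcol ?E)\<^sup>T * vcol ?I) (?I * ?I)"
      unfolding g'_def f_def by (rule kronecker_mult) auto
    then show ?thesis unfolding pairing by (simp add: kronecker_zero_left)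
  qed
  \<comment> \<open>Removes the component of \<open>f'\<close> along \<open>f\<close>, so that
    \<open>g * f''\<close> vanishes. The value under \<open>g'\<close> stays the identity since
    \<open>g' * f\<close> is zero.\<close>
  define f'' where "f'' = f' - f * (g * f')"
  have f'': "f'' \<in> hmod_hom V M"
    unfolding f''_def
    by (rule hmod_hom_diff[OF f' hmod_hom_comp[OF f hmod_hom_comp[OF g f' V M V] V V M] V M])
  note [simp] = carrier_matD[OF hmod_homD(1)[OF f''], folded n_def]
  have gf'': "g * f'' = 0\<^sub>m n n"
  proof -
    have "g * f'' = g * f' - g * f * (g * f')"
      unfolding f''_def by (simp add: mat_mult_diff mat_mult_assoc)
    then show ?thesis by (simp add: gf minus_r_inv_mat[of _ n n] carrier_matI)
  qed
  have g'f'': "g' * f'' = ?I"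
  proof -
    have "g' * f'' = g' * f' - g' * f * (g * f')"
      unfolding f''_def by (simp add: mat_mult_diff mat_mult_assoc)
    then show ?thesis by (auto simp: g'f' g'f intro!: eq_matI)
  qed
  obtain U j q where U: "hmodule H U" and b: "is_biproduct M V U f g j q"
    using split_mono_complement[OF M V f g gf[unfolded n_def]] by blast
  note D = is_biproductD[OF b]
  note [simp] = is_biproduct_dims[OF b, folded n_def]
  have jq: "g' * j \<in> hmod_hom U V" "q * f'' \<in> hmod_hom V U"
    by (rule hmod_hom_comp[OF g' D(3) U M V], rule hmod_hom_comp[OF D(4) f'' V M U])
  \<comment> \<open>With the identity of M inserted between \<open>g'\<close> and
    \<open>f''\<close>, the part through the first copy of V vanishes. The second copy therefore
    splits off from the complement U.\<close>
  have "g' * (f * g + j * q) * f'' = g' * f * (g * f'') + g' * j * (q * f'')"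
    by (simp add: mat_mult_add mat_add_mult mat_mult_assoc)
  then have gj: "g' * j * (q * f'') = ?I"
    by (simp add: D(7) g'f'' g'f gf'' carrier_matI left_add_zero_mat[of _ n n])
  obtain W j' q' where W: "hmodule H W" and b': "is_biproduct U V W (q * f'') (g' * j) j' q'"
    using split_mono_complement[OF U V jq(2,1) gj[unfolded n_def]] by blast
  have "hmod_iso M (hmod_sum V U)" by (rule biproduct_iso_sum[OF b M V U])
  moreover have "hmod_iso (hmod_sum V U) (hmod_sum V (hmod_sum V W))"
    by (rule hmod_sum_cong[OF hmod_iso_refl[OF V] biproduct_iso_sum[OF b' U V W] V U V hmodule_sum[OF V W]])
  ultimately have "hmod_iso M (hmod_sum V (hmod_sum V W))"
    by (rule hmod_iso_trans[OF _ _ M hmodule_sum[OF V U] hmodule_sum[OF V hmodule_sum[OF V W]]])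
  with W show ?thesis unfolding M_def by blast
qed

end

section \<open>The regular module\<close>

context hopf_algebra
begin

text \<open>Tensoring a module with \<open>trivial_power m\<close> yields the sum of m copies of it.
  Free modules thereby take the form of tensor products, with the same underlying space as H
  \<otimes> V.\<close>

definition trivial_power :: "nat \<Rightarrow> ('k, 'h) hmod" where
  "trivial_power m = (m, \<lambda>h. counit H h \<cdot>\<^sub>m 1\<^sub>m m)"

lemma fst_trivial_power [simp]: "fst (trivial_power m) = m"
  and snd_trivial_power: "snd (trivial_power m) h = counit H h \<cdot>\<^sub>m 1\<^sub>m m"
  by (simp_all add: trivial_power_def)

lemma hmodule_trivial_power: "hmodule H (trivial_power m)"
proof (rule hmoduleI)
  show "lin (fst (trivial_power m)) (fst (trivial_power m)) (snd (trivial_power m))"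
    unfolding snd_trivial_power[abs_def] by (intro lin_counit) simp
  show "snd (trivial_power m) (g * h) = snd (trivial_power m) g * snd (trivial_power m) h" for g h
    using mult_smult_assoc_mat[of "1\<^sub>m m" m m "counit H h \<cdot>\<^sub>m 1\<^sub>m m" m "counit H g"]
    by (auto simp: snd_trivial_power counit_mult intro!: eq_matI)
qed (simp add: snd_trivial_power counit_one)

lemma trivial_power_Suc: "trivial_power (Suc m) = hmod_sum (hmod_trivial H) (trivial_power m)"
proof (rule prod_eqI)
  have "snd (trivial_power (Suc m)) h = snd (hmod_sum (hmod_trivial H) (trivial_power m)) h" for h
    by (rule eq_matI) (auto simp: snd_trivial_power snd_hmod_sum snd_hmod_trivial)
  then show "snd (trivial_power (Suc m)) = snd (hmod_sum (hmod_trivial H) (trivial_power m))" by blast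
qed simp

end

text \<open>H as a left module over itself, seen through a fixed coordinate map
  \<open>\<phi>\<close>.\<close>

locale regular_module = hopf_algebra H
  for H :: "('k::field, 'h::ring_1, 'z) hopf_data_scheme" +
  fixes n :: nat and \<rho> :: "'h \<Rightarrow> 'k mat" and \<phi> :: "'h \<Rightarrow> 'k vec"
  assumes regular: "hmodule H (n, \<rho>)"
    and \<phi>_bij: "bij_betw \<phi> UNIV (carrier_vec n)"
    and \<phi>_add: "\<phi> (g + h) = \<phi> g + \<phi> h"
    and \<phi>_scale: "\<phi> (hscale H c h) = c \<cdot>\<^sub>v \<phi> h"
    and \<phi>_mult: "\<phi> (g * h) = \<rho> g *\<^sub>v \<phi> h"
begin

text \<open>Coordinates as a one-column matrix, so that Kronecker products can be formed with
  them.\<close>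

definition coord :: "'h \<Rightarrow> 'k mat" where
  "coord h = mat n 1 (\<lambda>(i, _). \<phi> h $ i)"

definition basis_elem :: "nat \<Rightarrow> 'h" where
  "basis_elem j = inv_into UNIV \<phi> (unit_vec n j)"

lemma \<phi>_carrier: "\<phi> h \<in> carrier_vec n"
  using \<phi>_bij by (auto simp: bij_betw_def)

lemma \<rho>_carrier: "\<rho> h \<in> carrier_mat n n"
  using hmodule_carrier[OF regular] by simp

lemma \<rho>_lin: "lin n n \<rho>"
  using hmodule_linear[OF regular] by simp

lemma coord_carrier: "coord h \<in> carrier_mat n 1"
  by (simp add: coord_def)

lemma coord_lin: "lin n 1 coord"
  using carrier_vecD[OF \<phi>_carrier] by (auto simp: mat_linear_def coord_def \<phi>_add \<phi>_scale intro!: eq_matI)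

lemma coord_mult: "coord (g * h) = \<rho> g * coord h"
proof -
  note [simp] = carrier_matD[OF \<rho>_carrier] carrier_vecD[OF \<phi>_carrier]
  show ?thesis by (rule eq_matI) (auto simp: coord_def \<phi>_mult scalar_prod_def)
qed

lemma \<phi>_basis_elem: "\<phi> (basis_elem j) = unit_vec n j"
  unfolding basis_elem_def using \<phi>_bij by (intro f_inv_into_f) (auto simp: bij_betw_def)

lemma basis_expansion: "h = (\<Sum>j = 0..<n. hscale H (\<phi> h $ j) (basis_elem j))"
proof -
  have "\<phi> 0 = 0 \<cdot>\<^sub>v \<phi> 0" using \<phi>_scale[of 0 0] by simp
  also have "\<dots> = 0\<^sub>v n" using carrier_vecD[OF \<phi>_carrier[of 0]] by (intro eq_vecI) auto
  finally have 0: "\<phi> 0 = 0\<^sub>v n" .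
  have "\<phi> (\<Sum>j\<in>J. hscale H (a j) (basis_elem j)) $ i = (\<Sum>j\<in>J. a j * unit_vec n j $ i)"
    if "finite J" "i < n" for a J i
    using that carrier_vecD[OF \<phi>_carrier]
    by (induction J rule: finite_induct) (simp_all add: 0 \<phi>_add \<phi>_scale \<phi>_basis_elem)
  then have "\<phi> (\<Sum>j = 0..<n. hscale H (\<phi> h $ j) (basis_elem j)) $ i = \<phi> h $ i" if "i < n" for i
    using that by (simp add: unit_vec_def if_distrib cong: if_cong)
  then have "\<phi> h = \<phi> (\<Sum>j = 0..<n. hscale H (\<phi> h $ j) (basis_elem j))"
    using carrier_vecD[OF \<phi>_carrier] by (intro eq_vecI) auto
  then show ?thesis using \<phi>_bij by (auto simp: bij_betw_def inj_def)
qed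

text \<open>\<open>kronecker (coord h) (1\<^sub>m m)\<close> is the map y -> h \<otimes> y. A linear
  map on the tensor product is thus specified by a linear family \<open>T\<close>, and its columns
  are read off at the basis of H.\<close>

lemma extend_from_coord:
  assumes T: "lin r m T"
  obtains \<Theta> where "\<Theta> \<in> carrier_mat r (n * m)" "\<And>h. \<Theta> * kronecker (coord h) (1\<^sub>m m) = T h"
proof -
  define \<Theta> where "\<Theta> = mat r (n * m) (\<lambda>(x, y). T (basis_elem (y div m)) $$ (x, y mod m))"
  have "\<Theta> * kronecker (coord h) (1\<^sub>m m) = T h" for h
  proof (rule eq_matI)
    fix x z assume "x < dim_row (T h)" "z < dim_col (T h)"
    then have xz: "x < r" "z < m" using mat_linearD(1)[OF T, of h] by auto
    let ?f = "\<lambda>j k. T (basis_elem j) $$ (x, k) * (\<phi> h $ j * (if k = z then 1 else 0))"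
    have "(\<Theta> * kronecker (coord h) (1\<^sub>m m)) $$ (x, z) = (\<Sum>y = 0..<n * m. ?f (y div m) (y mod m))"
      using xz carrier_matD[OF coord_carrier]
      by (auto simp: \<Theta>_def scalar_prod_def kronecker_index div_mod_bounds coord_def intro!: sum.cong)
    also have "\<dots> = (\<Sum>j = 0..<n. \<Sum>k = 0..<m. ?f j k)" by (rule sum_div_mod)
    also have "\<dots> = (\<Sum>j = 0..<n. \<phi> h $ j * T (basis_elem j) $$ (x, z))"
      using xz by (intro sum.cong refl) (simp add: if_distrib mult.commute cong: if_cong)
    also have "\<dots> = T h $$ (x, z)"
      using xz by (subst (2) basis_expansion[of h]) (simp add: lin_sum[OF T] mat_lincomb_def)
    finally show "(\<Theta> * kronecker (coord h) (1\<^sub>m m)) $$ (x, z) = T h $$ (x, z)" .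
  qed (use mat_linearD(1)[OF T, of h] in \<open>auto simp: \<Theta>_def carrier_matD[OF coord_carrier]\<close>)
  then show thesis using that[of \<Theta>] by (simp add: \<Theta>_def)
qed

text \<open>The matching uniqueness: the vectors h \<otimes> y span the tensor product.\<close>

lemma eq_if_eq_on_coord:
  assumes A: "A \<in> carrier_mat r (n * m)" and B: "B \<in> carrier_mat r (n * m)"
    and eq: "\<And>h. A * kronecker (coord h) (1\<^sub>m m) = B * kronecker (coord h) (1\<^sub>m m)"
  shows "A = B"
proof (rule eq_matI)
  have *: "(M * kronecker (coord (basis_elem j)) (1\<^sub>m m)) $$ (x, z) = M $$ (x, j * m + z)"
    if M: "M \<in> carrier_mat r (n * m)" and x: "x < r" and j: "j < n" and z: "z < m" for M x j z
  proof -
    let ?f = "\<lambda>i k. M $$ (x, i * m + k) * ((if i = j then 1 else 0) * (if k = z then 1 else 0))"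
    have "(M * kronecker (coord (basis_elem j)) (1\<^sub>m m)) $$ (x, z) = (\<Sum>y = 0..<n * m. ?f (y div m) (y mod m))"
      using M x j z carrier_matD[OF coord_carrier]
      by (auto simp: scalar_prod_def kronecker_index div_mod_bounds coord_def \<phi>_basis_elem intro!: sum.cong)
    also have "\<dots> = (\<Sum>i = 0..<n. \<Sum>k = 0..<m. ?f i k)" by (rule sum_div_mod)
    also have "\<dots> = (\<Sum>i = 0..<n. if i = j then M $$ (x, j * m + z) else 0)"
      using z by (intro sum.cong refl) (simp add: if_distrib cong: if_cong)
    finally show ?thesis using j by simp
  qed
  fix x y assume "x < dim_row B" "y < dim_col B"
  then have xy: "x < r" "y < n * m" using B by auto
  note b = div_mod_bounds[OF xy(2)]
  show "A $$ (x, y) = B $$ (x, y)"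
    using *[OF A xy(1) b] *[OF B xy(1) b] eq[of "basis_elem (y div m)"] by simp
qed (use A B in auto)

text \<open>The isomorphism maps \<open>h \<otimes> x\<close> to \<open>h\<^sub>1 \<otimes> h\<^sub>2 x\<close>; its inverse maps it to \<open>h\<^sub>1 \<otimes> S(h\<^sub>2) x\<close>.\<close>

lemma regular_tensor_iso:
  assumes V: "hmodule H V"
  shows "hmod_iso (hmod_tensor H (n, \<rho>) (trivial_power (fst V))) (hmod_tensor H (n, \<rho>) V)"
proof -
  define m \<sigma> where "m = fst V" and "\<sigma> = snd V"
  let ?S = "antipode H"
  have \<sigma>: "lin m m \<sigma>" using hmodule_linear[OF V] by (simp add: m_def \<sigma>_def)
  note c = \<rho>_carrier mat_linearD(1)[OF \<sigma>] coord_carrier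
  note [simp] = carrier_matD[OF c(1)] carrier_matD[OF c(2)] carrier_matD[OF c(3)]
  note kc = kronecker_carrier[OF c(3) c(2), simplified] kronecker_carrier[OF c(1) c(2)]
  define T T' where "T = sw (n * m) m (\<lambda>a b. kronecker (coord a) (\<sigma> b))"
    and "T' = sw (n * m) m (\<lambda>a b. kronecker (coord a) (\<sigma> (?S b)))"
  have l1: "lin (n * m) m (\<lambda>a. kronecker (coord a) B)" if "B \<in> carrier_mat m m" for B
    using mat_linear_kronecker_left[OF coord_lin that] by simp
  have l2: "lin (n * m) m (\<lambda>a. kronecker (coord h) (F a))" if "lin m m F" for F h
    using mat_linear_kronecker_right[OF that coord_carrier] by simp
  have T: "lin (n * m) m T" unfolding T_def by (intro lin_sw l1 l2 \<sigma> c)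
  have T': "lin (n * m) m T'" unfolding T'_def by (intro lin_sw l1 l2 lin_antipode \<sigma> c)
  obtain \<Theta> where \<Theta>: "\<Theta> \<in> carrier_mat (n * m) (n * m)" "\<And>h. \<Theta> * kronecker (coord h) (1\<^sub>m m) = T h"
    using extend_from_coord[OF T] by blast
  obtain \<Theta>' where \<Theta>': "\<Theta>' \<in> carrier_mat (n * m) (n * m)" "\<And>h. \<Theta>' * kronecker (coord h) (1\<^sub>m m) = T' h"
    using extend_from_coord[OF T'] by blast
  note [simp] = carrier_matD[OF \<Theta>(1)] carrier_matD[OF \<Theta>'(1)] carrier_matD[OF mat_linearD(1)[OF T]]
  \<comment> \<open>After coassociativity the last two legs of the coproduct meet as S(p) q and
    collapse. Only this composite is computed; the opposite one follows because the matrices are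
    square.\<close>
  have inv: "\<Theta>' * \<Theta> = 1\<^sub>m (n * m)"
  proof (rule eq_if_eq_on_coord)
    fix h
    have "\<Theta>' * \<Theta> * kronecker (coord h) (1\<^sub>m m) = \<Theta>' * T h"
      by (simp add: mat_mult_assoc \<Theta>(2))
    also have "\<dots> = sw (n * m) m (\<lambda>a b. \<Theta>' * kronecker (coord a) (\<sigma> b)) h"
      unfolding T_def by (rule sw_mult_left[OF kc(1) \<Theta>'(1)])
    also have "\<dots> = sw (n * m) m (\<lambda>a b. sw (n * m) m (\<lambda>p q. kronecker (coord p) (\<sigma> (?S q) * \<sigma> b)) a) h"
    proof -
      have "\<Theta>' * kronecker (coord a) (\<sigma> b) = sw (n * m) m (\<lambda>p q. kronecker (coord p) (\<sigma> (?S q) * \<sigma> b)) a" for a b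
      proof -
        have split: "kronecker (coord a) X * \<sigma> b = kronecker (coord a) (X * \<sigma> b)" if "X \<in> carrier_mat m m" for X a
          using kronecker_mult[of "coord a" "1\<^sub>m 1" X "\<sigma> b"] that by simp
        have "\<Theta>' * kronecker (coord a) (\<sigma> b) = \<Theta>' * kronecker (coord a) (1\<^sub>m m) * \<sigma> b"
          using split[of "1\<^sub>m m" a] by (simp add: mat_mult_assoc)
        also have "\<dots> = sw (n * m) m (\<lambda>p q. kronecker (coord p) (\<sigma> (?S q)) * \<sigma> b) a"
          unfolding \<Theta>'(2) T'_def by (rule sw_mult_right[OF kc(1) c(2)])
        finally show ?thesis by (simp add: split c)
      qed
      then show ?thesis by simp
    qed
    also have "\<dots> = sw (n * m) m (\<lambda>a b. sw (n * m) m (\<lambda>p q. kronecker (coord a) (\<sigma> (?S p) * \<sigma> q)) b) h"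
      by (rule sw_coassoc) (intro l1 l2 mat_linear_mult_right[where c = m] mat_linear_mult_left[where c = m]
          lin_antipode \<sigma> c mult_carrier_mat[OF c(2) c(2)])+
    also have "\<dots> = sw (n * m) m (\<lambda>a b. counit H b \<cdot>\<^sub>m kronecker (coord a) (1\<^sub>m m)) h"
    proof -
      have "sw (n * m) m (\<lambda>p q. kronecker (coord a) (\<sigma> (?S p) * \<sigma> q)) b = counit H b \<cdot>\<^sub>m kronecker (coord a) (1\<^sub>m m)" for a b
        using sw_antipode_left[OF l2[OF \<sigma>], of a b] hmodule_mult[OF V] hmodule_one[OF V]
        by (simp add: \<sigma>_def m_def)
      then show ?thesis by simp
    qed
    also have "\<dots> = kronecker (coord h) (1\<^sub>m m)" by (rule sw_counit_right) (intro l1 one_carrier_mat)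
    also have "\<dots> = 1\<^sub>m (n * m) * kronecker (coord h) (1\<^sub>m m)" by simp
    finally show "\<Theta>' * \<Theta> * kronecker (coord h) (1\<^sub>m m) = 1\<^sub>m (n * m) * kronecker (coord h) (1\<^sub>m m)" .
  qed (use \<Theta> \<Theta>' in auto)
  let ?P = "hmod_tensor H (n, \<rho>) (trivial_power m)" and ?Q = "hmod_tensor H (n, \<rho>) V"
  have P: "hmodule H ?P" and Q: "hmodule H ?Q" by (intro hmodule_tensor regular hmodule_trivial_power V)+
  have actP: "snd ?P g = kronecker (\<rho> g) (1\<^sub>m m)" for g
  proof -
    have "snd ?P g = sw (n * m) (n * m) (\<lambda>a b. counit H b \<cdot>\<^sub>m kronecker (\<rho> a) (1\<^sub>m m)) g"
      by (simp add: snd_hmod_tensor snd_trivial_power kronecker_smult_right)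
    also have "\<dots> = kronecker (\<rho> g) (1\<^sub>m m)"
      by (rule sw_counit_right) (intro mat_linear_kronecker_left \<rho>_lin one_carrier_mat)
    finally show ?thesis .
  qed
  have actQ: "snd ?Q g = sw (n * m) (n * m) (\<lambda>a b. kronecker (\<rho> a) (\<sigma> b)) g" for g
    by (simp add: snd_hmod_tensor m_def \<sigma>_def)
  have hom: "\<Theta> \<in> hmod_hom ?P ?Q"
  proof (rule hmod_homI)
    show "\<Theta> \<in> carrier_mat (fst ?Q) (fst ?P)" using \<Theta>(1) by (simp add: m_def)
    fix g
    note [simp] = carrier_matD[OF hmodule_carrier[OF Q], simplified, folded m_def]
    show "\<Theta> * snd ?P g = snd ?Q g * \<Theta>"
    proof (rule eq_if_eq_on_coord[of _ "n * m"])
      fix h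
      have "\<Theta> * snd ?P g * kronecker (coord h) (1\<^sub>m m) = \<Theta> * kronecker (coord (g * h)) (1\<^sub>m m)"
        by (simp add: actP mat_mult_assoc kronecker_mult coord_mult)
      also have "\<dots> = T (g * h)" by (rule \<Theta>(2))
      also have "\<dots> = sw (n * m) m (\<lambda>a b. sw (n * m) m (\<lambda>a' b'. kronecker (coord (a * a')) (\<sigma> (b * b'))) h) g"
        unfolding T_def by (rule sw_mult; intro l1 l2 \<sigma> c)
      also have "\<dots> = sw (n * m) m (\<lambda>a b. sw (n * m) m (\<lambda>a' b'. kronecker (\<rho> a) (\<sigma> b) * kronecker (coord a') (\<sigma> b')) h) g"
        using hmodule_mult[OF V, folded \<sigma>_def] by (simp add: coord_mult kronecker_mult)
      also have "\<dots> = sw (n * m) m (\<lambda>a b. kronecker (\<rho> a) (\<sigma> b) * T h) g"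
        unfolding T_def by (simp only: sw_mult_left[OF kc(1) kc(2)])
      also have "\<dots> = snd ?Q g * T h"
        unfolding actQ by (rule sw_mult_right[symmetric, OF kc(2) mat_linearD(1)[OF T]])
      also have "\<dots> = snd ?Q g * \<Theta> * kronecker (coord h) (1\<^sub>m m)"
        by (simp add: \<Theta>(2)[symmetric] mat_mult_assoc del: \<Theta>(2))
      finally show "\<Theta> * snd ?P g * kronecker (coord h) (1\<^sub>m m) = snd ?Q g * \<Theta> * kronecker (coord h) (1\<^sub>m m)" .
    qed (use \<Theta>(1) in \<open>simp_all add: carrier_matI actP\<close>)
  qed
  have "hmod_iso ?P ?Q"
    using \<Theta>'(1) inv left_inverse_imp_right_inverse[OF \<Theta>(1) \<Theta>'(1) inv]
    by (intro hmod_isoI_inverse[OF hom _ _ _ P Q]) (simp_all add: m_def)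
  then show ?thesis by (simp add: m_def)
qed

end

section \<open>The Green ring\<close>

lemma lookup_sum_list_frag_of: "Poly_Mapping.lookup (sum_list (map frag_of cs)) c = int (count_list cs c)"
  by (induction cs) (auto simp: lookup_add)

lemma frag_extend_diff_fun: "frag_extend (\<lambda>X. f X - g X) x = frag_extend f x - frag_extend g x"
proof -
  have "Poly_Mapping.keys x \<subseteq> UNIV" by simp
  then show ?thesis by (induction x rule: frag_induction) (simp_all add: frag_extend_diff)
qed

lemma hmod_summand_sum_right:
  assumes X: "hmod_summand X B" and m: "hmodule H X" "hmodule H A" "hmodule H B"
  shows "hmod_summand X (hmod_sum A B)"
proof -
  obtain f g where f: "f \<in> hmod_hom X B" and g: "g \<in> hmod_hom B X" and gf: "g * f = 1\<^sub>m (fst X)"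
    using X unfolding hmod_summand_def by blast
  obtain i p j q where b: "is_biproduct (hmod_sum A B) A B i p j q" using hmod_sum_biproduct[OF m(2,3)] by blast
  note D = is_biproductD[OF b] and M = hmodule_sum[OF m(2,3)]
  note c = hmod_homD(1)[OF f] hmod_homD(1)[OF g]
  note [simp] = is_biproduct_dims[OF b, simplified] carrier_matD[OF c(1)] carrier_matD[OF c(2)]
  have "g * q * (j * f) = g * (q * j) * f" by (simp add: mat_mult_assoc)
  then have "g * q * (j * f) = 1\<^sub>m (fst X)" by (simp add: D(6) gf)
  then show ?thesis
    by (rule hmod_summandI[OF hmod_hom_comp[OF D(3) f m(1,3) M] hmod_hom_comp[OF g D(4) M m(3,1)]])
qed

lemma hmod_summand_sum_list:
  assumes "X \<in> set Xs" "\<And>Y. Y \<in> set Xs \<Longrightarrow> hmodule H Y"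
  shows "hmod_summand X (hmod_sum_list Xs)"
  using assms
proof (induction Xs)
  case (Cons Y Ys)
  have mY: "hmodule H Y" and mX: "hmodule H X" and mYs: "hmodule H (hmod_sum_list Ys)"
    using Cons.prems hmodule_sum_list[of Ys H] by auto
  show ?case
  proof (cases "X = Y")
    case True
    then show ?thesis using hmod_summand_sum_left[OF mY mYs] by simp
  next
    case False
    with Cons have "hmod_summand X (hmod_sum_list Ys)" by simp
    then show ?thesis using hmod_summand_sum_right[OF _ mX mY mYs] by simp
  qed
qed simp

lemma indec_classes_subset: "indec_classes H \<subseteq> iso_classes H"
  unfolding indec_classes_def iso_classes_def using indecomposableD(1) by blast

lemma add_monoid_free_green_ring: "add_monoid (free_green_ring H) = free_Abelian_group (iso_classes H)"
  by (simp add: free_green_ring_def free_Abelian_group_def)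

lemma carrier_free_green_ring: "x \<in> carrier (free_green_ring H) \<longleftrightarrow> Poly_Mapping.keys x \<subseteq> iso_classes H"
  by (simp add: free_green_ring_def)

text \<open>Reduces additive statements about the free abelian group to classes of single
  modules.\<close>

lemma frag_iso_class_induct [consumes 1, case_names zero iso_class diff]:
  assumes "Poly_Mapping.keys x \<subseteq> iso_classes H" "P 0" "\<And>V. hmodule H V \<Longrightarrow> P (frag_of (iso_class H V))"
    and "\<And>a b. P a \<Longrightarrow> P b \<Longrightarrow> P (a - b)"
  shows "P x"
  using assms(1)
proof (induction x rule: frag_induction)
  case (one X)
  then show ?case using assms(3) by (auto simp: iso_classes_def)
qed (use assms in auto)

section \<open>Operations on isomorphism classes\<close>

context hopf_algebra
begin

abbreviation cl :: "('k, 'h) hmod \<Rightarrow> ('k, 'h) hclass" where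
  "cl \<equiv> iso_class H"

lemma cl_self: "hmodule H V \<Longrightarrow> V \<in> cl V"
  by (simp add: iso_class_def hmod_iso_refl)

lemma mem_cl: "W \<in> cl V \<longleftrightarrow> hmodule H W \<and> hmod_iso V W"
  by (simp add: iso_class_def)

lemma cl_eqI: "hmodule H V \<Longrightarrow> hmodule H W \<Longrightarrow> hmod_iso V W \<Longrightarrow> cl V = cl W"
  using iso_class_eq_iff by blast

lemma some_mem_cl:
  assumes "hmodule H V"
  shows "hmodule H (SOME W. W \<in> cl V)" "hmod_iso V (SOME W. W \<in> cl V)"
  using someI[of "\<lambda>W. W \<in> cl V", OF cl_self[OF assms]] by (simp_all add: mem_cl)

lemma cl_in_iso_classes: "hmodule H V \<Longrightarrow> cl V \<in> iso_classes H"
  unfolding iso_classes_def by blast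

lemma cl_in_indec_classes: "indecomposable H V \<Longrightarrow> cl V \<in> indec_classes H"
  unfolding indec_classes_def by blast

text \<open>Tensor products respect isomorphism, so the union defining \<open>class_tensor\<close>
  is over a nonempty constant family.\<close>

lemma class_tensor_cl:
  assumes V: "hmodule H V" and W: "hmodule H W"
  shows "class_tensor H (cl V) (cl W) = cl (hmod_tensor H V W)"
proof -
  have "cl (hmod_tensor H V' W') = cl (hmod_tensor H V W)" if "V' \<in> cl V" "W' \<in> cl W" for V' W'
    using that V W by (intro cl_eqI hmodule_tensor hmod_iso_sym[OF hmod_tensor_cong]) (auto simp: mem_cl)
  then have "class_tensor H (cl V) (cl W) = (\<Union>V'\<in>cl V. \<Union>W'\<in>cl W. cl (hmod_tensor H V W))"
    unfolding class_tensor_def by (intro SUP_cong refl)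
  moreover have "cl V \<noteq> {}" "cl W \<noteq> {}" using cl_self[OF V] cl_self[OF W] by blast+
  ultimately show ?thesis by simp
qed

lemma class_dual_cl:
  assumes V: "hmodule H V"
  shows "class_dual H (cl V) = cl (hmod_dual H V)"
proof -
  have "cl (hmod_dual H V') = cl (hmod_dual H V)" if "V' \<in> cl V" for V'
    using that V by (intro cl_eqI hmodule_dual hmod_iso_sym[OF hmod_dual_cong]) (auto simp: mem_cl)
  then have "class_dual H (cl V) = (\<Union>V'\<in>cl V. cl (hmod_dual H V))"
    unfolding class_dual_def by (intro SUP_cong refl)
  moreover have "cl V \<noteq> {}" using cl_self[OF V] by blast
  ultimately show ?thesis by simp
qed

section \<open>Multiplicities of indecomposable summands\<close>

definition summands :: "('k, 'h) hmod \<Rightarrow> ('k, 'h) hmod list" where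
  "summands V = (SOME Xs. (\<forall>X \<in> set Xs. indecomposable H X) \<and> hmod_iso V (hmod_sum_list Xs))"

text \<open>The multiplicities of the indecomposable summands, as a formal sum of classes.
  \<open>summands\<close> involves a choice, on which this sum does not depend.\<close>

definition dec :: "('k, 'h) hmod \<Rightarrow> ('k, 'h) hclass \<Rightarrow>\<^sub>0 int" where
  "dec V = sum_list (map frag_of (map cl (summands V)))"

lemma summands:
  assumes "hmodule H V"
  shows "\<forall>X \<in> set (summands V). indecomposable H X" "hmod_iso V (hmod_sum_list (summands V))"
  unfolding summands_def using someI_ex[OF exists_indecomposable_decomposition[OF assms]] by blast+

lemma hmodule_indecomposables: "\<forall>X \<in> set Xs. indecomposable H X \<Longrightarrow> hmodule H (hmod_sum_list Xs)"
  by (intro hmodule_sum_list) (auto dest: indecomposableD(1))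

text \<open>The one place where \<open>krull_schmidt\<close> is applied: any decomposition into
  indecomposables computes \<open>dec\<close>.\<close>

lemma dec_eqI:
  assumes V: "hmodule H V" and Xs: "\<forall>X \<in> set Xs. indecomposable H X" and iso: "hmod_iso V (hmod_sum_list Xs)"
  shows "dec V = sum_list (map frag_of (map cl Xs))"
proof -
  note s = summands[OF V]
  have "hmod_iso (hmod_sum_list (summands V)) (hmod_sum_list Xs)"
    by (rule hmod_iso_trans[OF hmod_iso_sym[OF s(2)] iso hmodule_indecomposables[OF s(1)] V hmodule_indecomposables[OF Xs]])
  then have eq: "mset (map cl (summands V)) = mset (map cl Xs)" by (rule krull_schmidt[OF s(1) Xs])
  have sum: "sum_list (map frag_of cs) = \<Sum>\<^sub># (image_mset frag_of (mset cs))" for cs :: "('k, 'h) hclass list"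
    by (simp add: sum_mset_sum_list flip: mset_map)
  show ?thesis unfolding dec_def by (simp only: sum eq)
qed

lemma dec_iso:
  assumes "hmod_iso V W" "hmodule H V" "hmodule H W"
  shows "dec V = dec W"
  unfolding dec_def[of W]
  by (rule dec_eqI[OF assms(2) summands(1)[OF assms(3)]])
    (rule hmod_iso_trans[OF assms(1) summands(2)[OF assms(3)] assms(2,3) hmodule_indecomposables[OF summands(1)[OF assms(3)]]])

lemma dec_sum:
  assumes V: "hmodule H V" and W: "hmodule H W"
  shows "dec (hmod_sum V W) = dec V + dec W"
proof -
  note s = summands[OF V] summands[OF W]
  have "hmod_sum_list (summands V @ summands W) = hmod_sum (hmod_sum_list (summands V)) (hmod_sum_list (summands W))"
    using s(1,3) by (intro hmod_sum_list_append[of _ _ H]) (auto dest: indecomposableD(1))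
  then have "hmod_iso (hmod_sum V W) (hmod_sum_list (summands V @ summands W))"
    using hmod_sum_cong[OF s(2,4) V W hmodule_indecomposables[OF s(1)] hmodule_indecomposables[OF s(3)]] by simp
  then have "dec (hmod_sum V W) = sum_list (map frag_of (map cl (summands V @ summands W)))"
    using s(1,3) by (intro dec_eqI hmodule_sum V W) auto
  then show ?thesis by (simp add: dec_def)
qed

lemma dec_indecomposable:
  assumes "indecomposable H X"
  shows "dec X = frag_of (cl X)"
proof -
  note mX = indecomposableD(1)[OF assms]
  have "dec X = sum_list (map frag_of (map cl [X]))"
    using assms hmod_iso_refl[OF mX] by (intro dec_eqI mX) (simp_all add: hmod_sum_zero[OF mX])
  then show ?thesis by simp
qed

lemma lookup_dec_nonneg: "0 \<le> Poly_Mapping.lookup (dec V) c"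
  unfolding dec_def lookup_sum_list_frag_of by simp

lemma keys_dec:
  assumes "hmodule H V"
  shows "Poly_Mapping.keys (dec V) \<subseteq> indec_classes H"
proof
  fix c assume "c \<in> Poly_Mapping.keys (dec V)"
  then have "c \<in> set (map cl (summands V))"
    unfolding in_keys_iff dec_def lookup_sum_list_frag_of by (auto simp: count_list_0_iff)
  then show "c \<in> indec_classes H" using summands(1)[OF assms] by (auto simp: cl_in_indec_classes)
qed

text \<open>Together with \<open>lookup_dec_pos_if_summand\<close>, this translates conditions on
  coefficients into the existence of split maps.\<close>

lemma summand_if_lookup_dec_pos:
  assumes V: "hmodule H V" and X: "hmodule H X" and pos: "0 < Poly_Mapping.lookup (dec V) (cl X)"
  shows "hmod_summand X V"
proof -
  note s = summands[OF V]
  have mod: "\<And>Y. Y \<in> set (summands V) \<Longrightarrow> hmodule H Y" using s(1) by (auto dest: indecomposableD(1))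
  have "cl X \<in> set (map cl (summands V))"
    using pos unfolding dec_def lookup_sum_list_frag_of by (metis count_notin less_irrefl of_nat_0)
  then obtain Y where Y: "Y \<in> set (summands V)" "cl Y = cl X" by auto
  have "hmod_iso Y X" using Y iso_class_eq_iff[OF mod[OF Y(1)] X] by simp
  then obtain f g where f: "f \<in> hmod_hom Y X" "g \<in> hmod_hom X Y" "g * f = 1\<^sub>m (fst Y)" "f * g = 1\<^sub>m (fst X)"
    and c: "f \<in> carrier_mat (fst X) (fst Y)" "g \<in> carrier_mat (fst Y) (fst X)"
    by (rule hmod_isoE)
  have "hmod_summand Y V"
    using hmod_summand_iso[OF hmod_summand_sum_list[OF Y(1) mod] hmod_iso_sym[OF s(2)] mod[OF Y(1)]
        hmodule_indecomposables[OF s(1)] V] by simp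
  then obtain i p where i: "i \<in> hmod_hom Y V" "p \<in> hmod_hom V Y" "p * i = 1\<^sub>m (fst Y)"
    unfolding hmod_summand_def by blast
  note d = hmod_homD(1)[OF i(1)] hmod_homD(1)[OF i(2)]
  note [simp] = carrier_matD[OF c(1)] carrier_matD[OF c(2)] carrier_matD[OF d(1)] carrier_matD[OF d(2)]
  have "f * p * (i * g) = f * (p * i) * g" by (simp add: mat_mult_assoc)
  then have "f * p * (i * g) = 1\<^sub>m (fst X)" by (simp add: i f)
  then show ?thesis
    using hmod_hom_comp[OF i(1) f(2) X mod[OF Y(1)] V] hmod_hom_comp[OF f(1) i(2) V mod[OF Y(1)] X]
    by (intro hmod_summandI)
qed

text \<open>Splitting X off contributes 1 to the coefficient, and the complement contributes a
  nonnegative amount.\<close>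

lemma lookup_dec_pos_if_summand:
  assumes V: "hmodule H V" and X: "indecomposable H X" and s: "hmod_summand X V"
  shows "0 < Poly_Mapping.lookup (dec V) (cl X)"
proof -
  note mX = indecomposableD(1)[OF X]
  obtain i p where "i \<in> hmod_hom X V" "p \<in> hmod_hom V X" "p * i = 1\<^sub>m (fst X)"
    using s unfolding hmod_summand_def by blast
  then obtain W j q where W: "hmodule H W" and b: "is_biproduct V X W i p j q"
    using split_mono_complement[OF V mX] by blast
  have "dec V = frag_of (cl X) + dec W"
    using dec_iso[OF biproduct_iso_sum[OF b V mX W] V hmodule_sum[OF mX W]] dec_sum[OF mX W] dec_indecomposable[OF X]
    by simp
  then show ?thesis using lookup_dec_nonneg[of W "cl X"] by (simp add: lookup_add)
qed

text \<open>
  By the Krull--Schmidt theorem, \<open>dec\<close> is additive; the kernel of its linear extension consists of the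
  relations of the Green ring, so that coefficients in the Green ring can be read off from \<open>dec\<close>.
\<close>

definition dec_ext :: "(('k, 'h) hclass \<Rightarrow>\<^sub>0 int) \<Rightarrow> (('k, 'h) hclass \<Rightarrow>\<^sub>0 int)" where
  "dec_ext = frag_extend (\<lambda>X. dec (SOME V. V \<in> X))"

lemma dec_ext_zero [simp]: "dec_ext 0 = 0" and dec_ext_diff: "dec_ext (x - y) = dec_ext x - dec_ext y" and dec_ext_add: "dec_ext (x + y) = dec_ext x + dec_ext y"
  by (simp_all add: dec_ext_def frag_extend_diff frag_extend_add)

lemma dec_ext_cl: "hmodule H V \<Longrightarrow> dec_ext (frag_of (cl V)) = dec V"
  using dec_iso[OF some_mem_cl(2) _ some_mem_cl(1)] by (simp add: dec_ext_def)

lemma keys_dec_ext: "Poly_Mapping.keys x \<subseteq> iso_classes H \<Longrightarrow> Poly_Mapping.keys (dec_ext x) \<subseteq> indec_classes H"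
proof (induction x rule: frag_iso_class_induct)
  case (diff a b)
  then show ?case using keys_diff[of "dec_ext a" "dec_ext b"] by (auto simp: dec_ext_diff)
qed (auto simp: dec_ext_cl dest: keys_dec)

text \<open>\<open>dec_ext\<close> is thus a retraction onto the free group on the indecomposable
  classes, whence the uniqueness of coefficients.\<close>

lemma dec_ext_fixes: "Poly_Mapping.keys x \<subseteq> indec_classes H \<Longrightarrow> dec_ext x = x"
proof (induction x rule: frag_induction)
  case (one X)
  then show ?case by (auto simp: indec_classes_def dec_ext_cl indecomposableD(1) dec_indecomposable)
qed (simp_all add: dec_ext_diff)

section \<open>The subgroup of relations\<close>

abbreviation relation :: "('k, 'h) hmod \<Rightarrow> ('k, 'h) hmod \<Rightarrow> ('k, 'h) hclass \<Rightarrow>\<^sub>0 int" where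
  "relation U V \<equiv> frag_of (cl (hmod_sum U V)) - frag_of (cl U) - frag_of (cl V)"

lemma relations_generate:
  "sum_relations H = generate (free_Abelian_group (iso_classes H)) {relation U V | U V. hmodule H U \<and> hmodule H V}"
  by (simp only: sum_relations_def add_monoid_free_green_ring)

lemma relations_in_carrier:
  "{relation U V | U V. hmodule H U \<and> hmodule H V} \<subseteq> carrier (free_Abelian_group (iso_classes H))"
proof -
  have *: "Poly_Mapping.keys (relation U V) \<subseteq> iso_classes H" if "hmodule H U" "hmodule H V" for U V
  proof -
    have "Poly_Mapping.keys (relation U V) \<subseteq> {cl (hmod_sum U V), cl U, cl V}"
      using keys_diff[of "frag_of (cl (hmod_sum U V)) - frag_of (cl U)" "frag_of (cl V)"]
        keys_diff[of "frag_of (cl (hmod_sum U V))" "frag_of (cl U)"]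
      unfolding keys_frag_of by blast
    also have "\<dots> \<subseteq> iso_classes H" by (simp add: that cl_in_iso_classes hmodule_sum)
    finally show ?thesis .
  qed
  show ?thesis
  proof
    fix x assume "x \<in> {relation U V | U V. hmodule H U \<and> hmodule H V}"
    then obtain U V where "x = relation U V" "hmodule H U" "hmodule H V" by blast
    with * show "x \<in> carrier (free_Abelian_group (iso_classes H))" by simp
  qed
qed

lemma subgroup_sum_relations: "subgroup (sum_relations H) (free_Abelian_group (iso_classes H))"
  unfolding relations_generate
  by (rule group.generate_is_subgroup[OF group_free_Abelian_group relations_in_carrier])

lemma keys_sum_relations: "x \<in> sum_relations H \<Longrightarrow> Poly_Mapping.keys x \<subseteq> iso_classes H"
  using subgroup.mem_carrier[OF subgroup_sum_relations, of x] by simp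

lemma sum_relations_add: "x \<in> sum_relations H \<Longrightarrow> y \<in> sum_relations H \<Longrightarrow> x + y \<in> sum_relations H"
  using subgroup.m_closed[OF subgroup_sum_relations] by simp

lemma sum_relations_uminus: "x \<in> sum_relations H \<Longrightarrow> - x \<in> sum_relations H"
  using subgroup.m_inv_closed[OF subgroup_sum_relations] keys_sum_relations[of x] by fastforce

lemma sum_relations_zero: "0 \<in> sum_relations H"
  using subgroup.one_closed[OF subgroup_sum_relations] by simp

lemma sum_relations_diff: "x \<in> sum_relations H \<Longrightarrow> y \<in> sum_relations H \<Longrightarrow> x - y \<in> sum_relations H"
  using sum_relations_add[OF _ sum_relations_uminus[of y], of x] by simp

lemma relation_in_sum_relations: "hmodule H U \<Longrightarrow> hmodule H V \<Longrightarrow> relation U V \<in> sum_relations H"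
  unfolding relations_generate by (rule generate.incl) blast

text \<open>The means of passing to the quotient: dimension, duality, and multiplication followed by
  \<open>dec_ext\<close> are all checked on single relations through this lemma.\<close>

lemma additive_vanishes_on_relations:
  fixes L :: "(('k, 'h) hclass \<Rightarrow>\<^sub>0 int) \<Rightarrow> 'c::ab_group_add"
  assumes L: "\<And>a b. L (a - b) = L a - L b"
    and rel: "\<And>U V. hmodule H U \<Longrightarrow> hmodule H V \<Longrightarrow> L (relation U V) = 0"
    and x: "x \<in> sum_relations H"
  shows "L x = 0"
proof -
  have L0: "L 0 = 0" using L[of 0 0] by simp
  have Ladd: "L (a + b) = L a + L b" for a b
    using L[of a "0 - b"] L[of 0 b] L0 by simp
  show ?thesis
    using x unfolding relations_generate
  proof (induction rule: generate.induct)
    case (inv h)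
    then have "h \<in> carrier (free_Abelian_group (iso_classes H))" using relations_in_carrier by blast
    moreover obtain U V where "h = relation U V" "hmodule H U" "hmodule H V" using inv by blast
    then have "L (- h) = 0" using rel L[of 0 h] L0 by simp
    ultimately show ?case by simp
  qed (auto simp: L0 Ladd rel)
qed

lemma dec_ext_sum_relations: "x \<in> sum_relations H \<Longrightarrow> dec_ext x = 0"
  by (rule additive_vanishes_on_relations) (simp_all add: dec_ext_diff dec_ext_cl hmodule_sum dec_sum)

lemma sum_list_relation:
  assumes "\<And>X. X \<in> set Xs \<Longrightarrow> hmodule H X"
  shows "frag_of (cl (hmod_sum_list Xs)) - sum_list (map frag_of (map cl Xs)) \<in> sum_relations H"
  using assms
proof (induction Xs)
  case Nil
  \<comment> \<open>As the sum of two zero modules is the zero module, this relation is minus the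
    class of the zero module.\<close>
  have "relation hmod_zero hmod_zero \<in> sum_relations H"
    by (intro relation_in_sum_relations hmodule_zero)
  then show ?case
    using sum_relations_uminus[of "relation hmod_zero hmod_zero"] by (simp add: hmod_sum_zero[OF hmodule_zero])
next
  case (Cons X Xs)
  have m: "hmodule H X" "hmodule H (hmod_sum_list Xs)" using Cons.prems hmodule_sum_list[of Xs H] by auto
  have "frag_of (cl (hmod_sum_list Xs)) - sum_list (map frag_of (map cl Xs)) \<in> sum_relations H"
    using Cons by simp
  from sum_relations_add[OF relation_in_sum_relations[OF m] this] show ?case
    by (simp add: algebra_simps)
qed

lemma diff_dec_ext_in_sum_relations: "Poly_Mapping.keys x \<subseteq> iso_classes H \<Longrightarrow> x - dec_ext x \<in> sum_relations H"
proof (induction x rule: frag_iso_class_induct)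
  case zero
  then show ?case by (simp add: sum_relations_zero)
next
  case (iso_class V)
  note s = summands[OF iso_class]
  have "cl V = cl (hmod_sum_list (summands V))"
    by (rule cl_eqI[OF iso_class hmodule_indecomposables[OF s(1)] s(2)])
  moreover have "dec_ext (frag_of (cl V)) = sum_list (map frag_of (map cl (summands V)))"
    by (simp only: dec_ext_cl[OF iso_class] dec_def)
  moreover have "frag_of (cl (hmod_sum_list (summands V))) - sum_list (map frag_of (map cl (summands V))) \<in> sum_relations H"
    using s(1) indecomposableD(1) by (intro sum_list_relation) blast
  ultimately show ?case by metis
next
  case (diff a b)
  from sum_relations_diff[OF this] show ?case by (simp add: dec_ext_diff algebra_simps)
qed

lemma sum_relations_iff:
  assumes "Poly_Mapping.keys x \<subseteq> iso_classes H"
  shows "x \<in> sum_relations H \<longleftrightarrow> dec_ext x = 0"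
  using dec_ext_sum_relations diff_dec_ext_in_sum_relations[OF assms] by auto

section \<open>Multiplication on the free group\<close>

abbreviation fmul :: "(('k, 'h) hclass \<Rightarrow>\<^sub>0 int) \<Rightarrow> (('k, 'h) hclass \<Rightarrow>\<^sub>0 int) \<Rightarrow> (('k, 'h) hclass \<Rightarrow>\<^sub>0 int)" where
  "fmul x y \<equiv> frag_extend (\<lambda>X. frag_extend (\<lambda>Y. frag_of (class_tensor H X Y)) y) x"

lemma fmul_diff_left: "fmul (x - x') y = fmul x y - fmul x' y"
  by (simp add: frag_extend_diff)

lemma fmul_diff_right: "fmul x (y - y') = fmul x y - fmul x y'"
  by (simp add: frag_extend_diff frag_extend_diff_fun)

lemma fmul_zero: "fmul 0 y = 0" "fmul x 0 = 0"
  by (simp_all add: frag_extend_def)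

lemma fmul_cl: "hmodule H V \<Longrightarrow> hmodule H W \<Longrightarrow> fmul (frag_of (cl V)) (frag_of (cl W)) = frag_of (cl (hmod_tensor H V W))"
  by (simp add: class_tensor_cl)

lemma frag_bilinear_induct [consumes 2, case_names zero_right zero_left diff_left diff_right iso_class]:
  assumes x: "Poly_Mapping.keys x \<subseteq> iso_classes H" and y: "Poly_Mapping.keys y \<subseteq> iso_classes H"
    and "\<And>x. P x 0" "\<And>y. P 0 y" "\<And>a b y. P a y \<Longrightarrow> P b y \<Longrightarrow> P (a - b) y" "\<And>x a b. P x a \<Longrightarrow> P x b \<Longrightarrow> P x (a - b)"
    and cl: "\<And>V W. hmodule H V \<Longrightarrow> hmodule H W \<Longrightarrow> P (frag_of (cl V)) (frag_of (cl W))"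
  shows "P x y"
  using x
proof (induction x rule: frag_iso_class_induct)
  case (iso_class V)
  show ?case using y by (induction y rule: frag_iso_class_induct) (use assms iso_class in auto)
qed (use assms in auto)

lemma keys_fmul:
  assumes "Poly_Mapping.keys x \<subseteq> iso_classes H" "Poly_Mapping.keys y \<subseteq> iso_classes H"
  shows "Poly_Mapping.keys (fmul x y) \<subseteq> iso_classes H"
  using assms
proof (induction x y rule: frag_bilinear_induct)
  case (diff_left a b y)
  then show ?case unfolding fmul_diff_left using keys_diff[of "fmul a y" "fmul b y"] by blast
next
  case (diff_right x a b)
  then show ?case unfolding fmul_diff_right using keys_diff[of "fmul x a" "fmul x b"] by blast
next
  case (iso_class V W)
  then show ?case unfolding fmul_cl[OF iso_class] by (simp add: keys_frag_of cl_in_iso_classes hmodule_tensor)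
qed (simp_all only: fmul_zero keys_zero empty_subsetI)

lemma fmul_assoc:
  assumes x: "Poly_Mapping.keys x \<subseteq> iso_classes H" and y: "Poly_Mapping.keys y \<subseteq> iso_classes H"
    and z: "Poly_Mapping.keys z \<subseteq> iso_classes H"
  shows "fmul (fmul x y) z = fmul x (fmul y z)"
  using x y
proof (induction x y rule: frag_bilinear_induct)
  case (iso_class V W)
  note VW = iso_class
  show ?case
    using z
  proof (induction z rule: frag_iso_class_induct)
    case (iso_class U)
    then show ?case using VW by (simp only: fmul_cl hmodule_tensor hmod_tensor_assoc)
  next
    case (diff a b)
    then show ?case by (simp only: fmul_diff_left fmul_diff_right)
  qed (simp only: fmul_zero)
next
  case (diff_left a b y)
  then show ?case by (simp only: fmul_diff_left fmul_diff_right)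
next
  case (diff_right x a b)
  then show ?case by (simp only: fmul_diff_left fmul_diff_right)
qed (simp_all only: fmul_zero keys_zero empty_subsetI)

lemma fmul_one:
  assumes "Poly_Mapping.keys x \<subseteq> iso_classes H"
  shows "fmul (frag_of (cl (hmod_trivial H))) x = x" "fmul x (frag_of (cl (hmod_trivial H))) = x"
  using assms
proof (induction x rule: frag_iso_class_induct)
  case (iso_class V)
  {
    case 1
    show ?case using iso_class by (simp only: fmul_cl hmodule_trivial hmod_tensor_trivial_left)
  next
    case 2
    show ?case using iso_class by (simp only: fmul_cl hmodule_trivial hmod_tensor_trivial_right)
  }
next
  case (diff a b)
  {
    case 1
    show ?case using diff by (simp only: fmul_diff_right)
  next
    case 2
    show ?case using diff by (simp only: fmul_diff_left)
  }
qed (simp_all add: fmul_zero)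

lemma free_green_ring_simps:
  "x \<otimes>\<^bsub>free_green_ring H\<^esub> y = fmul x y" "x \<oplus>\<^bsub>free_green_ring H\<^esub> y = x + y"
  "\<one>\<^bsub>free_green_ring H\<^esub> = frag_of (cl (hmod_trivial H))" "\<zero>\<^bsub>free_green_ring H\<^esub> = 0"
  by (simp_all add: free_green_ring_def)

lemma ring_free_green_ring: "ring (free_green_ring H)"
proof (rule ringI)
  show "abelian_group (free_green_ring H)"
    by (rule comm_group_abelian_groupI, unfold add_monoid_free_green_ring, rule abelian_free_Abelian_group)
  show "Group.monoid (free_green_ring H)"
    by (rule monoidI)
      (simp_all only: carrier_free_green_ring free_green_ring_simps keys_fmul fmul_assoc fmul_one,
        simp add: keys_frag_of cl_in_iso_classes hmodule_trivial)
  \<comment> \<open>Bilinearity of \<open>fmul\<close> is recorded for differences, so sums are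
    written as differences.\<close>
  have add: "x + y = x - (0 - y)" for x y :: "('k, 'h) hclass \<Rightarrow>\<^sub>0 int" by simp
  show "(x \<oplus>\<^bsub>free_green_ring H\<^esub> y) \<otimes>\<^bsub>free_green_ring H\<^esub> z =
      x \<otimes>\<^bsub>free_green_ring H\<^esub> z \<oplus>\<^bsub>free_green_ring H\<^esub> y \<otimes>\<^bsub>free_green_ring H\<^esub> z" for x y z
    by (simp only: free_green_ring_simps add fmul_diff_left fmul_zero)
  show "z \<otimes>\<^bsub>free_green_ring H\<^esub> (x \<oplus>\<^bsub>free_green_ring H\<^esub> y) =
      z \<otimes>\<^bsub>free_green_ring H\<^esub> x \<oplus>\<^bsub>free_green_ring H\<^esub> z \<otimes>\<^bsub>free_green_ring H\<^esub> y" for x y z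
    by (simp only: free_green_ring_simps add fmul_diff_right fmul_zero)
qed

text \<open>Membership is tested by \<open>dec_ext\<close>, so absorption comes down to the
  distributivity of tensor products over direct sums.\<close>

lemma ideal_sum_relations: "ideal (sum_relations H) (free_green_ring H)"
proof (rule idealI[OF ring_free_green_ring])
  show "subgroup (sum_relations H) (add_monoid (free_green_ring H))"
    unfolding add_monoid_free_green_ring by (rule subgroup_sum_relations)
  fix a x assume a: "a \<in> sum_relations H" and "x \<in> carrier (free_green_ring H)"
  then have x: "Poly_Mapping.keys x \<subseteq> iso_classes H" by (simp add: carrier_free_green_ring)
  note a' = keys_sum_relations[OF a]
  have "dec_ext (fmul x a) = 0"
    using x
  proof (induction x rule: frag_iso_class_induct)
    case (iso_class V)
    show ?case
    proof (rule additive_vanishes_on_relations[OF _ _ a])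
      show "dec_ext (fmul (frag_of (cl V)) (b - c)) = dec_ext (fmul (frag_of (cl V)) b) - dec_ext (fmul (frag_of (cl V)) c)" for b c
        by (simp only: fmul_diff_right dec_ext_diff)
      show "dec_ext (fmul (frag_of (cl V)) (relation A B)) = 0" if m: "hmodule H A" "hmodule H B" for A B
        using dec_iso[OF hmod_tensor_sum_left[OF m iso_class]] m iso_class
        by (simp only: fmul_diff_right dec_ext_diff fmul_cl hmodule_sum dec_ext_cl hmodule_tensor dec_sum) simp
    qed
  qed (simp_all only: fmul_zero fmul_diff_left dec_ext_diff dec_ext_zero diff_self)
  then show "x \<otimes>\<^bsub>free_green_ring H\<^esub> a \<in> sum_relations H"
    by (simp only: free_green_ring_simps sum_relations_iff[OF keys_fmul[OF x a']])
  have "dec_ext (fmul a x) = 0"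
    using x
  proof (induction x rule: frag_iso_class_induct)
    case (iso_class V)
    show ?case
    proof (rule additive_vanishes_on_relations[OF _ _ a])
      show "dec_ext (fmul (b - c) (frag_of (cl V))) = dec_ext (fmul b (frag_of (cl V))) - dec_ext (fmul c (frag_of (cl V)))" for b c
        by (simp only: fmul_diff_left dec_ext_diff)
      show "dec_ext (fmul (relation A B) (frag_of (cl V))) = 0" if m: "hmodule H A" "hmodule H B" for A B
        using dec_iso[OF hmod_tensor_sum_right[OF m iso_class]] m iso_class
        by (simp only: fmul_diff_left dec_ext_diff fmul_cl hmodule_sum dec_ext_cl hmodule_tensor dec_sum) simp
    qed
  qed (simp_all only: fmul_zero fmul_diff_right dec_ext_diff dec_ext_zero diff_self)
  then show "a \<otimes>\<^bsub>free_green_ring H\<^esub> x \<in> sum_relations H"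
    by (simp only: free_green_ring_simps sum_relations_iff[OF keys_fmul[OF a' x]])
qed

section \<open>The quotient ring and its basis\<close>

definition coset :: "(('k, 'h) hclass \<Rightarrow>\<^sub>0 int) \<Rightarrow> (('k, 'h) hclass \<Rightarrow>\<^sub>0 int) set" where
  "coset x = sum_relations H +>\<^bsub>free_green_ring H\<^esub> x"

lemma green_class_coset: "green_class H X = coset (frag_of X)"
  by (simp add: green_class_def coset_def)

lemma ring_green_ring: "ring (green_ring H)"
  unfolding green_ring_def by (rule ideal.quotient_is_ring[OF ideal_sum_relations])

lemma carrier_green_ring: "carrier (green_ring H) = coset ` {x. Poly_Mapping.keys x \<subseteq> iso_classes H}"
  by (auto simp: green_ring_def FactRing_def A_RCOSETS_def' coset_def carrier_free_green_ring)

lemma coset_in_carrier: "Poly_Mapping.keys x \<subseteq> iso_classes H \<Longrightarrow> coset x \<in> carrier (green_ring H)"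
  by (simp add: carrier_green_ring)

lemma coset_mult:
  assumes "Poly_Mapping.keys x \<subseteq> iso_classes H" "Poly_Mapping.keys y \<subseteq> iso_classes H"
  shows "coset x \<otimes>\<^bsub>green_ring H\<^esub> coset y = coset (fmul x y)"
  using ideal.rcoset_mult_add[OF ideal_sum_relations, of x y] assms
  by (simp add: green_ring_def FactRing_def coset_def carrier_free_green_ring free_green_ring_simps)

lemma coset_add:
  assumes "Poly_Mapping.keys x \<subseteq> iso_classes H" "Poly_Mapping.keys y \<subseteq> iso_classes H"
  shows "coset x \<oplus>\<^bsub>green_ring H\<^esub> coset y = coset (x + y)"
  using ideal.a_rcos_sum[OF ideal_sum_relations, of x y] assms
  by (simp add: green_ring_def FactRing_def coset_def carrier_free_green_ring free_green_ring_simps)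

lemma coset_one: "\<one>\<^bsub>green_ring H\<^esub> = coset (frag_of (cl (hmod_trivial H)))"
  by (simp add: green_ring_def FactRing_def coset_def free_green_ring_simps)

lemma coset_zero: "\<zero>\<^bsub>green_ring H\<^esub> = coset 0"
  by (auto simp: green_ring_def FactRing_def coset_def a_r_coset_def' free_green_ring_simps)

lemma coset_eq_iff:
  assumes x: "Poly_Mapping.keys x \<subseteq> iso_classes H" and y: "Poly_Mapping.keys y \<subseteq> iso_classes H"
  shows "coset x = coset y \<longleftrightarrow> dec_ext x = dec_ext y"
proof -
  have "x \<ominus>\<^bsub>free_green_ring H\<^esub> y = x - y"
    unfolding a_minus_def a_inv_def add_monoid_free_green_ring free_green_ring_simps(2) using y by simp
  moreover have "x \<ominus>\<^bsub>free_green_ring H\<^esub> y \<in> sum_relations H \<longleftrightarrow> coset x = coset y"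
    unfolding coset_def
    by (rule ring.quotient_eq_iff_same_a_r_cos[OF ring_free_green_ring ideal_sum_relations])
      (simp_all add: carrier_free_green_ring x y)
  moreover have "Poly_Mapping.keys (x - y) \<subseteq> iso_classes H" using keys_diff[of x y] x y by blast
  ultimately show ?thesis using sum_relations_iff[of "x - y"] by (simp add: dec_ext_diff)
qed

lemma keys_frag_cmul_subset: "Poly_Mapping.keys x \<subseteq> S \<Longrightarrow> Poly_Mapping.keys (frag_cmul k x) \<subseteq> S"
  using keys_cmul[of k x] by blast

lemma coset_add_pow:
  fixes k :: int
  assumes x: "Poly_Mapping.keys x \<subseteq> iso_classes H"
  shows "[k] \<cdot>\<^bsub>green_ring H\<^esub> coset x = coset (frag_cmul k x)"
proof -
  interpret G: ring "green_ring H" by (rule ring_green_ring)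
  have nat: "[n] \<cdot>\<^bsub>green_ring H\<^esub> coset x = coset (frag_cmul (int n) x)" for n :: nat
  proof (induction n)
    case 0
    then show ?case by (simp add: add_pow_def nat_pow_def coset_zero)
  next
    case (Suc n)
    have "[Suc n] \<cdot>\<^bsub>green_ring H\<^esub> coset x = [n] \<cdot>\<^bsub>green_ring H\<^esub> coset x \<oplus>\<^bsub>green_ring H\<^esub> coset x"
      by (simp add: add_pow_def nat_pow_def)
    also have "\<dots> = coset (frag_cmul (int n) x + x)"
      unfolding Suc by (rule coset_add[OF keys_frag_cmul_subset[OF x] x])
    also have "frag_cmul (int n) x + x = frag_cmul (int (Suc n)) x"
      by (simp add: frag_cmul_distrib algebra_simps)
    finally show ?case .
  qed
  show ?thesis
  proof (cases "k \<ge> 0")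
    case True
    then show ?thesis using nat[of "nat k"] by (simp add: add_pow_int_ge)
  next
    case False
    let ?y = "frag_cmul (- k) x"
    have y: "Poly_Mapping.keys ?y \<subseteq> iso_classes H" "Poly_Mapping.keys (frag_cmul k x) \<subseteq> iso_classes H"
      by (rule keys_frag_cmul_subset[OF x])+
    have "coset (frag_cmul k x) \<oplus>\<^bsub>green_ring H\<^esub> coset ?y = \<zero>\<^bsub>green_ring H\<^esub>"
      using coset_add[OF y(2,1)] by (simp add: coset_zero flip: frag_cmul_distrib)
    then have "\<ominus>\<^bsub>green_ring H\<^esub> coset ?y = coset (frag_cmul k x)"
      by (rule G.minus_equality) (intro coset_in_carrier y)+
    then show ?thesis using False nat[of "nat (- k)"] by (simp add: add_pow_int_lt)
  qed
qed

lemma zcomb_coset: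
  assumes "Poly_Mapping.keys c \<subseteq> indec_classes H"
  shows "zcomb (green_ring H) (green_class H) c = coset c"
proof -
  interpret G: ring "green_ring H" by (rule ring_green_ring)
  let ?f = "\<lambda>i. frag_cmul (Poly_Mapping.lookup c i) (frag_of i)"
  have "(\<Oplus>\<^bsub>green_ring H\<^esub>i\<in>A. [Poly_Mapping.lookup c i] \<cdot>\<^bsub>green_ring H\<^esub> green_class H i) = coset (sum ?f A) \<and>
      Poly_Mapping.keys (sum ?f A) \<subseteq> iso_classes H"
    if "finite A" "A \<subseteq> indec_classes H" for A
    using that
  proof (induction A rule: finite_induct)
    case empty
    then show ?case by (simp add: coset_zero)
  next
    case (insert i A)
    have k: "Poly_Mapping.keys (?f j) \<subseteq> iso_classes H" if "j \<in> insert i A" for j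
      using that insert.prems indec_classes_subset by (intro keys_frag_cmul_subset) (auto simp: keys_frag_of)
    have p: "[Poly_Mapping.lookup c j] \<cdot>\<^bsub>green_ring H\<^esub> green_class H j = coset (?f j)" if "j \<in> insert i A" for j
      using that insert.prems indec_classes_subset unfolding green_class_coset
      by (intro coset_add_pow) (auto simp: keys_frag_of)
    have "(\<Oplus>\<^bsub>green_ring H\<^esub>j\<in>insert i A. [Poly_Mapping.lookup c j] \<cdot>\<^bsub>green_ring H\<^esub> green_class H j) =
        coset (?f i) \<oplus>\<^bsub>green_ring H\<^esub> coset (sum ?f A)"
      using insert p k by (subst G.finsum_insert) (auto simp: coset_in_carrier)
    also have "\<dots> = coset (?f i + sum ?f A)"
      using insert k by (intro coset_add) auto
    finally have eq: "(\<Oplus>\<^bsub>green_ring H\<^esub>j\<in>insert i A. [Poly_Mapping.lookup c j] \<cdot>\<^bsub>green_ring H\<^esub> green_class H j) =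
        coset (?f i + sum ?f A)" .
    have "Poly_Mapping.keys (?f i + sum ?f A) \<subseteq> iso_classes H"
      using keys_add[of "?f i" "sum ?f A"] k[of i] insert.IH insert.prems by blast
    then show ?case using eq insert.hyps by simp
  qed
  from this[OF finite_keys assms] have "zcomb (green_ring H) (green_class H) c = coset (sum ?f (Poly_Mapping.keys c))"
    by (simp add: zcomb_def)
  also have "sum ?f (Poly_Mapping.keys c) = c"
    using frag_expansion[of c] by (simp add: frag_extend_def)
  finally show ?thesis .
qed

text \<open>Existence and uniqueness of the expansion at once, with the coefficients identified as
  those of \<open>dec_ext x\<close>.\<close>

lemma zcomb_coset_iff:
  assumes "Poly_Mapping.keys x \<subseteq> iso_classes H"
  shows "Poly_Mapping.keys c \<subseteq> indec_classes H \<and> coset x = zcomb (green_ring H) (green_class H) c \<longleftrightarrow> c = dec_ext x"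
proof
  assume c: "Poly_Mapping.keys c \<subseteq> indec_classes H \<and> coset x = zcomb (green_ring H) (green_class H) c"
  then have "dec_ext x = dec_ext c"
    using coset_eq_iff[OF assms, of c] indec_classes_subset by (auto simp: zcomb_coset)
  then show "c = dec_ext x" using c by (simp add: dec_ext_fixes)
next
  assume c: "c = dec_ext x"
  have "Poly_Mapping.keys c \<subseteq> iso_classes H" using keys_dec_ext[OF assms] indec_classes_subset unfolding c by blast
  then show "Poly_Mapping.keys c \<subseteq> indec_classes H \<and> coset x = zcomb (green_ring H) (green_class H) c"
    using coset_eq_iff[OF assms, of c] keys_dec_ext[OF assms] by (simp add: zcomb_coset c dec_ext_fixes)
qed

lemma zbasis_green_ring: "zbasis (green_ring H) (indec_classes H) (green_class H)"
  unfolding zbasis_def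
proof (intro conjI ballI)
  show "green_class H ` indec_classes H \<subseteq> carrier (green_ring H)"
    by (auto simp: green_class_coset keys_frag_of intro!: coset_in_carrier dest: subsetD[OF indec_classes_subset])
  show "\<exists>!c. Poly_Mapping.keys c \<subseteq> indec_classes H \<and> a = zcomb (green_ring H) (green_class H) c"
    if "a \<in> carrier (green_ring H)" for a
  proof -
    from that have "a \<in> coset ` {x. Poly_Mapping.keys x \<subseteq> iso_classes H}" by (simp only: carrier_green_ring)
    then obtain x where a: "a = coset x" and "x \<in> {x. Poly_Mapping.keys x \<subseteq> iso_classes H}"
      by (rule imageE)
    then have "Poly_Mapping.keys x \<subseteq> iso_classes H" by simp
    then show ?thesis unfolding a by (simp only: zcomb_coset_iff) simp
  qed
qed

lemma zcoeff_coset: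
  assumes "Poly_Mapping.keys x \<subseteq> iso_classes H"
  shows "zcoeff (green_ring H) (indec_classes H) (green_class H) (coset x) i = Poly_Mapping.lookup (dec_ext x) i"
  unfolding zcoeff_def zcomb_coset_iff[OF assms] by simp

section \<open>Dimension and duality on the quotient\<close>

definition rep :: "(('k, 'h) hclass \<Rightarrow>\<^sub>0 int) set \<Rightarrow> ('k, 'h) hclass \<Rightarrow>\<^sub>0 int" where
  "rep \<xi> = (SOME x. Poly_Mapping.keys x \<subseteq> iso_classes H \<and> \<xi> = coset x)"

text \<open>The chosen representative differs from any other by a relation, so additive maps that
  kill relations may be evaluated at \<open>x\<close> itself.\<close>

lemma rep_coset:
  assumes x: "Poly_Mapping.keys x \<subseteq> iso_classes H"
  shows "Poly_Mapping.keys (rep (coset x)) \<subseteq> iso_classes H" "rep (coset x) - x \<in> sum_relations H"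
proof -
  have r: "Poly_Mapping.keys (rep (coset x)) \<subseteq> iso_classes H \<and> coset x = coset (rep (coset x))"
    using someI[of "\<lambda>z. Poly_Mapping.keys z \<subseteq> iso_classes H \<and> coset x = coset z" x] x by (simp add: rep_def)
  then show "Poly_Mapping.keys (rep (coset x)) \<subseteq> iso_classes H" by simp
  moreover have "dec_ext (rep (coset x) - x) = 0"
    using r coset_eq_iff[OF x, of "rep (coset x)"] by (simp add: dec_ext_diff)
  ultimately show "rep (coset x) - x \<in> sum_relations H"
    using keys_diff[of "rep (coset x)" x] x by (subst sum_relations_iff) auto
qed

text \<open>The integers appear as the free abelian group on one generator, so that
  \<open>frag_extend\<close> also provides the additive extension of the dimension; the value is its
  single coefficient.\<close>

definition fdim :: "(('k, 'h) hclass \<Rightarrow>\<^sub>0 int) \<Rightarrow> int" where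
  "fdim x = Poly_Mapping.lookup (frag_extend (\<lambda>X. frag_cmul (int (fst (SOME V. V \<in> X))) (frag_of ())) x) ()"

lemma fdim_zero [simp]: "fdim 0 = 0" and fdim_diff: "fdim (x - y) = fdim x - fdim y" and fdim_add: "fdim (x + y) = fdim x + fdim y"
  by (simp_all add: fdim_def frag_extend_diff frag_extend_add lookup_add lookup_minus)

lemma fdim_cl: "hmodule H V \<Longrightarrow> fdim (frag_of (cl V)) = int (fst V)"
  using hmod_iso_imp_fst_eq[OF some_mem_cl(2), of V] by (simp add: fdim_def)

lemma fdim_fmul:
  assumes "Poly_Mapping.keys x \<subseteq> iso_classes H" "Poly_Mapping.keys y \<subseteq> iso_classes H"
  shows "fdim (fmul x y) = fdim x * fdim y"
  using assms
proof (induction x y rule: frag_bilinear_induct)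
  case (diff_left a b y)
  then show ?case by (simp only: fmul_diff_left fdim_diff left_diff_distrib)
next
  case (diff_right x a b)
  then show ?case by (simp only: fmul_diff_right fdim_diff right_diff_distrib)
next
  case (iso_class V W)
  then show ?case by (simp only: fmul_cl fdim_cl hmodule_tensor) simp
qed (simp_all only: fmul_zero fdim_zero mult_zero_left mult_zero_right)

definition gdim :: "(('k, 'h) hclass \<Rightarrow>\<^sub>0 int) set \<Rightarrow> int" where
  "gdim \<xi> = fdim (rep \<xi>)"

lemma gdim_coset:
  assumes "Poly_Mapping.keys x \<subseteq> iso_classes H"
  shows "gdim (coset x) = fdim x"
proof -
  have "fdim (rep (coset x) - x) = 0"
    by (rule additive_vanishes_on_relations[OF fdim_diff _ rep_coset(2)[OF assms]])
      (simp add: fdim_diff fdim_cl hmodule_sum)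
  then show ?thesis by (simp add: fdim_diff gdim_def)
qed

definition fdual :: "(('k, 'h) hclass \<Rightarrow>\<^sub>0 int) \<Rightarrow> (('k, 'h) hclass \<Rightarrow>\<^sub>0 int)" where
  "fdual = frag_extend (\<lambda>X. frag_of (class_dual H X))"

lemma fdual_zero [simp]: "fdual 0 = 0" and fdual_diff: "fdual (x - y) = fdual x - fdual y" and fdual_add: "fdual (x + y) = fdual x + fdual y"
  by (simp_all add: fdual_def frag_extend_diff frag_extend_add)

lemma fdual_cl: "hmodule H V \<Longrightarrow> fdual (frag_of (cl V)) = frag_of (cl (hmod_dual H V))"
  by (simp add: fdual_def class_dual_cl)

lemma keys_fdual: "Poly_Mapping.keys x \<subseteq> iso_classes H \<Longrightarrow> Poly_Mapping.keys (fdual x) \<subseteq> iso_classes H"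
proof (induction x rule: frag_iso_class_induct)
  case (diff a b)
  then show ?case using keys_diff[of "fdual a" "fdual b"] by (auto simp: fdual_diff)
qed (auto simp: fdual_cl keys_frag_of cl_in_iso_classes hmodule_dual)

lemma fdual_fmul:
  assumes "Poly_Mapping.keys x \<subseteq> iso_classes H" "Poly_Mapping.keys y \<subseteq> iso_classes H"
  shows "fdual (fmul x y) = fmul (fdual y) (fdual x)"
  using assms
proof (induction x y rule: frag_bilinear_induct)
  case (diff_left a b y)
  then show ?case by (simp only: fmul_diff_left fmul_diff_right fdual_diff)
next
  case (diff_right x a b)
  then show ?case by (simp only: fmul_diff_left fmul_diff_right fdual_diff)
next
  case (iso_class V W)
  then have "cl (hmod_dual H (hmod_tensor H V W)) = cl (hmod_tensor H (hmod_dual H W) (hmod_dual H V))"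
    by (intro cl_eqI hmod_dual_tensor_iso hmodule_dual hmodule_tensor)
  with iso_class show ?case by (simp only: fmul_cl fdual_cl hmodule_tensor hmodule_dual)
qed (simp_all only: fmul_zero fdual_zero)

text \<open>The trivial module tensored with itself is literally the trivial module, so its identity
  map is an invariant to which \<open>vcol_hom_iff\<close> applies.\<close>

lemma trivial_dual_iso: "hmod_iso (hmod_dual H (hmod_trivial H)) (hmod_trivial H)"
proof -
  let ?k = "hmod_trivial H"
  have one: "1\<^sub>m 1 \<in> hmod_hom ?k ?k" using hmod_hom_one[OF hmodule_trivial] by simp
  have "vcol (1\<^sub>m 1) = (1\<^sub>m 1 :: 'k mat)" by (rule eq_matI) (auto simp: vcol_def)
  then have "(1\<^sub>m 1)\<^sup>T \<in> hmod_hom (hmod_dual H ?k) ?k"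
    using vcol_hom_iff[OF hmodule_trivial hmodule_trivial, of "1\<^sub>m 1"] one
    by (simp add: hmod_tensor_trivial_left hmodule_trivial)
  then show ?thesis
    by (intro hmod_isoI_inverse[of "1\<^sub>m 1" _ _ "1\<^sub>m 1" H] hmodule_dual hmodule_trivial) auto
qed

definition gdual :: "(('k, 'h) hclass \<Rightarrow>\<^sub>0 int) set \<Rightarrow> (('k, 'h) hclass \<Rightarrow>\<^sub>0 int) set" where
  "gdual \<xi> = coset (fdual (rep \<xi>))"

lemma gdual_coset:
  assumes "Poly_Mapping.keys x \<subseteq> iso_classes H"
  shows "gdual (coset x) = coset (fdual x)"
proof -
  have "dec_ext (fdual (rep (coset x) - x)) = 0"
  proof (rule additive_vanishes_on_relations[OF _ _ rep_coset(2)[OF assms]])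
    show "dec_ext (fdual (a - b)) = dec_ext (fdual a) - dec_ext (fdual b)" for a b by (simp add: fdual_diff dec_ext_diff)
    show "dec_ext (fdual (relation U V)) = 0" if m: "hmodule H U" "hmodule H V" for U V
      using dec_iso[OF hmod_dual_sum[OF m]] m
      by (simp add: fdual_diff dec_ext_diff fdual_cl dec_ext_cl hmodule_sum hmodule_dual dec_sum)
  qed
  then have "dec_ext (fdual (rep (coset x))) = dec_ext (fdual x)" by (simp add: fdual_diff dec_ext_diff)
  then show ?thesis
    unfolding gdual_def by (subst coset_eq_iff) (intro keys_fdual rep_coset(1) assms)+
qed

lemma indecomposable_trivial: "indecomposable H (hmod_trivial H)"
  unfolding indecomposable_def
proof (intro conjI notI hmodule_trivial)
  assume "\<exists>U W. hmodule H U \<and> hmodule H W \<and> fst U \<noteq> 0 \<and> fst W \<noteq> 0 \<and> hmod_iso (hmod_trivial H) (hmod_sum U W)"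
  then show False
  proof (elim exE conjE)
    fix U W :: "('k, 'h) hmod" assume "fst U \<noteq> 0" "fst W \<noteq> 0" "hmod_iso (hmod_trivial H) (hmod_sum U W)"
    then show False using hmod_iso_imp_fst_eq[of "hmod_trivial H" "hmod_sum U W"] by simp
  qed
qed simp

lemma dec_zero: "dec hmod_zero = 0"
  using dec_sum[OF hmodule_zero hmodule_zero] by (simp add: hmod_sum_zero[OF hmodule_zero])

lemma dec_tensor_trivial_power:
  assumes V: "hmodule H V"
  shows "dec (hmod_tensor H V (trivial_power m)) = frag_cmul (int m) (dec V)"
proof (induction m)
  case 0
  have "fst (hmod_tensor H V (trivial_power 0)) = 0" by simp
  then have "dec (hmod_tensor H V (trivial_power 0)) = dec hmod_zero"
    by (intro dec_iso hmod_iso_zero[of H] hmodule_tensor V hmodule_trivial_power hmodule_zero)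
  then show ?case by (simp add: dec_zero)
next
  case (Suc m)
  let ?k = "hmod_trivial H"
  have "dec (hmod_tensor H V (trivial_power (Suc m))) =
      dec (hmod_sum (hmod_tensor H V ?k) (hmod_tensor H V (trivial_power m)))"
    unfolding trivial_power_Suc
    by (intro dec_iso hmod_tensor_sum_left hmodule_tensor hmodule_sum V hmodule_trivial hmodule_trivial_power)
  also have "\<dots> = dec V + dec (hmod_tensor H V (trivial_power m))"
    by (simp add: dec_sum hmodule_tensor V hmodule_trivial hmodule_trivial_power hmod_tensor_trivial_right)
  finally show ?case using Suc by (simp add: frag_cmul_distrib)
qed

end

section \<open>The axioms of a representation ring\<close>

context hopf_algebra_inner
begin

lemma keys_frag_of_cl: "hmodule H V \<Longrightarrow> Poly_Mapping.keys (frag_of (cl V)) \<subseteq> iso_classes H"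
  by (simp add: keys_frag_of cl_in_iso_classes)

lemma green_class_mult:
  "hmodule H V \<Longrightarrow> hmodule H W \<Longrightarrow>
   green_class H (cl V) \<otimes>\<^bsub>green_ring H\<^esub> green_class H (cl W) = green_class H (cl (hmod_tensor H V W))"
  by (simp only: green_class_coset coset_mult keys_frag_of_cl fmul_cl)

lemma zcoeff_green_class:
  "hmodule H V \<Longrightarrow> zcoeff (green_ring H) (indec_classes H) (green_class H) (green_class H (cl V)) i =
    Poly_Mapping.lookup (dec V) i"
  by (simp only: green_class_coset zcoeff_coset keys_frag_of_cl dec_ext_cl)

lemma class_dual_involution:
  assumes "hmodule H V"
  shows "class_dual H (class_dual H (cl V)) = cl V"
proof -
  have "cl (hmod_dual H (hmod_dual H V)) = cl V"
    by (intro cl_eqI hmodule_dual assms hmod_iso_sym[OF double_dual_iso])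
  then show ?thesis by (simp only: class_dual_cl hmodule_dual assms)
qed

lemma fdual_involution:
  assumes "Poly_Mapping.keys x \<subseteq> iso_classes H"
  shows "fdual (fdual x) = x"
  using assms
proof (induction x rule: frag_iso_class_induct)
  case (iso_class V)
  then show ?case using class_dual_involution[OF iso_class] by (simp only: class_dual_cl fdual_cl hmodule_dual)
qed (simp_all add: fdual_diff)

lemma carrier_green_ringE:
  assumes "a \<in> carrier (green_ring H)"
  obtains x where "Poly_Mapping.keys x \<subseteq> iso_classes H" "a = coset x"
  using assms unfolding carrier_green_ring by (elim imageE) simp

lemma anti_involution_gdual: "anti_involution (green_ring H) gdual"
proof -
  let ?G = "green_ring H"
  have closed: "gdual a \<in> carrier ?G" if "a \<in> carrier ?G" for a
    using that by (elim carrier_green_ringE) (simp only: gdual_coset coset_in_carrier keys_fdual)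
  have add: "gdual (a \<oplus>\<^bsub>?G\<^esub> b) = gdual a \<oplus>\<^bsub>?G\<^esub> gdual b" if a: "a \<in> carrier ?G" and b: "b \<in> carrier ?G" for a b
  proof -
    obtain x where x: "Poly_Mapping.keys x \<subseteq> iso_classes H" "a = coset x"
      using a by (rule carrier_green_ringE)
    obtain y where y: "Poly_Mapping.keys y \<subseteq> iso_classes H" "b = coset y"
      using b by (rule carrier_green_ringE)
    have "Poly_Mapping.keys (x + y) \<subseteq> iso_classes H" using keys_add[of x y] x y by blast
    then show ?thesis by (simp only: x y coset_add gdual_coset keys_fdual fdual_add)
  qed
  have mult: "gdual (a \<otimes>\<^bsub>?G\<^esub> b) = gdual b \<otimes>\<^bsub>?G\<^esub> gdual a" if a: "a \<in> carrier ?G" and b: "b \<in> carrier ?G" for a b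
  proof -
    obtain x where x: "Poly_Mapping.keys x \<subseteq> iso_classes H" "a = coset x"
      using a by (rule carrier_green_ringE)
    obtain y where y: "Poly_Mapping.keys y \<subseteq> iso_classes H" "b = coset y"
      using b by (rule carrier_green_ringE)
    show ?thesis by (simp only: x y coset_mult gdual_coset keys_fdual keys_fmul fdual_fmul)
  qed
  have "cl (hmod_dual H (hmod_trivial H)) = cl (hmod_trivial H)"
    by (intro cl_eqI trivial_dual_iso hmodule_dual hmodule_trivial)
  then have one: "gdual \<one>\<^bsub>?G\<^esub> = \<one>\<^bsub>?G\<^esub>"
    by (simp only: coset_one gdual_coset keys_frag_of_cl hmodule_trivial fdual_cl)
  have invol: "gdual (gdual a) = a" if "a \<in> carrier ?G" for a
    using that by (elim carrier_green_ringE) (simp only: gdual_coset keys_fdual fdual_involution)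
  show ?thesis
    unfolding anti_involution_def by (intro conjI ballI Pi_I closed add mult one invol)
qed

lemma gdim_ring_hom: "gdim \<in> ring_hom (green_ring H) \<Z>"
proof (rule ring_hom_memI)
  let ?G = "green_ring H"
  fix a b assume a: "a \<in> carrier ?G" and b: "b \<in> carrier ?G"
  obtain x where x: "Poly_Mapping.keys x \<subseteq> iso_classes H" "a = coset x"
    using a by (rule carrier_green_ringE)
  obtain y where y: "Poly_Mapping.keys y \<subseteq> iso_classes H" "b = coset y"
    using b by (rule carrier_green_ringE)
  have "Poly_Mapping.keys (x + y) \<subseteq> iso_classes H" using keys_add[of x y] x y by blast
  then have "gdim (a \<oplus>\<^bsub>?G\<^esub> b) = gdim a + gdim b"
    by (simp only: x y coset_add gdim_coset fdim_add)
  then show "gdim (a \<oplus>\<^bsub>?G\<^esub> b) = gdim a \<oplus>\<^bsub>\<Z>\<^esub> gdim b" by simp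
  have "gdim (a \<otimes>\<^bsub>?G\<^esub> b) = gdim a * gdim b"
    by (simp only: x y coset_mult gdim_coset keys_fmul fdim_fmul)
  then show "gdim (a \<otimes>\<^bsub>?G\<^esub> b) = gdim a \<otimes>\<^bsub>\<Z>\<^esub> gdim b" by simp
next
  have "gdim \<one>\<^bsub>green_ring H\<^esub> = 1"
    by (simp only: coset_one gdim_coset keys_frag_of_cl hmodule_trivial fdim_cl) simp
  then show "gdim \<one>\<^bsub>green_ring H\<^esub> = \<one>\<^bsub>\<Z>\<^esub>" by simp
qed simp

lemma gdim_green_class: "hmodule H V \<Longrightarrow> gdim (green_class H (cl V)) = int (fst V)"
  by (simp only: green_class_coset gdim_coset keys_frag_of_cl fdim_cl)

lemma dec_ext_frag_cmul: "dec_ext (frag_cmul k x) = frag_cmul k (dec_ext x)"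
  by (simp add: dec_ext_def frag_extend_cmul)

text \<open>For the class of a module V the identity says that tensoring the regular module with V
  gives \<open>fst V\<close> copies of it. Both sides are additive in \<open>x\<close>, so this case
  suffices.\<close>

lemma exists_regular_element:
  assumes fd: "finite_dimensional_over H"
  obtains r where "hmodule H r" "fst r \<noteq> 0"
    "\<And>x. Poly_Mapping.keys x \<subseteq> iso_classes H \<Longrightarrow>
      coset (frag_of (cl r)) \<otimes>\<^bsub>green_ring H\<^esub> coset x = [gdim (coset x)] \<cdot>\<^bsub>green_ring H\<^esub> coset (frag_of (cl r))"
proof -
  obtain B where B: "finite_dimensional_vector_space (hscale H) B"
    using fd by (auto simp: finite_dimensional_over_def)
  \<comment> \<open>H acting on itself by left multiplication, put into coordinates.\<close>
  obtain n \<rho> \<phi> where reg: "hmodule H (n, \<rho>)" "bij_betw \<phi> UNIV (carrier_vec n)"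
    "\<And>v w. \<phi> (v + w) = \<phi> v + \<phi> w" "\<And>c v. \<phi> (hscale H c v) = c \<cdot>\<^sub>v \<phi> v"
    "\<And>h v. \<phi> (h * v) = \<rho> h *\<^sub>v \<phi> v"
    by (rule fd_module_iso_hmodule[OF B, of "(*)" H])
      (simp_all add: distrib_left distrib_right mult.assoc scale_mult_left[symmetric] scale_mult_right[symmetric])
  interpret R: regular_module H n \<rho> \<phi>
    by unfold_locales (use reg in auto)
  note R = R.regular
  \<comment> \<open>In dimension 0 the injective coordinate map would identify 0 and 1 in H.\<close>
  have "n \<noteq> 0"
  proof
    assume "n = 0"
    then have "\<phi> 0 = \<phi> 1" using R.\<phi>_carrier by (intro eq_vecI) (metis carrier_vecD less_nat_zero_code, metis carrier_vecD)
    moreover have "inj \<phi>" using reg(2) by (rule bij_betw_imp_inj_on)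
    ultimately have "(0 :: 'h) = 1" by (simp add: inj_eq)
    then show False by simp
  qed
  have "dec_ext (fmul (frag_of (cl (n, \<rho>))) x) = dec_ext (frag_cmul (fdim x) (frag_of (cl (n, \<rho>))))"
    if "Poly_Mapping.keys x \<subseteq> iso_classes H" for x
    using that
  proof (induction x rule: frag_iso_class_induct)
    case zero
    then show ?case by (simp only: fmul_zero fdim_zero frag_cmul_zero)
  next
    case (iso_class V)
    note m = hmodule_tensor[OF R iso_class] hmodule_tensor[OF R hmodule_trivial_power[of "fst V"]]
    have "dec (hmod_tensor H (n, \<rho>) V) = frag_cmul (int (fst V)) (dec (n, \<rho>))"
      using dec_iso[OF R.regular_tensor_iso[OF iso_class] m(2,1)] dec_tensor_trivial_power[OF R, of "fst V"] by simp
    then show ?case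
      by (simp only: fmul_cl R iso_class dec_ext_cl m dec_ext_frag_cmul fdim_cl)
  next
    case (diff a b)
    then show ?case by (simp only: fmul_diff_right fdim_diff frag_cmul_diff_distrib dec_ext_diff)
  qed
  then have "coset (frag_of (cl (n, \<rho>))) \<otimes>\<^bsub>green_ring H\<^esub> coset x =
      [gdim (coset x)] \<cdot>\<^bsub>green_ring H\<^esub> coset (frag_of (cl (n, \<rho>)))"
    if "Poly_Mapping.keys x \<subseteq> iso_classes H" for x
    by (simp only: that coset_mult keys_frag_of_cl R gdim_coset coset_add_pow coset_eq_iff keys_fmul keys_frag_cmul_subset)
  with R \<open>n \<noteq> 0\<close> that show thesis by simp
qed

theorem benson_representation_ring_green_ring:
  assumes fd: "finite_dimensional_over H"
    and comm: "\<forall>a \<in> carrier (green_ring H). \<forall>b \<in> carrier (green_ring H).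
      a \<otimes>\<^bsub>green_ring H\<^esub> b = b \<otimes>\<^bsub>green_ring H\<^esub> a"
  shows "benson_representation_ring (green_ring H) (indec_classes H) (green_class H)"
proof -
  let ?G = "green_ring H" and ?I = "indec_classes H" and ?x = "green_class H" and ?k = "hmod_trivial H"
  interpret G: ring ?G by (rule ring_green_ring)
  have cring: "cring ?G"
    by (intro cring.intro G.ring_axioms comm_monoid.intro comm_monoid_axioms.intro) (use G.monoid_axioms comm in auto)
  have indecE: thesis if "i \<in> ?I" "\<And>V. indecomposable H V \<Longrightarrow> i = cl V \<Longrightarrow> thesis" for i thesis
    using that unfolding indec_classes_def by blast
  have nonneg: "0 \<le> zcoeff ?G ?I ?x (?x i \<otimes>\<^bsub>?G\<^esub> ?x j) l" if ij: "i \<in> ?I" "j \<in> ?I" for i j l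
  proof -
    obtain V W where V: "indecomposable H V" "i = cl V" and W: "indecomposable H W" "j = cl W"
      using ij by (elim indecE)
    note m = indecomposableD(1)[OF V(1)] indecomposableD(1)[OF W(1)]
    show ?thesis
      unfolding V(2) W(2) green_class_mult[OF m] zcoeff_green_class[OF hmodule_tensor[OF m]]
      by (rule lookup_dec_nonneg)
  qed
  have star: "class_dual H i \<in> ?I \<and> class_dual H (class_dual H i) = i \<and> gdual (?x i) = ?x (class_dual H i)"
    if i: "i \<in> ?I" for i
  proof -
    obtain V where V: "indecomposable H V" "i = cl V" using i by (elim indecE)
    note m = indecomposableD(1)[OF V(1)]
    show ?thesis
      unfolding V(2) class_dual_involution[OF m] unfolding class_dual_cl[OF m]
      by (simp only: green_class_coset gdual_coset keys_frag_of_cl m fdual_cl cl_in_indec_classes indecomposable_dual V(1))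
  qed
  have ii: "j = class_dual H i"
    if ij: "i \<in> ?I" "j \<in> ?I" and pos: "0 < zcoeff ?G ?I ?x (?x i \<otimes>\<^bsub>?G\<^esub> ?x j) (cl ?k)" for i j
  proof -
    obtain V W where V: "indecomposable H V" "i = cl V" and W: "indecomposable H W" "j = cl W"
      using ij by (elim indecE)
    note m = indecomposableD(1)[OF V(1)] indecomposableD(1)[OF W(1)]
    have "0 < Poly_Mapping.lookup (dec (hmod_tensor H V W)) (cl ?k)"
      using pos unfolding V(2) W(2) green_class_mult[OF m] zcoeff_green_class[OF hmodule_tensor[OF m]] .
    then have "hmod_summand ?k (hmod_tensor H V W)"
      by (rule summand_if_lookup_dec_pos[OF hmodule_tensor[OF m] hmodule_trivial])
    then have "hmod_iso W (hmod_dual H V)" by (rule trivial_summand_tensor[OF V(1) W(1)])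
    then have "cl W = cl (hmod_dual H V)" by (rule cl_eqI[OF m(2) hmodule_dual[OF m(1)]])
    then show ?thesis unfolding V(2) W(2) class_dual_cl[OF m(1)] .
  qed
  have iii: "2 \<le> zcoeff ?G ?I ?x (?x i \<otimes>\<^bsub>?G\<^esub> ?x (class_dual H i) \<otimes>\<^bsub>?G\<^esub> ?x i) i"
    if i: "i \<in> ?I" and zero: "zcoeff ?G ?I ?x (?x i \<otimes>\<^bsub>?G\<^esub> ?x (class_dual H i)) (cl ?k) = 0" for i
  proof -
    obtain V where V: "indecomposable H V" "i = cl V" using i by (elim indecE)
    note m = indecomposableD(1)[OF V(1)]
    let ?M = "hmod_tensor H V (hmod_dual H V)"
    have M: "hmodule H ?M" by (intro hmodule_tensor hmodule_dual m)
    have p: "?x (cl V) \<otimes>\<^bsub>?G\<^esub> ?x (class_dual H (cl V)) = ?x (cl ?M)"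
      unfolding class_dual_cl[OF m] by (rule green_class_mult[OF m hmodule_dual[OF m]])
    have "Poly_Mapping.lookup (dec ?M) (cl ?k) = 0"
      using zero unfolding V(2) p zcoeff_green_class[OF M] .
    then have "\<not> hmod_summand ?k ?M"
      using lookup_dec_pos_if_summand[OF M indecomposable_trivial] by auto
    then obtain W where W: "hmodule H W" and iso: "hmod_iso (hmod_tensor H ?M V) (hmod_sum V (hmod_sum V W))"
      using double_summand[OF m] by blast
    have "dec (hmod_tensor H ?M V) = dec (hmod_sum V (hmod_sum V W))"
      by (rule dec_iso[OF iso hmodule_tensor[OF M m] hmodule_sum[OF m hmodule_sum[OF m W]]])
    also have "\<dots> = frag_of (cl V) + (frag_of (cl V) + dec W)"
      by (simp only: dec_sum m W hmodule_sum dec_indecomposable[OF V(1)])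
    finally have "2 \<le> Poly_Mapping.lookup (dec (hmod_tensor H ?M V)) (cl V)"
      using lookup_dec_nonneg[of W "cl V"] by (simp add: lookup_add)
    then show ?thesis
      unfolding V(2) p green_class_mult[OF M m] zcoeff_green_class[OF hmodule_tensor[OF M m]] .
  qed
  have iv: "gdim (?x i) = gdim (?x (class_dual H i)) \<and> 0 < gdim (?x i)" if i: "i \<in> ?I" for i
  proof -
    obtain V where V: "indecomposable H V" "i = cl V" using i by (elim indecE)
    note m = indecomposableD(1)[OF V(1)]
    show ?thesis
      unfolding V(2) class_dual_cl[OF m] gdim_green_class[OF m] gdim_green_class[OF hmodule_dual[OF m]]
      using indecomposableD(2)[OF V(1)] by simp
  qed
  obtain r where r: "hmodule H r" "fst r \<noteq> 0"
    and r_mult: "\<And>x. Poly_Mapping.keys x \<subseteq> iso_classes H \<Longrightarrow>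
      coset (frag_of (cl r)) \<otimes>\<^bsub>?G\<^esub> coset x = [gdim (coset x)] \<cdot>\<^bsub>?G\<^esub> coset (frag_of (cl r))"
    by (rule exists_regular_element[OF fd]) (rule that)
  let ?r = "coset (frag_of (cl r))"
  have r_carrier: "?r \<in> carrier ?G" by (intro coset_in_carrier keys_frag_of_cl r)
  \<comment> \<open>The dimension distinguishes the regular class from zero.\<close>
  have "gdim ?r \<noteq> gdim \<zero>\<^bsub>?G\<^esub>"
    using r(2) gdim_coset[OF keys_frag_of_cl[OF r(1)]] fdim_cl[OF r(1)] by (simp add: coset_zero gdim_coset)
  then have r_nonzero: "?r \<noteq> \<zero>\<^bsub>?G\<^esub>" by metis
  have r_nonneg: "0 \<le> zcoeff ?G ?I ?x ?r i" for i
    unfolding green_class_coset[symmetric] zcoeff_green_class[OF r(1)] by (rule lookup_dec_nonneg)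
  have v: "a \<otimes>\<^bsub>?G\<^esub> ?r = [gdim a] \<cdot>\<^bsub>?G\<^esub> ?r" if a: "a \<in> carrier ?G" for a
  proof -
    have "a \<otimes>\<^bsub>?G\<^esub> ?r = ?r \<otimes>\<^bsub>?G\<^esub> a" using comm a r_carrier by blast
    with a show ?thesis by (elim carrier_green_ringE) (simp only: r_mult)
  qed
  have one: "?x (cl ?k) = \<one>\<^bsub>?G\<^esub>" by (simp only: green_class_coset coset_one)
  show ?thesis
    unfolding benson_representation_ring_def
  proof (intro conjI)
    show "\<exists>i\<^sub>0 \<in> ?I. ?x i\<^sub>0 = \<one>\<^bsub>?G\<^esub> \<and>
       (\<exists>star dm.
         (\<forall>i\<in>?I. star i \<in> ?I \<and> star (star i) = i) \<and>
         (\<exists>\<phi>. anti_involution ?G \<phi> \<and> (\<forall>i\<in>?I. \<phi> (?x i) = ?x (star i))) \<and>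
         (\<forall>i\<in>?I. \<forall>j\<in>?I. 0 < zcoeff ?G ?I ?x (?x i \<otimes>\<^bsub>?G\<^esub> ?x j) i\<^sub>0 \<longrightarrow> j = star i) \<and>
         (\<forall>i\<in>?I. zcoeff ?G ?I ?x (?x i \<otimes>\<^bsub>?G\<^esub> ?x (star i)) i\<^sub>0 = 0 \<longrightarrow>
            2 \<le> zcoeff ?G ?I ?x (?x i \<otimes>\<^bsub>?G\<^esub> ?x (star i) \<otimes>\<^bsub>?G\<^esub> ?x i) i) \<and>
         dm \<in> ring_hom ?G \<Z> \<and>
         (\<forall>i\<in>?I. dm (?x i) = dm (?x (star i)) \<and> 0 < dm (?x i)) \<and>
         (\<exists>r \<in> carrier ?G. r \<noteq> \<zero>\<^bsub>?G\<^esub> \<and> (\<forall>i\<in>?I. 0 \<le> zcoeff ?G ?I ?x r i) \<and>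
            (\<forall>a \<in> carrier ?G. a \<otimes>\<^bsub>?G\<^esub> r = [dm a] \<cdot>\<^bsub>?G\<^esub> r)))"
    proof (rule bexI[of _ "cl ?k"], rule conjI[OF one], rule exI[of _ "class_dual H"], rule exI[of _ gdim],
        intro conjI)
      show "\<exists>\<phi>. anti_involution ?G \<phi> \<and> (\<forall>i\<in>?I. \<phi> (?x i) = ?x (class_dual H i))"
        using star by (intro exI[of _ gdual] conjI ballI anti_involution_gdual) simp
      show "\<exists>r \<in> carrier ?G. r \<noteq> \<zero>\<^bsub>?G\<^esub> \<and> (\<forall>i\<in>?I. 0 \<le> zcoeff ?G ?I ?x r i) \<and>
            (\<forall>a \<in> carrier ?G. a \<otimes>\<^bsub>?G\<^esub> r = [gdim a] \<cdot>\<^bsub>?G\<^esub> r)"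
        by (intro bexI[OF _ r_carrier] conjI ballI r_nonzero r_nonneg v)
      show "\<forall>i\<in>?I. \<forall>j\<in>?I. 0 < zcoeff ?G ?I ?x (?x i \<otimes>\<^bsub>?G\<^esub> ?x j) (cl ?k) \<longrightarrow> j = class_dual H i"
        by (intro ballI impI ii)
      show "\<forall>i\<in>?I. zcoeff ?G ?I ?x (?x i \<otimes>\<^bsub>?G\<^esub> ?x (class_dual H i)) (cl ?k) = 0 \<longrightarrow>
          2 \<le> zcoeff ?G ?I ?x (?x i \<otimes>\<^bsub>?G\<^esub> ?x (class_dual H i) \<otimes>\<^bsub>?G\<^esub> ?x i) i"
        by (intro ballI impI iii)
      show "\<forall>i\<in>?I. class_dual H i \<in> ?I \<and> class_dual H (class_dual H i) = i"
        using star by blast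
      show "\<forall>i\<in>?I. gdim (?x i) = gdim (?x (class_dual H i)) \<and> 0 < gdim (?x i)"
        by (intro ballI iv)
      show "gdim \<in> ring_hom ?G \<Z>" by (rule gdim_ring_hom)
      show "cl ?k \<in> ?I" by (rule cl_in_indec_classes[OF indecomposable_trivial])
    qed
    show "\<forall>i\<in>?I. \<forall>j\<in>?I. \<forall>l\<in>?I. 0 \<le> zcoeff ?G ?I ?x (?x i \<otimes>\<^bsub>?G\<^esub> ?x j) l"
      by (intro ballI nonneg)
  qed (rule cring zbasis_green_ring)+
qed

end

theorem theorem2p9:
  fixes H :: "('k::alg_closed_field, 'h::ring_1) hopf_data"
  assumes "hopf_algebra H"
    and "finite_dimensional_over H"
    and "\<not> semisimple_ring TYPE('h)"
    and "\<forall>a \<in> carrier (green_ring H). \<forall>b \<in> carrier (green_ring H).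
           a \<otimes>\<^bsub>green_ring H\<^esub> b = b \<otimes>\<^bsub>green_ring H\<^esub> a"
    and "inner_automorphism (antipode H \<circ> antipode H)"
    and "I_max H = I_proj H"
  shows "benson_representation_ring (green_ring H) (indec_classes H) (green_class H)"
proof -
  obtain u v where "u * v = 1" "v * u = 1" "\<And>h. antipode H (antipode H h) = u * h * v"
    using assms(5) by (auto simp: inner_automorphism_def)
  then have "hopf_algebra_inner H u v"
    using assms(1) by (simp add: hopf_algebra_inner_def hopf_algebra_inner_axioms_def)
  then show ?thesis
    using hopf_algebra_inner.benson_representation_ring_green_ring assms(2,4) by blast
qed

end
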